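(* Let $I\subset\mathbb{R}$ be an interval, let $\Omega\subset I\times I$ be a serrated domain, and let $K_\Omega$ be a partial covariance on $\Omega$ with canonical completion $K_\star$. Then $K_\star$ is the only completion of $K_\Omega$ such that the associated (mean-zero) Gaussian process $\{X_t:t\in I\}$ forms an undirected graphical model with respect to the graph $(I,\Omega)$; that is, the mean-zero Gaussian process with covariance $K_\star$ forms an undirected graphical model over $\Omega$, and if $K$ is a completion of $K_\Omega$ whose mean-zero Gaussian process forms an undirected graphical model over $\Omega$, then $K=K_\star$.
   Context: A covariance on a set $S$ is a symmetric function $K:S\times S\to\mathbb{R}$ with $\sum_{i,j=1}^n\alpha_i\alpha_jK(t_i,t_j)\ge 0$ for all $n\ge1$, $t_i\in S$, $\alpha_i\in\mathbb{R}$. A serrated domain is $\Omega=\bigcup_{j=1}^m (I_j\times I_j)$ with $\{I_j\}$ a finite collection of (nonempty) subintervals covering $I$, indexed in natural order: for $p<q$ every point of $I_p\setminus I_q$ lies to the left of every point of $I_q$ and every point of $I_q\setminus I_p$ lies to the right of every point of $I_p$. A partial covariance on $\Omega$ is a function $K_\Omega:\Omega\to\mathbb{R}$ such that $K_\Omega|_{J\times J}$ is a covariance on $J$ whenever $J\subset I$ and $J\times J\subset\Omega$. A completion of $K_\Omega$ is a covariance $K$ on $I$ with $K|_\Omega=K_\Omega$. $\mathscr{H}(K_J)$ is the reproducing kernel Hilbert space of a covariance $K_J$ on $J$ ($\mathscr{H}(K_\emptyset)=\{0\}$), and functions inside its inner product are restricted to $J$. Canonical completion: put $J_p=I_p\cap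 I_{p+1}$, $\Omega_p=\big(\bigcup_{j\le p}I_j\big)^2\cup\bigcup_{j>p}(I_j\times I_j)$, $K_1=K_\Omega$ on $\Omega_1=\Omega$, and for $p=1,\dots,m-1$ let $K_{p+1}=K_p$ on $\Omega_p$ and $K_{p+1}(s,t)=\langle K_p(s,\cdot),K_p(\cdot,t)\rangle_{\mathscr{H}(K_{J_p})}$ for $(s,t)\in\Omega_{p+1}\setminus\Omega_p$, where $K_{J_p}=K_\Omega|_{J_p\times J_p}$. Then $K_\star=K_m$ on $\Omega_m=I\times I$. A set $J\subset I$ separates $s,t\in I$ with respect to the graph $(I,\Omega)$ (vertex set $I$, edge set $\Omega$) if for every finite sequence $t_1=s,t_2,\dots,t_r=t$ in $I$ ($r\ge1$) with $(t_i,t_{i+1})\in\Omega$ for $1\le i<r$, there is $1<j<r$ with $t_j\in J$. A Gaussian process $X=\{X_t:t\in I\}$ forms an undirected graphical model over $\Omega$ if for every $s,t\in I$ separated by $J\subset I$, with $X_J=\{X_u:u\in J\}$, $$\mathbb{E}\big[(X_s-\mathbb{E}[X_s|X_J])(X_t-\mathbb{E}[X_t|X_J])\,\big|\,X_J\big]=0\quad\text{a.s.}$$ *)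

theory Defs
  imports "HOL-Probability.Probability"
begin

section \<open>Covariances\<close>

text \<open>Kernels are total functions; only their values on the set named in a predicate matter.\<close>

definition covariance_on :: "'a set \<Rightarrow> ('a \<Rightarrow> 'a \<Rightarrow> real) \<Rightarrow> bool" where
  "covariance_on S K \<longleftrightarrow>
     (\<forall>s\<in>S. \<forall>t\<in>S. K s t = K t s) \<and>
     (\<forall>(n::nat) (t::nat \<Rightarrow> 'a) (\<alpha>::nat \<Rightarrow> real). 1 \<le> n \<and> (\<forall>i\<in>{1..n}. t i \<in> S) \<longrightarrow>
        0 \<le> (\<Sum>i=1..n. \<Sum>j=1..n. \<alpha> i * \<alpha> j * K (t i) (t j)))"

definition partial_covariance :: "'a set \<Rightarrow> ('a \<times> 'a) set \<Rightarrow> ('a \<Rightarrow> 'a \<Rightarrow> real) \<Rightarrow> bool" where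
  "partial_covariance I \<Omega> K \<longleftrightarrow> (\<forall>J. J \<subseteq> I \<and> J \<times> J \<subseteq> \<Omega> \<longrightarrow> covariance_on J K)"

definition is_completion ::
    "'a set \<Rightarrow> ('a \<times> 'a) set \<Rightarrow> ('a \<Rightarrow> 'a \<Rightarrow> real) \<Rightarrow> ('a \<Rightarrow> 'a \<Rightarrow> real) \<Rightarrow> bool" where
  "is_completion I \<Omega> K\<^sub>\<Omega> K \<longleftrightarrow> covariance_on I K \<and> (\<forall>(s, t)\<in>\<Omega>. K s t = K\<^sub>\<Omega> s t)"


section \<open>Serrated domains\<close>

text \<open>The intervals are \<open>Is 1, \<dots>, Is m\<close>; other values of \<open>Is\<close> are irrelevant.
  The case \<open>m = 0\<close> occurs only for \<open>I = {}\<close>.\<close>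

definition serrated_cover :: "real set \<Rightarrow> nat \<Rightarrow> (nat \<Rightarrow> real set) \<Rightarrow> bool" where
  "serrated_cover I m Is \<longleftrightarrow>
     (\<forall>j\<in>{1..m}. is_interval (Is j) \<and> Is j \<noteq> {} \<and> Is j \<subseteq> I) \<and>
     (\<Union>j\<in>{1..m}. Is j) = I \<and>
     (\<forall>p\<in>{1..m}. \<forall>q\<in>{1..m}. p < q \<longrightarrow>
        (\<forall>x\<in>Is p - Is q. \<forall>y\<in>Is q. x < y) \<and>
        (\<forall>x\<in>Is q - Is p. \<forall>y\<in>Is p. y < x))"

definition serrated_domain :: "nat \<Rightarrow> (nat \<Rightarrow> real set) \<Rightarrow> (real \<times> real) set" where
  "serrated_domain m Is = (\<Union>j\<in>{1..m}. Is j \<times> Is j)"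


section \<open>Reproducing kernel Hilbert spaces\<close>

text \<open>A function on \<open>J\<close> is represented by its extension by zero, so that functions on \<open>J\<close>
  form a vector space under the pointwise operations.\<close>

definition zero_ext :: "'a set \<Rightarrow> ('a \<Rightarrow> real) \<Rightarrow> 'a \<Rightarrow> real" where
  "zero_ext J f = (\<lambda>u. if u \<in> J then f u else 0)"

locale rkhs =
  fixes J :: "'a set" and K :: "'a \<Rightarrow> 'a \<Rightarrow> real"
    and H :: "('a \<Rightarrow> real) set" and ip :: "('a \<Rightarrow> real) \<Rightarrow> ('a \<Rightarrow> real) \<Rightarrow> real"
  assumes zero_off: "f \<in> H \<Longrightarrow> u \<notin> J \<Longrightarrow> f u = 0"
    and zero_mem: "(\<lambda>u. 0) \<in> H"
    and add_mem: "f \<in> H \<Longrightarrow> g \<in> H \<Longrightarrow> (\<lambda>u. f u + g u) \<in> H"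
    and scale_mem: "f \<in> H \<Longrightarrow> (\<lambda>u. c * f u) \<in> H"
    and ip_sym: "f \<in> H \<Longrightarrow> g \<in> H \<Longrightarrow> ip f g = ip g f"
    and ip_add: "f \<in> H \<Longrightarrow> g \<in> H \<Longrightarrow> h \<in> H \<Longrightarrow> ip (\<lambda>u. f u + g u) h = ip f h + ip g h"
    and ip_scale: "f \<in> H \<Longrightarrow> g \<in> H \<Longrightarrow> ip (\<lambda>u. c * f u) g = c * ip f g"
    and ip_nonneg: "f \<in> H \<Longrightarrow> 0 \<le> ip f f"
    and ip_definite: "f \<in> H \<Longrightarrow> ip f f = 0 \<Longrightarrow> f = (\<lambda>u. 0)"
    and ip_complete:
      "(\<And>n. \<sigma> n \<in> H) \<Longrightarrow>
       (\<And>\<epsilon>. 0 < \<epsilon> \<Longrightarrow> \<exists>N. \<forall>m\<ge>N. \<forall>n\<ge>N.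
          sqrt (ip (\<lambda>u. \<sigma> m u - \<sigma> n u) (\<lambda>u. \<sigma> m u - \<sigma> n u)) < \<epsilon>) \<Longrightarrow>
       \<exists>f\<in>H. (\<lambda>n. sqrt (ip (\<lambda>u. \<sigma> n u - f u) (\<lambda>u. \<sigma> n u - f u))) \<longlonglongrightarrow> 0"
    and kernel_mem: "t \<in> J \<Longrightarrow> zero_ext J (K t) \<in> H"
    and reproducing: "f \<in> H \<Longrightarrow> t \<in> J \<Longrightarrow> ip f (zero_ext J (K t)) = f t"

text \<open>The space \<open>H\<close>, and \<open>ip\<close> on it, are determined by \<open>J\<close> and by the covariance \<open>K\<close> on \<open>J\<close>
  (Moore--Aronszajn), so the description below is proper whenever \<open>f\<close> and \<open>g\<close>, restricted
  to \<open>J\<close>, belong to the space.\<close>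

definition rkhs_inner ::
    "'a set \<Rightarrow> ('a \<Rightarrow> 'a \<Rightarrow> real) \<Rightarrow> ('a \<Rightarrow> real) \<Rightarrow> ('a \<Rightarrow> real) \<Rightarrow> real" where
  "rkhs_inner J K f g =
     (THE r. \<exists>H ip. rkhs J K H ip \<and> zero_ext J f \<in> H \<and> zero_ext J g \<in> H \<and>
                    r = ip (zero_ext J f) (zero_ext J g))"


section \<open>The canonical completion\<close>

definition stage_domain :: "nat \<Rightarrow> (nat \<Rightarrow> real set) \<Rightarrow> nat \<Rightarrow> (real \<times> real) set" where
  "stage_domain m Is p =
     (\<Union>j\<in>{1..p}. Is j) \<times> (\<Union>j\<in>{1..p}. Is j) \<union> (\<Union>j\<in>{p<..m}. Is j \<times> Is j)"

text \<open>The index is shifted: \<open>canonical_stage m Is K\<^sub>\<Omega> n\<close> is the kernel \<open>K\<^bsub>n+1\<^esub>\<close>, the completion up to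
  the union of the first \<open>n + 1\<close> intervals.\<close>

primrec canonical_stage ::
    "nat \<Rightarrow> (nat \<Rightarrow> real set) \<Rightarrow> (real \<Rightarrow> real \<Rightarrow> real) \<Rightarrow> nat \<Rightarrow> real \<Rightarrow> real \<Rightarrow> real" where
  "canonical_stage m Is K\<^sub>\<Omega> 0 = K\<^sub>\<Omega>"
| "canonical_stage m Is K\<^sub>\<Omega> (Suc n) =
     (let p = Suc n; K\<^sub>p = canonical_stage m Is K\<^sub>\<Omega> n in
      (\<lambda>s t. if (s, t) \<in> stage_domain m Is (p + 1) - stage_domain m Is p
             then rkhs_inner (Is p \<inter> Is (p + 1)) K\<^sub>\<Omega> (\<lambda>u. K\<^sub>p s u) (\<lambda>u. K\<^sub>p u t)
             else K\<^sub>p s t))"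

definition canonical_completion ::
    "nat \<Rightarrow> (nat \<Rightarrow> real set) \<Rightarrow> (real \<Rightarrow> real \<Rightarrow> real) \<Rightarrow> real \<Rightarrow> real \<Rightarrow> real" where
  "canonical_completion m Is K\<^sub>\<Omega> = canonical_stage m Is K\<^sub>\<Omega> (m - 1)"


section \<open>Gaussian processes and undirected graphical models\<close>

text \<open>Degenerate (almost surely constant) variables count as Gaussian.\<close>

definition gaussian_rv :: "'w measure \<Rightarrow> ('w \<Rightarrow> real) \<Rightarrow> bool" where
  "gaussian_rv M Y \<longleftrightarrow> Y \<in> borel_measurable M \<and>
     ((\<exists>\<mu>. AE \<omega> in M. Y \<omega> = \<mu>) \<or>
      (\<exists>\<mu> \<sigma>. 0 < \<sigma> \<and> distributed M lborel Y (\<lambda>x. ennreal (normal_density \<mu> \<sigma> x))))"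

definition gaussian_process :: "'w measure \<Rightarrow> 'a set \<Rightarrow> ('a \<Rightarrow> 'w \<Rightarrow> real) \<Rightarrow> bool" where
  "gaussian_process M I X \<longleftrightarrow> prob_space M \<and> (\<forall>t\<in>I. X t \<in> borel_measurable M) \<and>
     (\<forall>(n::nat) (t::nat \<Rightarrow> 'a) (\<alpha>::nat \<Rightarrow> real). (\<forall>i\<in>{1..n}. t i \<in> I) \<longrightarrow>
        gaussian_rv M (\<lambda>\<omega>. \<Sum>i=1..n. \<alpha> i * X (t i) \<omega>))"

definition mean_zero_gaussian_process ::
    "'w measure \<Rightarrow> 'a set \<Rightarrow> ('a \<Rightarrow> 'w \<Rightarrow> real) \<Rightarrow> ('a \<Rightarrow> 'a \<Rightarrow> real) \<Rightarrow> bool" where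
  "mean_zero_gaussian_process M I X K \<longleftrightarrow> gaussian_process M I X \<and>
     (\<forall>t\<in>I. integral\<^sup>L M (X t) = 0) \<and>
     (\<forall>s\<in>I. \<forall>t\<in>I. integral\<^sup>L M (\<lambda>\<omega>. X s \<omega> * X t \<omega>) = K s t)"

definition separates :: "'a set \<Rightarrow> ('a \<times> 'a) set \<Rightarrow> 'a set \<Rightarrow> 'a \<Rightarrow> 'a \<Rightarrow> bool" where
  "separates I \<Omega> J s t \<longleftrightarrow>
     (\<forall>(r::nat) (\<tau>::nat \<Rightarrow> 'a).
        1 \<le> r \<and> (\<forall>i\<in>{1..r}. \<tau> i \<in> I) \<and> \<tau> 1 = s \<and> \<tau> r = t \<and>
        (\<forall>i. 1 \<le> i \<and> i < r \<longrightarrow> (\<tau> i, \<tau> (i + 1)) \<in> \<Omega>) \<longrightarrow>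
        (\<exists>j. 1 < j \<and> j < r \<and> \<tau> j \<in> J))"

text \<open>The sigma-algebra generated by the family \<open>X\<^sub>J\<close>, regarded as a random element of the
  product space over \<open>J\<close>.\<close>

definition generated_algebra ::
    "'w measure \<Rightarrow> ('a \<Rightarrow> 'w \<Rightarrow> real) \<Rightarrow> 'a set \<Rightarrow> 'w measure" where
  "generated_algebra M X J =
     vimage_algebra (space M) (\<lambda>\<omega>. \<lambda>u\<in>J. X u \<omega>) (PiM J (\<lambda>_. borel))"

definition undirected_graphical_model ::
    "'w measure \<Rightarrow> 'a set \<Rightarrow> ('a \<times> 'a) set \<Rightarrow> ('a \<Rightarrow> 'w \<Rightarrow> real) \<Rightarrow> bool" where
  "undirected_graphical_model M I \<Omega> X \<longleftrightarrow>
     (\<forall>s\<in>I. \<forall>t\<in>I. \<forall>J. J \<subseteq> I \<and> separates I \<Omega> J s t \<longrightarrow>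
        (let F = generated_algebra M X J in
         AE \<omega> in M. real_cond_exp M F
           (\<lambda>\<omega>. (X s \<omega> - real_cond_exp M F (X s) \<omega>) * (X t \<omega> - real_cond_exp M F (X t) \<omega>)) \<omega> = 0))"

end

theory Submission
  imports Defs
begin

text \<open>The theorem rests on translating the graphical condition into an identity for the kernel.
  For a centred Gaussian process with covariance \<open>K\<close>, the conditional expectation of \<open>X\<^sub>s\<close> given
  \<open>X\<^sub>J\<close> is the orthogonal projection of \<open>X\<^sub>s\<close> onto the closed span of \<open>X\<^sub>J\<close> in \<open>L\<^sup>2\<close>, and the
  residual is independent of \<open>X\<^sub>J\<close>. The conditional covariance of \<open>X\<^sub>s\<close> and \<open>X\<^sub>t\<close> is therefore the
  constant \<open>K(s,t) - \<langle>K\<^sub>s, K\<^sub>t\<rangle>\<close>, with the inner product of the reproducing kernel space of \<open>K\<close> on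
  \<open>J\<close>. So the process is a graphical model exactly if \<open>K(s,t) = \<langle>K\<^sub>s, K\<^sub>t\<rangle>\<close> whenever \<open>J\<close>
  separates \<open>s\<close> from \<open>t\<close> (\<open>undirected_graphical_model_iff\<close>); this is the very formula by which
  the canonical completion is built, for the overlaps of consecutive intervals.

  \<^emph>\<open>Completion.\<close> Restricting a finite combination of kernel sections to a subset does not
  increase its norm. Hence two covariances glued along their common domain \<open>J\<close> by
  \<open>K(s,t) = \<langle>K\<^sub>s, K\<^sub>t\<rangle>\<close> satisfy \<open>Q \<ge> \<parallel>f\<parallel>\<^sup>2 + 2 \<langle>f, g\<rangle> + \<parallel>g\<parallel>\<^sup>2 \<ge> 0\<close> for the quadratic form
  \<open>Q\<close> of every finite combination, where \<open>f\<close> and \<open>g\<close> are the restrictions to \<open>J\<close> of the two halves (\<open>covariance_glue\<close>).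

  \<^emph>\<open>Uniqueness.\<close> An overlap separates the points to the left of an interval from the new points of
  that interval (\<open>overlap_separates\<close>), so the graphical condition forces the values of the kernel
  one stage after the other (\<open>completion_unique\<close>).

  \<^emph>\<open>Graphical model.\<close> If no overlap between \<open>s\<close> and \<open>t\<close> were contained in a separating set \<open>J\<close>,
  points of the overlaps outside \<open>J\<close> would form a path from \<open>s\<close> to \<open>t\<close> that avoids \<open>J\<close>. So \<open>J\<close>
  contains an overlap, and Hilbert space geometry carries the identity from the steps of the
  construction to the whole parts left and right of the overlap (\<open>cond_uncorrelated_chain\<close>) and
  from the overlap to the larger set \<open>J\<close> (\<open>cond_uncorrelated_enlarge\<close>).

  Throughout, the squared norm of a reproducing kernel space is used in the variational form
  \<open>\<parallel>f\<parallel>\<^sup>2 = sup (2 \<Sum> c\<^sub>x f(x) - \<Sum> \<Sum> c\<^sub>x c\<^sub>y K(x,y))\<close> over finite combinations, which makes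
  the parallelogram law, the reproducing property, completeness and the effect of restriction
  elementary consequences of the properties of a supremum.\<close>

section \<open>The energy of a function with respect to a covariance\<close>

definition quad :: "('a \<Rightarrow> 'a \<Rightarrow> real) \<Rightarrow> 'a set \<Rightarrow> ('a \<Rightarrow> real) \<Rightarrow> real" where
  "quad K F c = (\<Sum>x\<in>F. \<Sum>y\<in>F. c x * c y * K x y)"

text \<open>If \<open>h = \<Sum> c\<^sub>x K\<^sub>x\<close>, this is \<open>\<parallel>f\<parallel>\<^sup>2 - \<parallel>f - h\<parallel>\<^sup>2\<close> in the reproducing kernel space of \<open>K\<close>
  (compare \<open>dual_value_eq\<close>), so that its supremum over finite combinations is \<open>\<parallel>f\<parallel>\<^sup>2\<close>.\<close>

definition dual_value :: "('a \<Rightarrow> 'a \<Rightarrow> real) \<Rightarrow> ('a \<Rightarrow> real) \<Rightarrow> 'a set \<Rightarrow> ('a \<Rightarrow> real) \<Rightarrow> real" where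
  "dual_value K f F c = 2 * (\<Sum>x\<in>F. c x * f x) - quad K F c"

definition finite_energy :: "'a set \<Rightarrow> ('a \<Rightarrow> 'a \<Rightarrow> real) \<Rightarrow> ('a \<Rightarrow> real) \<Rightarrow> bool" where
  "finite_energy J K f \<longleftrightarrow> (\<exists>C. \<forall>F c. finite F \<and> F \<subseteq> J \<longrightarrow> dual_value K f F c \<le> C)"

definition energy :: "'a set \<Rightarrow> ('a \<Rightarrow> 'a \<Rightarrow> real) \<Rightarrow> ('a \<Rightarrow> real) \<Rightarrow> real" where
  "energy J K f = Sup {dual_value K f F c | F c. finite F \<and> F \<subseteq> J}"

text \<open>The polarisation formula: it becomes an inner product because the energy satisfies the
  parallelogram law.\<close>

definition energy_inner :: "'a set \<Rightarrow> ('a \<Rightarrow> 'a \<Rightarrow> real) \<Rightarrow> ('a \<Rightarrow> real) \<Rightarrow> ('a \<Rightarrow> real) \<Rightarrow> real" where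
  "energy_inner J K f g = (energy J K (\<lambda>u. f u + g u) - energy J K (\<lambda>u. f u - g u)) / 4"

lemma dual_value_empty [simp]: "dual_value K f {} c = 0"
  by (simp add: dual_value_def quad_def)

lemma finite_energyI:
  "(\<And>F c. finite F \<Longrightarrow> F \<subseteq> J \<Longrightarrow> dual_value K f F c \<le> C) \<Longrightarrow> finite_energy J K f"
  unfolding finite_energy_def by blast

lemma dual_value_le_energy:
  assumes "finite_energy J K f" "finite F" "F \<subseteq> J"
  shows "dual_value K f F c \<le> energy J K f"
  unfolding energy_def
proof (rule cSup_upper)
  show "dual_value K f F c \<in> {dual_value K f F c | F c. finite F \<and> F \<subseteq> J}"
    using assms by blast
  show "bdd_above {dual_value K f F c | F c. finite F \<and> F \<subseteq> J}"
    using assms(1) unfolding finite_energy_def bdd_above_def by blast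
qed

lemma energy_least:
  assumes "\<And>F c. finite F \<Longrightarrow> F \<subseteq> J \<Longrightarrow> dual_value K f F c \<le> C"
  shows "energy J K f \<le> C"
  unfolding energy_def using assms by (intro cSup_least) auto

lemma energy_nonneg: "finite_energy J K f \<Longrightarrow> 0 \<le> energy J K f"
  using dual_value_le_energy[of J K f "{}"] by simp

lemma dual_value_cong:
  assumes "\<And>x y. x \<in> F \<Longrightarrow> y \<in> F \<Longrightarrow> K x y = K' x y" "\<And>x. x \<in> F \<Longrightarrow> f x = f' x"
    "\<And>x. x \<in> F \<Longrightarrow> c x = c' x"
  shows "dual_value K f F c = dual_value K' f' F c'"
  unfolding dual_value_def quad_def using assms by (simp cong: sum.cong)

lemma energy_cong:
  assumes "\<And>x y. x \<in> J \<Longrightarrow> y \<in> J \<Longrightarrow> K x y = K' x y" "\<And>x. x \<in> J \<Longrightarrow> f x = f' x"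
  shows "energy J K f = energy J K' f'"
proof -
  have "dual_value K f F c = dual_value K' f' F c" if "F \<subseteq> J" for F c
    by (rule dual_value_cong) (use assms that in auto)
  then have "{dual_value K f F c | F c. finite F \<and> F \<subseteq> J} = {dual_value K' f' F c | F c. finite F \<and> F \<subseteq> J}"
    by metis
  then show ?thesis unfolding energy_def by simp
qed

lemma finite_energy_cong:
  assumes "\<And>x y. x \<in> J \<Longrightarrow> y \<in> J \<Longrightarrow> K x y = K' x y" "\<And>x. x \<in> J \<Longrightarrow> f x = f' x"
  shows "finite_energy J K f = finite_energy J K' f'"
proof -
  have "dual_value K f F c = dual_value K' f' F c" if "F \<subseteq> J" for F c
    by (rule dual_value_cong) (use assms that in auto)
  then show ?thesis unfolding finite_energy_def by metis
qed

lemma energy_inner_cong: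
  assumes "\<And>x y. x \<in> J \<Longrightarrow> y \<in> J \<Longrightarrow> K x y = K' x y"
    "\<And>x. x \<in> J \<Longrightarrow> f x = f' x" "\<And>x. x \<in> J \<Longrightarrow> g x = g' x"
  shows "energy_inner J K f g = energy_inner J K' f' g'"
proof -
  have "energy J K (\<lambda>u. f u + g u) = energy J K' (\<lambda>u. f' u + g' u)"
    "energy J K (\<lambda>u. f u - g u) = energy J K' (\<lambda>u. f' u - g' u)"
    by (rule energy_cong; use assms in auto)+
  then show ?thesis unfolding energy_inner_def by simp
qed

text \<open>Extending coefficients by zero brings two finite combinations to a common index set.\<close>

definition extend_coeff :: "'a set \<Rightarrow> ('a \<Rightarrow> real) \<Rightarrow> 'a \<Rightarrow> real" where
  "extend_coeff F c x = (if x \<in> F then c x else 0)"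

lemma sum_extend_coeff:
  assumes "finite E" "F \<subseteq> E"
  shows "(\<Sum>x\<in>E. extend_coeff F c x * h x) = (\<Sum>x\<in>F. c x * h x)"
  unfolding extend_coeff_def by (rule sum.mono_neutral_cong_right) (use assms in auto)

lemma quad_alt: "quad K F c = (\<Sum>x\<in>F. c x * (\<Sum>y\<in>F. c y * K x y))"
  unfolding quad_def by (simp add: sum_distrib_left mult.assoc)

lemma quad_extend_coeff:
  assumes "finite E" "F \<subseteq> E"
  shows "quad K E (extend_coeff F c) = quad K F c"
  unfolding quad_alt by (simp add: sum_extend_coeff[OF assms])

lemma dual_value_extend_coeff:
  assumes "finite E" "F \<subseteq> E"
  shows "dual_value K f E (extend_coeff F c) = dual_value K f F c"
  unfolding dual_value_def by (simp add: sum_extend_coeff[OF assms] quad_extend_coeff[OF assms])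

text \<open>A finite set can be enumerated; conversely, repeated points of a sequence are merged by adding
  their coefficients.\<close>

lemma covariance_on_iff_quad:
  "covariance_on S K \<longleftrightarrow> (\<forall>s\<in>S. \<forall>t\<in>S. K s t = K t s) \<and> (\<forall>F c. finite F \<and> F \<subseteq> S \<longrightarrow> 0 \<le> quad K F c)"
proof -
  have 1: "0 \<le> quad K F c" if cov: "covariance_on S K" and F: "finite F" "F \<subseteq> S" for F c
  proof (cases "F = {}")
    case True then show ?thesis by (simp add: quad_def)
  next
    case False
    define n where "n = card F"
    have n: "1 \<le> n" using False F unfolding n_def by (simp add: Suc_leI card_gt_0_iff)
    obtain h where h: "bij_betw h {1..n} F" unfolding n_def
      using ex_bij_betw_nat_finite_1[OF F(1)] by blast
    have re: "sum g F = (\<Sum>i=1..n. g (h i))" for g :: "'a \<Rightarrow> real"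
      by (rule sum.reindex_bij_betw[OF h, symmetric])
    have hS: "\<forall>i\<in>{1..n}. h i \<in> S" using h F(2) unfolding bij_betw_def by blast
    have "quad K F c = (\<Sum>i=1..n. \<Sum>j=1..n. c (h i) * c (h j) * K (h i) (h j))"
      unfolding quad_def re ..
    also have "0 \<le> \<dots>"
    proof -
      have "\<And>t \<alpha>. \<forall>i\<in>{1..n}. t i \<in> S \<Longrightarrow> 0 \<le> (\<Sum>i=1..n. \<Sum>j=1..n. \<alpha> i * \<alpha> j * K (t i) (t j))"
        using cov n unfolding covariance_on_def by simp
      from this[OF hS] show ?thesis .
    qed
    finally show ?thesis .
  qed
  have 2: "0 \<le> (\<Sum>i=1..n. \<Sum>j=1..n. \<alpha> i * \<alpha> j * K (t i) (t j))"
    if q: "\<forall>F c. finite F \<and> F \<subseteq> S \<longrightarrow> 0 \<le> quad K F c" and t: "\<forall>i\<in>{1..n}. t i \<in> S"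
    for n :: nat and t :: "nat \<Rightarrow> 'a" and \<alpha> :: "nat \<Rightarrow> real"
  proof -
    define F where "F = t ` {1..n}"
    define c where "c x = (\<Sum>i\<in>{i\<in>{1..n}. t i = x}. \<alpha> i)" for x
    have g: "(\<Sum>i=1..n. \<alpha> i * h (t i)) = (\<Sum>x\<in>F. c x * h x)" for h
    proof -
      have "(\<Sum>i=1..n. \<alpha> i * h (t i)) = (\<Sum>x\<in>F. \<Sum>i\<in>{i\<in>{1..n}. t i = x}. \<alpha> i * h (t i))"
        by (rule sum.group[symmetric]) (auto simp: F_def)
      also have "\<dots> = (\<Sum>x\<in>F. c x * h x)" unfolding c_def by (simp add: sum_distrib_right)
      finally show ?thesis .
    qed
    have "(\<Sum>i=1..n. \<Sum>j=1..n. \<alpha> i * \<alpha> j * K (t i) (t j)) = (\<Sum>i=1..n. \<alpha> i * (\<Sum>j=1..n. \<alpha> j * K (t i) (t j)))"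
      by (simp add: sum_distrib_left mult.assoc)
    also have "\<dots> = quad K F c" unfolding quad_alt g by (rule g)
    also have "\<dots> \<ge> 0" using q t unfolding F_def by auto
    finally show ?thesis .
  qed
  show ?thesis
  proof
    assume c: "covariance_on S K"
    then have "\<forall>s\<in>S. \<forall>t\<in>S. K s t = K t s" unfolding covariance_on_def by (rule conjunct1)
    with 1[OF c] show "(\<forall>s\<in>S. \<forall>t\<in>S. K s t = K t s) \<and> (\<forall>F c. finite F \<and> F \<subseteq> S \<longrightarrow> 0 \<le> quad K F c)"
      by simp
  next
    assume "(\<forall>s\<in>S. \<forall>t\<in>S. K s t = K t s) \<and> (\<forall>F c. finite F \<and> F \<subseteq> S \<longrightarrow> 0 \<le> quad K F c)"
    then show "covariance_on S K" unfolding covariance_on_def using 2 by simp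
  qed
qed

lemma covariance_on_quad_nonneg: "covariance_on S K \<Longrightarrow> finite F \<Longrightarrow> F \<subseteq> S \<Longrightarrow> 0 \<le> quad K F c"
  by (simp add: covariance_on_iff_quad)

lemma covariance_on_sym: "covariance_on S K \<Longrightarrow> s \<in> S \<Longrightarrow> t \<in> S \<Longrightarrow> K s t = K t s"
  by (simp add: covariance_on_iff_quad)

lemma covariance_on_subset: "covariance_on S K \<Longrightarrow> T \<subseteq> S \<Longrightarrow> covariance_on T K"
  unfolding covariance_on_iff_quad by blast

lemma covariance_on_cong:
  assumes "\<And>s t. s \<in> S \<Longrightarrow> t \<in> S \<Longrightarrow> K s t = K' s t"
  shows "covariance_on S K = covariance_on S K'"
proof -
  have "quad K F c = quad K' F c" if "F \<subseteq> S" for F c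
    unfolding quad_def using assms that by (intro sum.cong refl) auto
  then have "(\<forall>F c. finite F \<and> F \<subseteq> S \<longrightarrow> 0 \<le> quad K F c) = (\<forall>F c. finite F \<and> F \<subseteq> S \<longrightarrow> 0 \<le> quad K' F c)"
    by auto
  moreover have "(\<forall>s\<in>S. \<forall>t\<in>S. K s t = K t s) = (\<forall>s\<in>S. \<forall>t\<in>S. K' s t = K' t s)"
    using assms by auto
  ultimately show ?thesis unfolding covariance_on_iff_quad by simp
qed

lemma quad_add:
  assumes sym: "\<And>x y. x \<in> F \<Longrightarrow> y \<in> F \<Longrightarrow> K x y = K y x"
  shows "quad K F (\<lambda>x. a * c x + b * d x) =
    a\<^sup>2 * quad K F c + 2 * a * b * (\<Sum>x\<in>F. \<Sum>y\<in>F. c x * d y * K x y) + b\<^sup>2 * quad K F d"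
proof -
  have sw: "(\<Sum>x\<in>F. \<Sum>y\<in>F. d x * c y * K x y) = (\<Sum>x\<in>F. \<Sum>y\<in>F. c x * d y * K x y)"
    by (subst sum.swap) (use sym in \<open>auto intro!: sum.cong simp: mult_ac\<close>)
  have "quad K F (\<lambda>x. a * c x + b * d x) =
    a\<^sup>2 * quad K F c + a * b * (\<Sum>x\<in>F. \<Sum>y\<in>F. c x * d y * K x y)
      + a * b * (\<Sum>x\<in>F. \<Sum>y\<in>F. d x * c y * K x y) + b\<^sup>2 * quad K F d"
    unfolding quad_def sum_distrib_left sum.distrib[symmetric]
    by (intro sum.cong refl) (simp add: algebra_simps power2_eq_square)
  then show ?thesis unfolding sw by (simp add: algebra_simps)
qed

text \<open>Restriction to a subset does not increase the norm: the bound for coefficients \<open>d\<close> on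
  \<open>G \<subseteq> J\<close> is the nonnegativity of the quadratic form at \<open>c - d\<close>.\<close>

lemma energy_restrict_le:
  assumes cov: "covariance_on S K" and J: "J \<subseteq> S" and F: "finite F" "F \<subseteq> S"
  shows "finite_energy J K (\<lambda>u. \<Sum>x\<in>F. c x * K x u)"
    and "energy J K (\<lambda>u. \<Sum>x\<in>F. c x * K x u) \<le> quad K F c"
proof -
  have *: "dual_value K (\<lambda>u. \<Sum>x\<in>F. c x * K x u) G d \<le> quad K F c" if G: "finite G" "G \<subseteq> J" for G d
  proof -
    define E where "E = F \<union> G"
    have E: "finite E" "F \<subseteq> E" "G \<subseteq> E" "E \<subseteq> S" using F G J unfolding E_def by auto
    have "0 \<le> quad K E (\<lambda>x. 1 * extend_coeff F c x + (-1) * extend_coeff G d x)"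
      using covariance_on_quad_nonneg[OF cov E(1,4)] .
    also have "\<dots> = quad K F c - 2 * (\<Sum>x\<in>E. \<Sum>y\<in>E. extend_coeff F c x * extend_coeff G d y * K x y) + quad K G d"
    proof (subst quad_add)
      show "K x y = K y x" if "x \<in> E" "y \<in> E" for x y
        using covariance_on_sym[OF cov] that E(4) by blast
    qed (simp add: quad_extend_coeff E)
    also have "(\<Sum>x\<in>E. \<Sum>y\<in>E. extend_coeff F c x * extend_coeff G d y * K x y) = (\<Sum>x\<in>F. c x * (\<Sum>y\<in>G. d y * K x y))"
      by (simp add: mult.assoc sum_distrib_left[symmetric] sum_extend_coeff[OF E(1,2)] sum_extend_coeff[OF E(1,3)])
    also have "\<dots> = (\<Sum>y\<in>G. d y * (\<Sum>x\<in>F. c x * K x y))"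
      unfolding sum_distrib_left by (subst sum.swap) (simp add: mult_ac)
    finally show ?thesis unfolding dual_value_def by simp
  qed
  show "finite_energy J K (\<lambda>u. \<Sum>x\<in>F. c x * K x u)" by (rule finite_energyI[OF *])
  show "energy J K (\<lambda>u. \<Sum>x\<in>F. c x * K x u) \<le> quad K F c" by (rule energy_least[OF *])
qed

lemma finite_energy_kernel:
  assumes "covariance_on S K" "J \<subseteq> S" "s \<in> S"
  shows "finite_energy J K (K s)"
  using energy_restrict_le(1)[OF assms(1,2), of "{s}" "\<lambda>_. 1"] assms(3) by simp

text \<open>The discriminant inequality behind the Cauchy--Schwarz inequality. The factor \<open>k + 1\<close> instead of
  \<open>k\<close> spares a separate treatment of \<open>k = 0\<close>, and its size is immaterial when \<open>d\<close> is small.\<close>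

lemma quadratic_bound:
  fixes b k d :: real
  assumes "0 \<le> k" "\<And>a. 2 * a * b \<le> d + a\<^sup>2 * k"
  shows "b\<^sup>2 \<le> (k + 1) * d"
proof -
  define q where "q = k + 1"
  have q: "q > 0" "k \<le> q" using assms(1) q_def by auto
  have "2 * (b / q) * b \<le> d + (b / q)\<^sup>2 * k" by (rule assms(2))
  also have "\<dots> \<le> d + (b / q)\<^sup>2 * q" using q by (intro add_left_mono mult_left_mono) auto
  finally have "2 * (b\<^sup>2 / q) \<le> d + b\<^sup>2 / q" using q by (simp add: power2_eq_square)
  then have "b\<^sup>2 / q \<le> d" by simp
  then show ?thesis using q by (simp add: pos_divide_le_eq q_def mult.commute)
qed

context
  fixes J :: "'a set" and K :: "'a \<Rightarrow> 'a \<Rightarrow> real"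
  assumes cov: "covariance_on J K"
begin

lemma energy_zero: "finite_energy J K (\<lambda>u. 0)" "energy J K (\<lambda>u. 0) = 0"
proof -
  have *: "dual_value K (\<lambda>u. 0) F c \<le> 0" if "finite F" "F \<subseteq> J" for F c
    using covariance_on_quad_nonneg[OF cov that] by (simp add: dual_value_def)
  show a: "finite_energy J K (\<lambda>u. 0)" by (rule finite_energyI[OF *])
  show "energy J K (\<lambda>u. 0) = 0" using energy_least[OF *] energy_nonneg[OF a] by force
qed

text \<open>The substitution of \<open>c / a\<close> for \<open>c\<close> multiplies the dual value by \<open>a\<^sup>2\<close>.\<close>

lemma energy_scale_le:
  assumes f: "finite_energy J K f"
  shows "finite_energy J K (\<lambda>u. a * f u)" "energy J K (\<lambda>u. a * f u) \<le> a\<^sup>2 * energy J K f"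
proof -
  have *: "dual_value K (\<lambda>u. a * f u) F c \<le> a\<^sup>2 * energy J K f" if F: "finite F" "F \<subseteq> J" for F c
  proof (cases "a = 0")
    case True
    then show ?thesis using covariance_on_quad_nonneg[OF cov F] by (simp add: dual_value_def)
  next
    case False
    have 1: "a\<^sup>2 * (\<Sum>x\<in>F. (c x / a) * f x) = (\<Sum>x\<in>F. c x * (a * f x))"
      unfolding sum_distrib_left by (rule sum.cong) (use False in \<open>auto simp: power2_eq_square\<close>)
    have 2: "a\<^sup>2 * quad K F (\<lambda>x. c x / a) = quad K F c"
      unfolding quad_def sum_distrib_left
      by (intro sum.cong refl) (use False in \<open>auto simp: power2_eq_square\<close>)
    have "dual_value K (\<lambda>u. a * f u) F c = a\<^sup>2 * dual_value K f F (\<lambda>x. c x / a)"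
      unfolding dual_value_def using 1 2 by (simp add: right_diff_distrib)
    also have "\<dots> \<le> a\<^sup>2 * energy J K f"
      by (intro mult_left_mono dual_value_le_energy[OF f F]) auto
    finally show ?thesis .
  qed
  show "finite_energy J K (\<lambda>u. a * f u)" by (rule finite_energyI[OF *])
  show "energy J K (\<lambda>u. a * f u) \<le> a\<^sup>2 * energy J K f" by (rule energy_least[OF *])
qed

lemma energy_scale:
  assumes f: "finite_energy J K f"
  shows "energy J K (\<lambda>u. a * f u) = a\<^sup>2 * energy J K f"
proof (cases "a = 0")
  case True then show ?thesis using energy_zero by simp
next
  case False
  have "energy J K (\<lambda>u. (1/a) * (a * f u)) \<le> (1/a)\<^sup>2 * energy J K (\<lambda>u. a * f u)"
    by (rule energy_scale_le(2)[OF energy_scale_le(1)[OF f]])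
  then have "a\<^sup>2 * energy J K f \<le> energy J K (\<lambda>u. a * f u)"
    using False by (simp add: power_one_over pos_le_divide_eq mult.commute)
  then show ?thesis using energy_scale_le(2)[OF f, of a] by linarith
qed

text \<open>The substitution \<open>(c, d) \<mapsto> ((c + d) / 2, (c - d) / 2)\<close> turns the sum of the dual values of
  \<open>f + g\<close> and \<open>f - g\<close> into twice the sum of those of \<open>f\<close> and \<open>g\<close>.\<close>

lemma parallelogram_le:
  assumes f: "finite_energy J K f" and g: "finite_energy J K g"
  shows "finite_energy J K (\<lambda>u. f u + g u)" "finite_energy J K (\<lambda>u. f u - g u)"
    "energy J K (\<lambda>u. f u + g u) + energy J K (\<lambda>u. f u - g u) \<le> 2 * energy J K f + 2 * energy J K g"
proof -
  let ?C = "2 * energy J K f + 2 * energy J K g"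
  have *: "dual_value K (\<lambda>u. f u + g u) F c + dual_value K (\<lambda>u. f u - g u) G d \<le> ?C"
    if F: "finite F" "F \<subseteq> J" and G: "finite G" "G \<subseteq> J" for F c G d
  proof -
    define E where "E = F \<union> G"
    have E: "finite E" "F \<subseteq> E" "G \<subseteq> E" "E \<subseteq> J" using F G unfolding E_def by auto
    define c' d' where "c' = extend_coeff F c" and "d' = extend_coeff G d"
    have sym: "K x y = K y x" if "x \<in> E" "y \<in> E" for x y
      using covariance_on_sym[OF cov] that E(4) by blast
    let ?p = "\<lambda>x. (1/2) * c' x + (1/2) * d' x" and ?m = "\<lambda>x. (1/2) * c' x + (-1/2) * d' x"
    have "dual_value K (\<lambda>u. f u + g u) F c + dual_value K (\<lambda>u. f u - g u) G d
       = dual_value K (\<lambda>u. f u + g u) E c' + dual_value K (\<lambda>u. f u - g u) E d'"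
      unfolding c'_def d'_def by (simp add: dual_value_extend_coeff E)
    also have "\<dots> = 2 * dual_value K f E ?p + 2 * dual_value K g E ?m"
    proof -
      have "quad K E (\<lambda>x. a * c' x + b * d' x) = a\<^sup>2 * quad K E c'
          + 2 * a * b * (\<Sum>x\<in>E. \<Sum>y\<in>E. c' x * d' y * K x y) + b\<^sup>2 * quad K E d'" for a b
        by (rule quad_add) (rule sym)
      note q = this[of "1/2" "1/2"] this[of "1/2" "-1/2"]
      have "(\<Sum>x\<in>E. c' x * (f x + g x)) + (\<Sum>x\<in>E. d' x * (f x - g x))
          = 2 * (\<Sum>x\<in>E. ?p x * f x) + 2 * (\<Sum>x\<in>E. ?m x * g x)"
        unfolding sum_distrib_left sum.distrib[symmetric] by (rule sum.cong) (auto simp: algebra_simps)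
      then show ?thesis unfolding dual_value_def q by (simp add: power2_eq_square)
    qed
    also have "\<dots> \<le> ?C"
      by (intro add_mono mult_left_mono dual_value_le_energy f g E) auto
    finally show ?thesis .
  qed
  show s: "finite_energy J K (\<lambda>u. f u + g u)"
    by (rule finite_energyI[of _ _ _ ?C]) (use *[where G="{}"] in simp)
  show d: "finite_energy J K (\<lambda>u. f u - g u)"
    by (rule finite_energyI[of _ _ _ ?C]) (use *[where F="{}"] in simp)
  have "energy J K (\<lambda>u. f u - g u) \<le> ?C - dual_value K (\<lambda>u. f u + g u) F c"
    if "finite F" "F \<subseteq> J" for F c
    by (rule energy_least) (use *[OF that] in \<open>simp add: algebra_simps\<close>)
  then have "energy J K (\<lambda>u. f u + g u) \<le> ?C - energy J K (\<lambda>u. f u - g u)"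
    by (intro energy_least) (simp add: algebra_simps)
  then show "energy J K (\<lambda>u. f u + g u) + energy J K (\<lambda>u. f u - g u) \<le> ?C" by simp
qed

text \<open>The missing inequality is the proved one applied to \<open>f + g\<close> and \<open>f - g\<close>.\<close>

lemma parallelogram:
  assumes f: "finite_energy J K f" and g: "finite_energy J K g"
  shows "energy J K (\<lambda>u. f u + g u) + energy J K (\<lambda>u. f u - g u) = 2 * energy J K f + 2 * energy J K g"
proof -
  have eqs: "(\<lambda>u. f u + g u + (f u - g u)) = (\<lambda>u. 2 * f u)" "(\<lambda>u. f u + g u - (f u - g u)) = (\<lambda>u. 2 * g u)"
    by auto
  have "4 * energy J K f + 4 * energy J K g
      \<le> 2 * energy J K (\<lambda>u. f u + g u) + 2 * energy J K (\<lambda>u. f u - g u)"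
    using parallelogram_le(3)[OF parallelogram_le(1,2)[OF f g]]
    unfolding eqs energy_scale[OF f] energy_scale[OF g] by simp
  then show ?thesis using parallelogram_le(3)[OF f g] by linarith
qed

text \<open>Adding \<open>a K\<^sub>t\<close> to \<open>f\<close> is compensated by subtracting \<open>a\<close> from the coefficient at \<open>t\<close>. The
  resulting expansion of \<open>\<parallel>f + a K\<^sub>t\<parallel>\<^sup>2\<close> contains the reproducing property.\<close>

lemma energy_shift_le:
  assumes f: "finite_energy J K f" and t: "t \<in> J"
  shows "finite_energy J K (\<lambda>u. f u + a * K t u)"
    "energy J K (\<lambda>u. f u + a * K t u) \<le> energy J K f + 2 * a * f t + a\<^sup>2 * K t t"
proof -
  have *: "dual_value K (\<lambda>u. f u + a * K t u) F c \<le> energy J K f + 2 * a * f t + a\<^sup>2 * K t t"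
    if F: "finite F" "F \<subseteq> J" for F c
  proof -
    define E where "E = insert t F"
    have E: "finite E" "F \<subseteq> E" "E \<subseteq> J" "t \<in> E" "{t} \<subseteq> E" using F t unfolding E_def by auto
    define c' where "c' = extend_coeff F c"
    define e where "e = extend_coeff {t} (\<lambda>_. 1)"
    have sym: "K x y = K y x" if "x \<in> E" "y \<in> E" for x y
      using covariance_on_sym[OF cov] that E(3) by blast
    have se: "(\<Sum>x\<in>E. e x * h x) = h t" for h
      unfolding e_def by (simp add: sum_extend_coeff[OF E(1,5)])
    have qe: "quad K E e = K t t" unfolding quad_alt se ..
    have ce: "(\<Sum>x\<in>E. \<Sum>y\<in>E. c' x * e y * K x y) = (\<Sum>x\<in>E. c' x * K t x)"
      by (simp add: mult.assoc sum_distrib_left[symmetric] se)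
         (intro sum.cong refl, use sym E(4) in simp)
    have "dual_value K (\<lambda>u. f u + a * K t u) F c = dual_value K (\<lambda>u. f u + a * K t u) E c'"
      unfolding c'_def by (simp add: dual_value_extend_coeff E)
    also have "\<dots> = dual_value K f E (\<lambda>x. 1 * c' x + (-a) * e x) + 2 * a * f t + a\<^sup>2 * K t t"
    proof -
      have q: "quad K E (\<lambda>x. 1 * c' x + (-a) * e x) = 1\<^sup>2 * quad K E c'
          + 2 * 1 * (-a) * (\<Sum>x\<in>E. \<Sum>y\<in>E. c' x * e y * K x y) + (-a)\<^sup>2 * quad K E e"
        by (rule quad_add) (rule sym)
      have "(\<Sum>x\<in>E. (1 * c' x + (-a) * e x) * f x) = (\<Sum>x\<in>E. c' x * f x) - a * (\<Sum>x\<in>E. e x * f x)"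
        unfolding sum_distrib_left sum_subtractf[symmetric] by (rule sum.cong) (auto simp: algebra_simps)
      moreover have "(\<Sum>x\<in>E. c' x * (f x + a * K t x)) = (\<Sum>x\<in>E. c' x * f x) + a * (\<Sum>x\<in>E. c' x * K t x)"
        unfolding sum_distrib_left sum.distrib[symmetric] by (rule sum.cong) (auto simp: algebra_simps)
      ultimately show ?thesis unfolding dual_value_def q qe ce se by (simp add: algebra_simps)
    qed
    also have "\<dots> \<le> energy J K f + 2 * a * f t + a\<^sup>2 * K t t"
      using dual_value_le_energy[OF f E(1,3)] by simp
    finally show ?thesis .
  qed
  show "finite_energy J K (\<lambda>u. f u + a * K t u)" by (rule finite_energyI[OF *])
  show "energy J K (\<lambda>u. f u + a * K t u) \<le> energy J K f + 2 * a * f t + a\<^sup>2 * K t t"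
    by (rule energy_least[OF *])
qed

lemma energy_shift:
  assumes f: "finite_energy J K f" and t: "t \<in> J"
  shows "energy J K (\<lambda>u. f u + a * K t u) = energy J K f + 2 * a * f t + a\<^sup>2 * K t t"
proof -
  have "energy J K (\<lambda>u. (f u + a * K t u) + (-a) * K t u)
     \<le> energy J K (\<lambda>u. f u + a * K t u) + 2 * (-a) * (f t + a * K t t) + (-a)\<^sup>2 * K t t"
    by (rule energy_shift_le(2)[OF energy_shift_le(1)[OF f t] t])
  then have "energy J K f \<le> energy J K (\<lambda>u. f u + a * K t u) - 2 * a * f t - a\<^sup>2 * K t t"
    by (simp add: algebra_simps power2_eq_square)
  then show ?thesis using energy_shift_le(2)[OF f t, of a] by linarith
qed

lemma energy_inner_reproducing:
  assumes "finite_energy J K f" "t \<in> J"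
  shows "energy_inner J K f (K t) = f t"
  unfolding energy_inner_def using energy_shift[OF assms, of 1] energy_shift[OF assms, of "-1"] by simp

text \<open>Evaluations are continuous; combinations supported in the single point \<open>t\<close> already give this.\<close>

lemma eval_sq_le_energy:
  assumes f: "finite_energy J K f" and t: "t \<in> J"
  shows "(f t)\<^sup>2 \<le> (K t t + 1) * energy J K f"
proof (rule quadratic_bound)
  show "0 \<le> K t t"
    using covariance_on_quad_nonneg[OF cov, of "{t}" "\<lambda>_. 1"] t by (simp add: quad_def)
  show "2 * a * f t \<le> energy J K f + a\<^sup>2 * K t t" for a
    using dual_value_le_energy[OF f, of "{t}" "\<lambda>_. a"] t
    by (simp add: dual_value_def quad_def power2_eq_square)
qed

lemma energy_inner_sym: "energy_inner J K f g = energy_inner J K g f" if fg: "finite_energy J K f" "finite_energy J K g"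
proof -
  have "energy J K (\<lambda>u. (-1) * (f u - g u)) = energy J K (\<lambda>u. f u - g u)"
    using energy_scale[OF parallelogram_le(2)[OF fg], of "-1"] by simp
  then have "energy J K (\<lambda>u. g u - f u) = energy J K (\<lambda>u. f u - g u)" by simp
  then show ?thesis unfolding energy_inner_def by (simp add: add.commute)
qed

lemma energy_inner_self: "energy_inner J K f f = energy J K f" if f: "finite_energy J K f"
proof -
  have "(\<lambda>u. f u + f u) = (\<lambda>u. 2 * f u)" "(\<lambda>u. f u - f u) = (\<lambda>u. 0)" by auto
  then show ?thesis unfolding energy_inner_def
    using energy_scale[OF f, of 2] energy_zero by simp
qed

text \<open>The Jordan--von Neumann argument.\<close>

lemma energy_inner_add:
  assumes f: "finite_energy J K f" and g: "finite_energy J K g" and h: "finite_energy J K h"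
  shows "energy_inner J K (\<lambda>u. f u + g u) h = energy_inner J K f h + energy_inner J K g h"
proof -
  \<comment> \<open>the parallelogram law for the pairs \<open>x + z, y + z\<close> and \<open>x - z, y - z\<close>\<close>
  have half: "energy_inner J K x z + energy_inner J K y z = energy_inner J K (\<lambda>u. x u + y u) (\<lambda>u. 2 * z u) / 2"
    if x: "finite_energy J K x" and y: "finite_energy J K y" and z: "finite_energy J K z" for x y z
  proof -
    have eqs: "(\<lambda>u. x u + z u + (y u + z u)) = (\<lambda>u. x u + y u + 2 * z u)"
      "(\<lambda>u. x u + z u - (y u + z u)) = (\<lambda>u. x u - y u)"
      "(\<lambda>u. x u - z u + (y u - z u)) = (\<lambda>u. x u + y u - 2 * z u)"
      "(\<lambda>u. x u - z u - (y u - z u)) = (\<lambda>u. x u - y u)" by auto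
    show ?thesis
      using parallelogram[OF parallelogram_le(1)[OF x z] parallelogram_le(1)[OF y z]]
        parallelogram[OF parallelogram_le(2)[OF x z] parallelogram_le(2)[OF y z]]
      unfolding energy_inner_def eqs by (simp only: diff_divide_distrib)
  qed
  have z: "energy_inner J K (\<lambda>u. 0) h = 0"
    unfolding energy_inner_def using energy_scale[OF h, of "-1"] by simp
  have "energy_inner J K x h = energy_inner J K x (\<lambda>u. 2 * h u) / 2" if "finite_energy J K x" for x
    using half[OF that energy_zero(1) h] z by simp
  from this[OF parallelogram_le(1)[OF f g]] half[OF f g h] show ?thesis by simp
qed

end

text \<open>Splitting \<open>n c\<close> into its integer and fractional parts shows that \<open>n\<close> times the defect
  \<open>\<phi> c - c \<phi> 1\<close> stays bounded as \<open>n\<close> grows.\<close>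

lemma additive_bounded_imp_linear:
  fixes \<phi> :: "real \<Rightarrow> real"
  assumes add: "\<And>x y. \<phi> (x + y) = \<phi> x + \<phi> y" and bd: "\<And>x. 0 \<le> x \<Longrightarrow> x \<le> 1 \<Longrightarrow> \<bar>\<phi> x\<bar> \<le> B"
  shows "\<phi> c = c * \<phi> 1"
proof -
  have z: "\<phi> 0 = 0" using add[of 0 0] by simp
  have neg: "\<phi> (- x) = - \<phi> x" for x using add[of x "-x"] z by simp
  have nat: "\<phi> (real n * x) = real n * \<phi> x" for n x
    by (induction n) (auto simp: z add algebra_simps)
  have int: "\<phi> (of_int k) = of_int k * \<phi> 1" for k
  proof (cases "k \<ge> 0")
    case True then show ?thesis using nat[of "nat k" 1] by simp
  next
    case False
    then have "\<phi> (- of_int k) = - of_int k * \<phi> 1" using nat[of "nat (-k)" 1] by simp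
    then show ?thesis using neg[of "of_int k"] by simp
  qed
  have bnd: "real n * \<bar>\<phi> c - c * \<phi> 1\<bar> \<le> \<bar>\<phi> 1\<bar> + B" for n
  proof -
    let ?x = "real n * c"
    have "real n * \<phi> c = \<phi> (of_int \<lfloor>?x\<rfloor> + frac ?x)" using nat[of n c] by (simp add: frac_def)
    also have "\<dots> = of_int \<lfloor>?x\<rfloor> * \<phi> 1 + \<phi> (frac ?x)" by (simp add: add int)
    also have "of_int \<lfloor>?x\<rfloor> = ?x - frac ?x" by (simp add: frac_def)
    finally have "real n * (\<phi> c - c * \<phi> 1) = \<phi> (frac ?x) - frac ?x * \<phi> 1" by (simp add: algebra_simps)
    then have "real n * \<bar>\<phi> c - c * \<phi> 1\<bar> = \<bar>\<phi> (frac ?x) - frac ?x * \<phi> 1\<bar>"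
      by (metis abs_mult abs_of_nat)
    also have "\<dots> \<le> \<bar>\<phi> (frac ?x)\<bar> + \<bar>frac ?x * \<phi> 1\<bar>" by (rule abs_triangle_ineq4)
    also have "\<dots> \<le> B + 1 * \<bar>\<phi> 1\<bar>"
      unfolding abs_mult by (intro add_mono bd mult_right_mono) (auto simp: less_imp_le frac_lt_1)
    finally show ?thesis by simp
  qed
  have "\<bar>\<phi> c - c * \<phi> 1\<bar> = 0"
  proof (rule ccontr)
    assume "\<bar>\<phi> c - c * \<phi> 1\<bar> \<noteq> 0"
    then have pos: "\<bar>\<phi> c - c * \<phi> 1\<bar> > 0" by simp
    obtain n where "\<bar>\<phi> 1\<bar> + B < real n * \<bar>\<phi> c - c * \<phi> 1\<bar>"
      using reals_Archimedean3[OF pos] by blast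
    then show False using bnd[of n] by simp
  qed
  then show ?thesis by simp
qed

context
  fixes J :: "'a set" and K :: "'a \<Rightarrow> 'a \<Rightarrow> real"
  assumes cov: "covariance_on J K"
begin

text \<open>Additivity in \<open>f\<close> makes \<open>a \<mapsto> \<langle>a f, g\<rangle>\<close> additive, and the parallelogram law bounds it on the
  unit interval.\<close>

lemma energy_inner_scale:
  assumes f: "finite_energy J K f" and g: "finite_energy J K g"
  shows "energy_inner J K (\<lambda>u. a * f u) g = a * energy_inner J K f g"
proof -
  define \<phi> where "\<phi> a = energy_inner J K (\<lambda>u. a * f u) g" for a
  have sc: "finite_energy J K (\<lambda>u. a * f u)" for a by (rule energy_scale_le(1)[OF cov f])
  have "\<phi> a = a * \<phi> 1"
  proof (rule additive_bounded_imp_linear)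
    show "\<phi> (x + y) = \<phi> x + \<phi> y" for x y
      using energy_inner_add[OF cov sc sc g, of x y] unfolding \<phi>_def by (simp add: distrib_right)
    show "\<bar>\<phi> x\<bar> \<le> 2 * energy J K f + 2 * energy J K g" if x: "0 \<le> x" "x \<le> 1" for x
    proof -
      note fe = parallelogram_le[OF cov sc[of x] g]
      have "x\<^sup>2 * energy J K f \<le> 1 * energy J K f"
        by (rule mult_right_mono) (use x energy_nonneg[OF f] in \<open>auto simp: power_le_one\<close>)
      then have "energy J K (\<lambda>u. x * f u) \<le> energy J K f" using energy_scale[OF cov f, of x] by simp
      then show ?thesis
        unfolding \<phi>_def energy_inner_def
        using fe(3) energy_nonneg[OF fe(1)] energy_nonneg[OF fe(2)]
        by (intro abs_leI) (simp_all add: field_simps)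
    qed
  qed
  then show ?thesis unfolding \<phi>_def by simp
qed

text \<open>A Cauchy sequence converges pointwise. As a supremum of functionals that depend on finitely many
  values, the energy is lower semicontinuous for pointwise convergence, so the pointwise limit is
  the limit in norm.\<close>

lemma energy_complete:
  assumes fe: "\<And>n. finite_energy J K (\<sigma> n)"
    and cauchy: "\<And>\<epsilon>. 0 < \<epsilon> \<Longrightarrow> \<exists>N. \<forall>m\<ge>N. \<forall>n\<ge>N. energy J K (\<lambda>u. \<sigma> m u - \<sigma> n u) < \<epsilon>"
    and off: "\<And>n u. u \<notin> J \<Longrightarrow> \<sigma> n u = 0"
  shows "\<exists>f. (\<forall>u. u \<notin> J \<longrightarrow> f u = 0) \<and> finite_energy J K f \<and>
    (\<lambda>n. energy J K (\<lambda>u. \<sigma> n u - f u)) \<longlonglongrightarrow> 0"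
proof -
  have fed: "finite_energy J K (\<lambda>u. \<sigma> m u - \<sigma> n u)" for m n by (rule parallelogram_le(2)[OF cov fe fe])
  have conv: "convergent (\<lambda>n. \<sigma> n t)" if t: "t \<in> J" for t
  proof -
    have ktt: "0 \<le> K t t"
      using covariance_on_quad_nonneg[OF cov, of "{t}" "\<lambda>_. 1"] t by (simp add: quad_def)
    have "Cauchy (\<lambda>n. \<sigma> n t)"
    proof (rule metric_CauchyI)
      fix e :: real assume e: "e > 0"
      obtain N where N: "\<forall>m\<ge>N. \<forall>n\<ge>N. energy J K (\<lambda>u. \<sigma> m u - \<sigma> n u) < e\<^sup>2 / (K t t + 1)"
        using cauchy[of "e\<^sup>2 / (K t t + 1)"] e ktt by (auto simp: add_nonneg_pos)
      have "dist (\<sigma> m t) (\<sigma> n t) < e" if "m \<ge> N" "n \<ge> N" for m n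
      proof -
        have "(\<sigma> m t - \<sigma> n t)\<^sup>2 \<le> (K t t + 1) * energy J K (\<lambda>u. \<sigma> m u - \<sigma> n u)"
          by (rule eval_sq_le_energy[OF cov fed t])
        also have "\<dots> < (K t t + 1) * (e\<^sup>2 / (K t t + 1))"
          by (rule mult_strict_left_mono) (use N that ktt in auto)
        also have "\<dots> = e\<^sup>2" using ktt by simp
        finally have "\<bar>\<sigma> m t - \<sigma> n t\<bar>\<^sup>2 < e\<^sup>2" by simp
        then show ?thesis unfolding dist_real_def using e power2_less_imp_less by (metis less_imp_le)
      qed
      then show "\<exists>M. \<forall>m\<ge>M. \<forall>n\<ge>M. dist (\<sigma> m t) (\<sigma> n t) < e" by blast
    qed
    then show ?thesis by (rule Cauchy_convergent)
  qed
  define f where "f t = lim (\<lambda>n. \<sigma> n t)" for t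
  have conv': "convergent (\<lambda>n. \<sigma> n t)" for t
    by (cases "t \<in> J") (use conv off in \<open>auto intro: convergent_const\<close>)
  have lim: "(\<lambda>n. \<sigma> n t) \<longlonglongrightarrow> f t" for t
    using conv'[of t] unfolding f_def by (simp add: convergent_LIMSEQ_iff)
  have close: "finite_energy J K (\<lambda>u. \<sigma> n u - f u) \<and> energy J K (\<lambda>u. \<sigma> n u - f u) \<le> e"
    if N: "\<forall>m\<ge>N. \<forall>n\<ge>N. energy J K (\<lambda>u. \<sigma> m u - \<sigma> n u) < e" and n: "n \<ge> N" for N n e
  proof -
    have *: "dual_value K (\<lambda>u. \<sigma> n u - f u) F c \<le> e" if F: "finite F" "F \<subseteq> J" for F c
    proof (rule Lim_bounded[where M = N])
      show "(\<lambda>m. dual_value K (\<lambda>u. \<sigma> n u - \<sigma> m u) F c) \<longlonglongrightarrow> dual_value K (\<lambda>u. \<sigma> n u - f u) F c"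
        unfolding dual_value_def by (intro tendsto_intros lim)
      show "\<forall>m\<ge>N. dual_value K (\<lambda>u. \<sigma> n u - \<sigma> m u) F c \<le> e"
        using dual_value_le_energy[OF fed F] N n by (meson less_imp_le order_trans)
    qed
    show ?thesis using finite_energyI[OF *] energy_least[OF *] by blast
  qed
  obtain N where "\<forall>m\<ge>N. \<forall>n\<ge>N. energy J K (\<lambda>u. \<sigma> m u - \<sigma> n u) < 1" using cauchy[of 1] by auto
  then have "finite_energy J K (\<lambda>u. \<sigma> N u - f u)" using close by blast
  then have "finite_energy J K (\<lambda>u. \<sigma> N u - (\<sigma> N u - f u))" by (rule parallelogram_le(2)[OF cov fe])
  then have ff: "finite_energy J K f" by simp
  have "(\<lambda>n. energy J K (\<lambda>u. \<sigma> n u - f u)) \<longlonglongrightarrow> 0"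
  proof (rule LIMSEQ_I)
    fix r :: real assume r: "r > 0"
    then obtain N where N: "\<forall>m\<ge>N. \<forall>n\<ge>N. energy J K (\<lambda>u. \<sigma> m u - \<sigma> n u) < r/2" using cauchy[of "r/2"] by auto
    have "norm (energy J K (\<lambda>u. \<sigma> n u - f u) - 0) < r" if "n \<ge> N" for n
      using close[OF N that] energy_nonneg[of J K "\<lambda>u. \<sigma> n u - f u"] r by auto
    then show "\<exists>no. \<forall>n\<ge>no. norm (energy J K (\<lambda>u. \<sigma> n u - f u) - 0) < r" by blast
  qed
  moreover have "f u = 0" if "u \<notin> J" for u
    using lim[of u] unfolding off[OF that] by (simp add: LIMSEQ_const_iff)
  ultimately show ?thesis using ff by blast
qed

text \<open>The existence half of the Moore--Aronszajn theorem.\<close>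

lemma rkhs_energy: "rkhs J K {f. (\<forall>u. u \<notin> J \<longrightarrow> f u = 0) \<and> finite_energy J K f} (energy_inner J K)"
proof (unfold_locales, goal_cases)
  case (9 f)
  then have f: "finite_energy J K f" by simp
  then have "energy J K f = 0" using 9 energy_inner_self[OF cov f] by simp
  then have "(f t)\<^sup>2 \<le> 0" if "t \<in> J" for t using eval_sq_le_energy[OF cov f that] by simp
  then have "f t = 0" for t using 9 by (cases "t \<in> J") auto
  then show ?case by blast
next
  case (10 \<sigma>)
  then have fe: "\<And>n. finite_energy J K (\<sigma> n)" and off: "\<And>n u. u \<notin> J \<Longrightarrow> \<sigma> n u = 0" by auto
  have fed: "finite_energy J K (\<lambda>u. \<sigma> m u - \<sigma> n u)" for m n by (rule parallelogram_le(2)[OF cov fe fe])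
  have "\<exists>N. \<forall>m\<ge>N. \<forall>n\<ge>N. energy J K (\<lambda>u. \<sigma> m u - \<sigma> n u) < \<epsilon>" if "0 < \<epsilon>" for \<epsilon>
    using 10(2)[of "sqrt \<epsilon>"] that unfolding energy_inner_self[OF cov fed] by simp
  from energy_complete[OF fe this off] obtain f where f: "\<forall>u. u \<notin> J \<longrightarrow> f u = 0" "finite_energy J K f"
    "(\<lambda>n. energy J K (\<lambda>u. \<sigma> n u - f u)) \<longlonglongrightarrow> 0" by blast
  have "(\<lambda>n. sqrt (energy_inner J K (\<lambda>u. \<sigma> n u - f u) (\<lambda>u. \<sigma> n u - f u))) \<longlonglongrightarrow> 0"
    using tendsto_real_sqrt[OF f(3)] energy_inner_self[OF cov parallelogram_le(2)[OF cov fe f(2)]] by simp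
  then show ?case by (intro bexI[of _ f]) (use f in auto)
next
  case (11 t)
  have "finite_energy J K (K t)" using finite_energy_kernel[OF cov _ 11] by simp
  then have "finite_energy J K (zero_ext J (K t))"
    by (subst finite_energy_cong[of J K K _ "K t"]) (auto simp: zero_ext_def)
  then show ?case by (auto simp: zero_ext_def)
next
  case (12 f t)
  have "energy_inner J K f (zero_ext J (K t)) = energy_inner J K f (K t)"
    by (rule energy_inner_cong) (auto simp: zero_ext_def)
  then show ?case using energy_inner_reproducing[OF cov] 12 by simp
next
  case (5 f g) then show ?case using energy_inner_sym[OF cov] by blast
next
  case (6 f g h) then show ?case using energy_inner_add[OF cov] by blast
next
  case (7 f g c) then show ?case using energy_inner_scale by blast
next
  case (8 f) then show ?case using energy_inner_self[OF cov] energy_nonneg by fastforce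
qed (auto intro: energy_zero[OF cov] parallelogram_le(1)[OF cov] energy_scale_le(1)[OF cov])

end

section \<open>Projections in semi-inner product spaces of functions\<close>

text \<open>The form may vanish on nonzero functions, so that the setting covers both reproducing kernel
  spaces and square-integrable random variables that are not identified almost everywhere.\<close>

locale semi_inner =
  fixes H :: "('w \<Rightarrow> real) set" and ip :: "('w \<Rightarrow> real) \<Rightarrow> ('w \<Rightarrow> real) \<Rightarrow> real"
  assumes zero_in: "(\<lambda>u. 0) \<in> H"
    and add_in: "f \<in> H \<Longrightarrow> g \<in> H \<Longrightarrow> (\<lambda>u. f u + g u) \<in> H"
    and scale_in: "f \<in> H \<Longrightarrow> (\<lambda>u. c * f u) \<in> H"
    and sym: "f \<in> H \<Longrightarrow> g \<in> H \<Longrightarrow> ip f g = ip g f"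
    and add_left: "f \<in> H \<Longrightarrow> g \<in> H \<Longrightarrow> h \<in> H \<Longrightarrow> ip (\<lambda>u. f u + g u) h = ip f h + ip g h"
    and scale_left: "f \<in> H \<Longrightarrow> g \<in> H \<Longrightarrow> ip (\<lambda>u. c * f u) g = c * ip f g"
    and nonneg: "f \<in> H \<Longrightarrow> 0 \<le> ip f f"

definition span_of :: "('i \<Rightarrow> 'w \<Rightarrow> real) \<Rightarrow> 'i set \<Rightarrow> ('w \<Rightarrow> real) set" where
  "span_of X J = {(\<lambda>u. \<Sum>x\<in>F. c x * X x u) | F c. finite F \<and> F \<subseteq> J}"

text \<open>All functions at distance zero from a limit belong to the closure, so a projection may be
  replaced by a version with better measurability.\<close>

definition closed_span ::
  "('w \<Rightarrow> real) set \<Rightarrow> (('w \<Rightarrow> real) \<Rightarrow> ('w \<Rightarrow> real) \<Rightarrow> real) \<Rightarrow> ('i \<Rightarrow> 'w \<Rightarrow> real) \<Rightarrow> 'i set \<Rightarrow> ('w \<Rightarrow> real) set" where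
  "closed_span H ip X J =
     {p\<in>H. \<forall>\<epsilon>>0. \<exists>h\<in>span_of X J. ip (\<lambda>u. p u - h u) (\<lambda>u. p u - h u) < \<epsilon>}"

lemma span_ofI: "finite F \<Longrightarrow> F \<subseteq> J \<Longrightarrow> (\<lambda>u. \<Sum>x\<in>F. c x * X x u) \<in> span_of X J"
  unfolding span_of_def by blast

lemma span_of_add:
  assumes "f \<in> span_of X J" "g \<in> span_of X J"
  shows "(\<lambda>u. f u + g u) \<in> span_of X J"
proof -
  obtain F c where F: "f = (\<lambda>u. \<Sum>x\<in>F. c x * X x u)" "finite F" "F \<subseteq> J" using assms(1) unfolding span_of_def by blast
  obtain G d where G: "g = (\<lambda>u. \<Sum>x\<in>G. d x * X x u)" "finite G" "G \<subseteq> J" using assms(2) unfolding span_of_def by blast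
  have "f u + g u = (\<Sum>x\<in>F \<union> G. (extend_coeff F c x + extend_coeff G d x) * X x u)" for u
    unfolding distrib_right sum.distrib F(1) G(1)
    using sum_extend_coeff[of "F \<union> G" F c "\<lambda>x. X x u"] sum_extend_coeff[of "F \<union> G" G d "\<lambda>x. X x u"] F G by simp
  then have "(\<lambda>u. f u + g u) = (\<lambda>u. \<Sum>x\<in>F \<union> G. (extend_coeff F c x + extend_coeff G d x) * X x u)" by blast
  then show ?thesis using span_ofI[of "F \<union> G" J] F G by simp
qed

lemma span_of_scale:
  assumes "f \<in> span_of X J"
  shows "(\<lambda>u. a * f u) \<in> span_of X J"
proof -
  obtain F c where F: "f = (\<lambda>u. \<Sum>x\<in>F. c x * X x u)" "finite F" "F \<subseteq> J" using assms(1) unfolding span_of_def by blast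
  have "(\<lambda>u. a * f u) = (\<lambda>u. \<Sum>x\<in>F. (a * c x) * X x u)"
    unfolding F(1) by (simp add: sum_distrib_left mult.assoc)
  then show ?thesis using span_ofI[OF F(2,3), of "\<lambda>x. a * c x" X] by simp
qed

lemma span_of_mono: "J \<subseteq> J' \<Longrightarrow> span_of X J \<subseteq> span_of X J'"
  unfolding span_of_def by blast

lemma span_of_zero: "(\<lambda>u. 0) \<in> span_of X J"
  using span_ofI[of "{}" J] by simp

lemma span_of_base: "t \<in> J \<Longrightarrow> X t \<in> span_of X J"
  using span_ofI[of "{t}" J "\<lambda>_. 1" X] by simp

context semi_inner
begin

abbreviation sq_norm :: "('w \<Rightarrow> real) \<Rightarrow> real" where "sq_norm f \<equiv> ip f f"

lemma diff_in: "f \<in> H \<Longrightarrow> g \<in> H \<Longrightarrow> (\<lambda>u. f u - g u) \<in> H"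
  using add_in[OF _ scale_in[of g "-1"], of f] by simp

lemma add_right: "f \<in> H \<Longrightarrow> g \<in> H \<Longrightarrow> h \<in> H \<Longrightarrow> ip f (\<lambda>u. g u + h u) = ip f g + ip f h"
  using add_left[of g h f] sym[of f] add_in[of g h] by simp

lemma scale_right: "f \<in> H \<Longrightarrow> g \<in> H \<Longrightarrow> ip f (\<lambda>u. c * g u) = c * ip f g"
  using scale_left[of g f c] sym[of f] scale_in[of g c] by simp

lemma diff_left: "f \<in> H \<Longrightarrow> g \<in> H \<Longrightarrow> h \<in> H \<Longrightarrow> ip (\<lambda>u. f u - g u) h = ip f h - ip g h"
  using add_left[of f "\<lambda>u. (-1) * g u" h] scale_left[of g h "-1"] scale_in[of g "-1"] by simp

lemma diff_right: "f \<in> H \<Longrightarrow> g \<in> H \<Longrightarrow> h \<in> H \<Longrightarrow> ip f (\<lambda>u. g u - h u) = ip f g - ip f h"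
  using diff_left[of g h f] sym[of f] diff_in[of g h] by simp

lemma sum_in: "finite F \<Longrightarrow> (\<And>x. x \<in> F \<Longrightarrow> X x \<in> H) \<Longrightarrow> (\<lambda>u. \<Sum>x\<in>F. c x * X x u) \<in> H"
proof (induction F rule: finite_induct)
  case empty then show ?case using zero_in by simp
next
  case (insert x F)
  have "(\<lambda>u. c x * X x u + (\<Sum>x\<in>F. c x * X x u)) \<in> H"
    by (rule add_in[OF scale_in]) (use insert in auto)
  then show ?case using insert by simp
qed

lemma zero_left: "h \<in> H \<Longrightarrow> ip (\<lambda>u. 0) h = 0"
  using scale_left[OF zero_in, of h 0] by simp

lemma sum_left:
  "finite F \<Longrightarrow> (\<And>x. x \<in> F \<Longrightarrow> X x \<in> H) \<Longrightarrow> h \<in> H \<Longrightarrow>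
    ip (\<lambda>u. \<Sum>x\<in>F. c x * X x u) h = (\<Sum>x\<in>F. c x * ip (X x) h)"
proof (induction F rule: finite_induct)
  case empty then show ?case using zero_left by simp
next
  case (insert x F)
  have "ip (\<lambda>u. c x * X x u + (\<Sum>x\<in>F. c x * X x u)) h = ip (\<lambda>u. c x * X x u) h + ip (\<lambda>u. \<Sum>x\<in>F. c x * X x u) h"
    by (rule add_left[OF scale_in sum_in]) (use insert in auto)
  then show ?case using insert by (simp add: scale_left)
qed

lemma sum_right:
  assumes "finite F" "\<And>x. x \<in> F \<Longrightarrow> X x \<in> H" "h \<in> H"
  shows "ip h (\<lambda>u. \<Sum>x\<in>F. c x * X x u) = (\<Sum>x\<in>F. c x * ip h (X x))"
proof -
  have "ip h (\<lambda>u. \<Sum>x\<in>F. c x * X x u) = (\<Sum>x\<in>F. c x * ip (X x) h)"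
    using sum_left[OF assms] sym[OF assms(3) sum_in[OF assms(1,2)]] by simp
  also have "\<dots> = (\<Sum>x\<in>F. c x * ip h (X x))"
    by (rule sum.cong) (use assms sym in auto)
  finally show ?thesis .
qed

lemma norm_diff_scale:
  assumes "f \<in> H" "h \<in> H"
  shows "sq_norm (\<lambda>u. f u - a * h u) = ip f f - 2 * a * ip f h + a\<^sup>2 * ip h h"
  using assms sym[of h f]
  by (simp add: diff_left diff_right scale_left scale_right diff_in scale_in power2_eq_square algebra_simps)

lemma norm_diff:
  assumes "f \<in> H" "h \<in> H"
  shows "sq_norm (\<lambda>u. f u - h u) = ip f f - 2 * ip f h + ip h h"
  using norm_diff_scale[OF assms, of 1] by simp

lemma weak_Cauchy_Schwarz:
  assumes "f \<in> H" "h \<in> H"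
  shows "(ip f h)\<^sup>2 \<le> (ip h h + 1) * ip f f"
proof (rule quadratic_bound)
  show "0 \<le> ip h h" by (rule nonneg[OF assms(2)])
  fix a
  have "0 \<le> sq_norm (\<lambda>u. f u - a * h u)"
    by (rule nonneg) (intro diff_in scale_in assms)
  then show "2 * a * ip f h \<le> ip f f + a\<^sup>2 * ip h h" unfolding norm_diff_scale[OF assms] by simp
qed

lemma span_of_in:
  assumes "\<And>x. x \<in> J \<Longrightarrow> X x \<in> H" "h \<in> span_of X J"
  shows "h \<in> H"
  using assms sum_in unfolding span_of_def by blast

text \<open>A sequence in \<open>T\<close> that minimises the distance to \<open>f\<close> is Cauchy by the parallelogram law, and its
  residuals become orthogonal to \<open>T\<close> because the distance cannot be decreased along any direction
  in \<open>T\<close>. The choice of the space that contains a limit is left open.\<close>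

lemma approx_projection:
  assumes f: "f \<in> H" and T: "T \<subseteq> H" "T \<noteq> {}"
    and Tadd: "\<And>g h. g \<in> T \<Longrightarrow> h \<in> T \<Longrightarrow> (\<lambda>u. g u + h u) \<in> T"
    and Tscale: "\<And>g c. g \<in> T \<Longrightarrow> (\<lambda>u. c * g u) \<in> T"
  obtains \<sigma> where "\<And>n. \<sigma> n \<in> T"
    and "\<And>\<epsilon>. \<epsilon> > 0 \<Longrightarrow> \<exists>N. \<forall>m\<ge>N. \<forall>n\<ge>N. sq_norm (\<lambda>u. \<sigma> m u - \<sigma> n u) < \<epsilon>"
    and "\<And>h. h \<in> T \<Longrightarrow> (\<lambda>n. ip (\<lambda>u. f u - \<sigma> n u) h) \<longlonglongrightarrow> 0"
proof -
  define N where "N h = sq_norm (\<lambda>u. f u - h u)" for h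
  define d where "d = Inf (N ` T)"
  have bdd: "bdd_below (N ` T)"
    by (rule bdd_belowI[of _ 0]) (use nonneg diff_in f T N_def in auto)
  have dle: "d \<le> N h" if "h \<in> T" for h
    unfolding d_def by (rule cInf_lower[OF _ bdd]) (use that in auto)
  have "\<exists>h\<in>T. N h < d + 1 / (real n + 1)" for n
    using cInf_lessD[of "N ` T" "d + 1 / (real n + 1)"] T(2) unfolding d_def by auto
  then obtain \<sigma> where \<sigma>: "\<And>n. \<sigma> n \<in> T" "\<And>n. N (\<sigma> n) < d + 1 / (real n + 1)" by metis
  have \<sigma>H: "\<sigma> n \<in> H" for n using \<sigma>(1) T(1) by blast
  have NH: "N h = ip f f - 2 * ip f h + ip h h" if "h \<in> H" for h
    unfolding N_def by (rule norm_diff[OF f that])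
  have cau: "sq_norm (\<lambda>u. \<sigma> m u - \<sigma> n u) \<le> 2 / (real m + 1) + 2 / (real n + 1)" for m n
  proof -
    let ?h = "\<lambda>u. (1/2) * (\<sigma> m u + \<sigma> n u)"
    have h: "?h \<in> T" by (rule Tscale[OF Tadd[OF \<sigma>(1) \<sigma>(1)]])
    have "ip ?h ?h = (1/4) * (sq_norm (\<sigma> m) + 2 * ip (\<sigma> m) (\<sigma> n) + sq_norm (\<sigma> n))"
      unfolding scale_left[OF add_in[OF \<sigma>H \<sigma>H] scale_in[OF add_in[OF \<sigma>H \<sigma>H]]]
        scale_right[OF add_in[OF \<sigma>H \<sigma>H] add_in[OF \<sigma>H \<sigma>H]]
        add_left[OF \<sigma>H \<sigma>H add_in[OF \<sigma>H \<sigma>H]] add_right[OF \<sigma>H \<sigma>H \<sigma>H]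
      using sym[OF \<sigma>H \<sigma>H, of m n] by simp
    moreover have "ip f ?h = (1/2) * (ip f (\<sigma> m) + ip f (\<sigma> n))"
      unfolding scale_right[OF f add_in[OF \<sigma>H \<sigma>H]] add_right[OF f \<sigma>H \<sigma>H] ..
    moreover have "d \<le> N ?h" by (rule dle[OF h])
    moreover have "N ?h = ip f f - 2 * ip f ?h + ip ?h ?h" by (rule NH) (use h T in blast)
    ultimately have "sq_norm (\<lambda>u. \<sigma> m u - \<sigma> n u) \<le> 2 * N (\<sigma> m) + 2 * N (\<sigma> n) - 4 * d"
      unfolding norm_diff[OF \<sigma>H \<sigma>H] NH[OF \<sigma>H] by simp
    then show ?thesis using \<sigma>(2)[of m] \<sigma>(2)[of n] by simp
  qed
  have "\<exists>M. \<forall>m\<ge>M. \<forall>n\<ge>M. sq_norm (\<lambda>u. \<sigma> m u - \<sigma> n u) < \<epsilon>" if e: "\<epsilon> > 0" for \<epsilon>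
  proof -
    obtain M where M: "inverse (real (Suc M)) < \<epsilon> / 4" using reals_Archimedean[of "\<epsilon> / 4"] e by auto
    have "2 / (real m + 1) < \<epsilon> / 2" if "m \<ge> M" for m
    proof -
      have "inverse (real (Suc m)) \<le> inverse (real (Suc M))" by (rule le_imp_inverse_le) (use that in auto)
      with M have "inverse (real (Suc m)) < \<epsilon> / 4" by linarith
      then show ?thesis by (simp add: inverse_eq_divide add.commute)
    qed
    then have "sq_norm (\<lambda>u. \<sigma> m u - \<sigma> n u) < \<epsilon>" if "m \<ge> M" "n \<ge> M" for m n
      using cau[of m n] that by (smt (verit) field_sum_of_halves)
    then show ?thesis by blast
  qed
  moreover have "(\<lambda>n. ip (\<lambda>u. f u - \<sigma> n u) h) \<longlonglongrightarrow> 0" if h: "h \<in> T" for h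
  proof -
    have hH: "h \<in> H" using h T by blast
    have "(ip (\<lambda>u. f u - \<sigma> n u) h)\<^sup>2 \<le> (ip h h + 1) * (1 / (real n + 1))" for n
    proof (rule quadratic_bound)
      show "0 \<le> ip h h" by (rule nonneg[OF hH])
      fix a
      let ?g = "\<lambda>u. \<sigma> n u + a * h u"
      have "d \<le> N ?g" by (rule dle[OF Tadd[OF \<sigma>(1) Tscale[OF h]]])
      also have "N ?g = sq_norm (\<lambda>u. f u - \<sigma> n u - a * h u)"
        unfolding N_def by (simp add: diff_diff_eq)
      also have "\<dots> = N (\<sigma> n) - 2 * a * ip (\<lambda>u. f u - \<sigma> n u) h + a\<^sup>2 * ip h h"
        unfolding N_def by (rule norm_diff_scale[OF diff_in[OF f \<sigma>H] hH])
      finally show "2 * a * ip (\<lambda>u. f u - \<sigma> n u) h \<le> 1 / (real n + 1) + a\<^sup>2 * ip h h"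
        using \<sigma>(2)[of n] by simp
    qed
    note sq = this
    have bound: "(\<lambda>n. (ip h h + 1) * (1 / (real n + 1))) \<longlonglongrightarrow> 0"
      using tendsto_mult_right_zero[OF LIMSEQ_inverse_real_of_nat, of "ip h h + 1"]
      by (simp add: inverse_eq_divide add.commute)
    have "(\<lambda>n. (ip (\<lambda>u. f u - \<sigma> n u) h)\<^sup>2) \<longlonglongrightarrow> 0"
      by (rule tendsto_sandwich[OF _ _ tendsto_const bound])
        (auto intro!: always_eventually sq simp del: times_divide_eq_right)
    then show ?thesis by (simp add: tendsto_null_power)
  qed
  ultimately show ?thesis using that \<sigma>(1) by blast
qed

lemma limit_orthogonal:
  assumes f: "f \<in> H" and \<sigma>: "\<And>n. \<sigma> n \<in> H" and p: "p \<in> H" and h: "h \<in> H"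
    and lim: "(\<lambda>n. sq_norm (\<lambda>u. \<sigma> n u - p u)) \<longlonglongrightarrow> 0"
    and orth: "(\<lambda>n. ip (\<lambda>u. f u - \<sigma> n u) h) \<longlonglongrightarrow> 0"
  shows "ip (\<lambda>u. f u - p u) h = 0"
proof -
  have "(\<lambda>n. (ip (\<lambda>u. \<sigma> n u - p u) h)\<^sup>2) \<longlonglongrightarrow> 0"
  proof (rule tendsto_sandwich[OF _ _ tendsto_const])
    show "(\<lambda>n. (ip h h + 1) * sq_norm (\<lambda>u. \<sigma> n u - p u)) \<longlonglongrightarrow> 0"
      by (rule tendsto_mult_right_zero[OF lim])
  qed (auto intro!: always_eventually weak_Cauchy_Schwarz diff_in \<sigma> p h)
  then have "(\<lambda>n. ip (\<lambda>u. \<sigma> n u - p u) h) \<longlonglongrightarrow> 0" by (simp add: tendsto_null_power)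
  from tendsto_add[OF orth this]
  have "(\<lambda>n. ip (\<lambda>u. f u - p u) h) \<longlonglongrightarrow> 0"
    unfolding diff_left[OF f \<sigma> h] diff_left[OF \<sigma> p h] diff_left[OF f p h] by simp
  then show ?thesis by (simp add: LIMSEQ_const_iff)
qed

text \<open>Here \<open>P\<close> is a set of representatives among which the limits are to be found; for random
  variables, those measurable with respect to the family spanning the subspace.\<close>

lemma projection_exists:
  assumes f: "f \<in> H" and X: "\<And>x. x \<in> J \<Longrightarrow> X x \<in> H" and P: "P \<subseteq> H"
    and complete: "\<And>\<sigma>. (\<And>n. \<sigma> n \<in> span_of X J) \<Longrightarrow>
      (\<And>\<epsilon>. \<epsilon> > 0 \<Longrightarrow> \<exists>N. \<forall>m\<ge>N. \<forall>n\<ge>N. sq_norm (\<lambda>u. \<sigma> m u - \<sigma> n u) < \<epsilon>) \<Longrightarrow>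
      \<exists>p\<in>P. (\<lambda>n. sq_norm (\<lambda>u. \<sigma> n u - p u)) \<longlonglongrightarrow> 0"
  shows "\<exists>p\<in>P. p \<in> closed_span H ip X J \<and> (\<forall>x\<in>J. ip (\<lambda>u. f u - p u) (X x) = 0)"
proof -
  have TH: "span_of X J \<subseteq> H" using span_of_in X by blast
  obtain \<sigma> where \<sigma>: "\<And>n. \<sigma> n \<in> span_of X J"
    "\<And>\<epsilon>. \<epsilon> > 0 \<Longrightarrow> \<exists>N. \<forall>m\<ge>N. \<forall>n\<ge>N. sq_norm (\<lambda>u. \<sigma> m u - \<sigma> n u) < \<epsilon>"
    "\<And>h. h \<in> span_of X J \<Longrightarrow> (\<lambda>n. ip (\<lambda>u. f u - \<sigma> n u) h) \<longlonglongrightarrow> 0"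
    using approx_projection[OF f TH _ span_of_add span_of_scale] span_of_zero by blast
  obtain p where p: "p \<in> P" "(\<lambda>n. sq_norm (\<lambda>u. \<sigma> n u - p u)) \<longlonglongrightarrow> 0"
    using complete[OF \<sigma>(1,2)] by blast
  have pH: "p \<in> H" and \<sigma>H: "\<And>n. \<sigma> n \<in> H" using p(1) P \<sigma>(1) TH by auto
  have flip: "sq_norm (\<lambda>u. p u - \<sigma> n u) = sq_norm (\<lambda>u. \<sigma> n u - p u)" for n
    unfolding norm_diff[OF pH \<sigma>H] norm_diff[OF \<sigma>H pH] using sym[OF pH \<sigma>H, of n] by simp
  have "\<exists>h\<in>span_of X J. sq_norm (\<lambda>u. p u - h u) < \<epsilon>" if "\<epsilon> > 0" for \<epsilon>
  proof -
    have "\<forall>\<^sub>F n in sequentially. sq_norm (\<lambda>u. \<sigma> n u - p u) < \<epsilon>"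
      by (rule order_tendstoD(2)[OF p(2) that])
    then obtain n where "sq_norm (\<lambda>u. \<sigma> n u - p u) < \<epsilon>"
      by (auto simp: eventually_sequentially)
    then have "sq_norm (\<lambda>u. p u - \<sigma> n u) < \<epsilon>" unfolding flip .
    then show ?thesis using \<sigma>(1) by blast
  qed
  then have "p \<in> closed_span H ip X J" unfolding closed_span_def using pH by blast
  moreover have "ip (\<lambda>u. f u - p u) (X x) = 0" if x: "x \<in> J" for x
    by (rule limit_orthogonal[OF f \<sigma>H pH X[OF x] p(2) \<sigma>(3)[OF span_of_base[of x J X]]]) (use x in auto)
  ultimately show ?thesis using p(1) by blast
qed

lemma closed_span_in: "p \<in> closed_span H ip X J \<Longrightarrow> p \<in> H"
  unfolding closed_span_def by blast

lemma closed_span_mono: "J \<subseteq> J' \<Longrightarrow> closed_span H ip X J \<subseteq> closed_span H ip X J'"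
  unfolding closed_span_def using span_of_mono by blast

lemma span_in_closed_span: "h \<in> span_of X J \<Longrightarrow> h \<in> H \<Longrightarrow> h \<in> closed_span H ip X J"
  unfolding closed_span_def using zero_left[OF zero_in] by (auto intro!: bexI[of _ h])

lemma closed_span_base: "t \<in> J \<Longrightarrow> X t \<in> H \<Longrightarrow> X t \<in> closed_span H ip X J"
  by (rule span_in_closed_span[OF span_of_base])

lemma closed_span_add:
  assumes X: "\<And>x. x \<in> J \<Longrightarrow> X x \<in> H" and p: "p \<in> closed_span H ip X J" and q: "q \<in> closed_span H ip X J"
  shows "(\<lambda>u. p u + q u) \<in> closed_span H ip X J"
proof -
  have pH: "p \<in> H" "q \<in> H" using closed_span_in p q by auto
  have "\<exists>h\<in>span_of X J. sq_norm (\<lambda>u. p u + q u - h u) < \<epsilon>" if e: "\<epsilon> > 0" for \<epsilon>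
  proof -
    have e4: "\<epsilon> / 4 > 0" using e by simp
    obtain h k where h: "h \<in> span_of X J" "sq_norm (\<lambda>u. p u - h u) < \<epsilon> / 4"
      and k: "k \<in> span_of X J" "sq_norm (\<lambda>u. q u - k u) < \<epsilon> / 4"
      using p q e4 unfolding closed_span_def by blast
    define a b where "a = (\<lambda>u. p u - h u)" and "b = (\<lambda>u. q u - k u)"
    have hk: "h \<in> H" "k \<in> H" using h(1) k(1) span_of_in[of J X, OF X] by auto
    have ab: "a \<in> H" "b \<in> H" unfolding a_def b_def using pH hk diff_in by auto
    have "sq_norm (\<lambda>u. a u + b u) + sq_norm (\<lambda>u. a u - b u) = 2 * ip a a + 2 * ip b b"
      using ab by (simp add: add_left add_right diff_left diff_right add_in diff_in)
    then have "sq_norm (\<lambda>u. a u + b u) \<le> 2 * ip a a + 2 * ip b b"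
      using nonneg[OF diff_in[OF ab]] by linarith
    also have "\<dots> < \<epsilon>" using h(2) k(2) unfolding a_def b_def by simp
    finally have "sq_norm (\<lambda>u. p u + q u - (h u + k u)) < \<epsilon>"
      unfolding a_def b_def by (simp add: algebra_simps)
    then show ?thesis by (rule bexI[OF _ span_of_add[OF h(1) k(1)]])
  qed
  then show ?thesis unfolding closed_span_def using add_in[OF pH] by blast
qed

lemma closed_span_scale:
  assumes X: "\<And>x. x \<in> J \<Longrightarrow> X x \<in> H" and p: "p \<in> closed_span H ip X J"
  shows "(\<lambda>u. a * p u) \<in> closed_span H ip X J"
proof -
  have pH: "p \<in> H" using closed_span_in p by auto
  have "\<exists>h\<in>span_of X J. sq_norm (\<lambda>u. a * p u - h u) < \<epsilon>" if e: "\<epsilon> > 0" for \<epsilon>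
  proof -
    have e4: "\<epsilon> / (a\<^sup>2 + 1) > 0" using e by (simp add: add_nonneg_pos)
    obtain h where h: "h \<in> span_of X J" "sq_norm (\<lambda>u. p u - h u) < \<epsilon> / (a\<^sup>2 + 1)"
      using p e4 unfolding closed_span_def by blast
    have hH: "h \<in> H" using h(1) span_of_in[of J X, OF X] by auto
    have d: "(\<lambda>u. p u - h u) \<in> H" using pH hH diff_in by auto
    have "(\<lambda>u. a * p u - a * h u) = (\<lambda>u. a * (p u - h u))" by (simp add: right_diff_distrib)
    then have "sq_norm (\<lambda>u. a * p u - a * h u) = a\<^sup>2 * sq_norm (\<lambda>u. p u - h u)"
      using scale_left[OF d scale_in[OF d], of a a] scale_right[OF d d, of a] by (simp add: power2_eq_square)
    also have "\<dots> \<le> a\<^sup>2 * (\<epsilon> / (a\<^sup>2 + 1))" using h(2) by (intro mult_left_mono) auto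
    also have "\<dots> < (a\<^sup>2 + 1) * (\<epsilon> / (a\<^sup>2 + 1))" by (intro mult_strict_right_mono e4) auto
    also have "\<dots> = \<epsilon>" by (simp add: add_nonneg_eq_0_iff)
    finally show ?thesis by (rule bexI[OF _ span_of_scale[OF h(1)]])
  qed
  then show ?thesis unfolding closed_span_def using scale_in[OF pH] by blast
qed

lemma closed_span_diff:
  assumes X: "\<And>x. x \<in> J \<Longrightarrow> X x \<in> H" and p: "p \<in> closed_span H ip X J" and q: "q \<in> closed_span H ip X J"
  shows "(\<lambda>u. p u - q u) \<in> closed_span H ip X J"
  using closed_span_add[OF X p closed_span_scale[OF X q, of "-1"]] by simp

text \<open>Orthogonality to generators passes to the closed span, by continuity of the inner product.\<close>

lemma orthogonal_closed_span:
  assumes X: "\<And>x. x \<in> J \<Longrightarrow> X x \<in> H" and V: "V \<in> H" "\<And>x. x \<in> J \<Longrightarrow> ip V (X x) = 0"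
    and p: "p \<in> closed_span H ip X J"
  shows "ip V p = 0"
proof -
  have pH: "p \<in> H" using closed_span_in p by auto
  have "(ip V p)\<^sup>2 \<le> 0"
  proof (rule field_le_epsilon)
    fix e :: real assume e: "e > 0"
    have vv: "0 \<le> ip V V" by (rule nonneg[OF V(1)])
    have e4: "e / (ip V V + 1) > 0" using e vv by (simp add: add_nonneg_pos)
    obtain h where h: "h \<in> span_of X J" "sq_norm (\<lambda>u. p u - h u) < e / (ip V V + 1)"
      using p e4 unfolding closed_span_def by blast
    have hH: "h \<in> H" using h(1) span_of_in[of J X, OF X] by auto
    obtain F c where F: "h = (\<lambda>u. \<Sum>x\<in>F. c x * X x u)" "finite F" "F \<subseteq> J"
      using h(1) unfolding span_of_def by blast
    have "ip V h = (\<Sum>x\<in>F. c x * ip V (X x))"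
      unfolding F(1) by (rule sum_right) (use F X V in auto)
    also have "\<dots> = 0" using V(2) F(3) by (intro sum.neutral) auto
    finally have "ip V p = ip (\<lambda>u. p u - h u) V"
      using diff_left[OF pH hH V(1)] sym[OF V(1) pH] sym[OF V(1) hH] by simp
    then have "(ip V p)\<^sup>2 \<le> (ip V V + 1) * sq_norm (\<lambda>u. p u - h u)"
      using weak_Cauchy_Schwarz[OF diff_in[OF pH hH] V(1)] by simp
    also have "\<dots> \<le> (ip V V + 1) * (e / (ip V V + 1))"
      using h(2) vv by (intro mult_left_mono) auto
    also have "\<dots> = e" using vv by simp
    finally show "(ip V p)\<^sup>2 \<le> 0 + e" by simp
  qed
  then show ?thesis by simp
qed

text \<open>Completing the square.\<close>

lemma dual_value_eq:
  assumes f: "f \<in> H" and X: "\<And>x. x \<in> F \<Longrightarrow> X x \<in> H" and F: "finite F"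
  shows "dual_value (\<lambda>s t. ip (X s) (X t)) (\<lambda>x. ip f (X x)) F c =
    ip f f - sq_norm (\<lambda>u. f u - (\<Sum>x\<in>F. c x * X x u))"
proof -
  let ?h = "\<lambda>u. \<Sum>x\<in>F. c x * X x u"
  have h: "?h \<in> H" by (rule sum_in[OF F X])
  have "ip ?h ?h = (\<Sum>x\<in>F. c x * ip (X x) ?h)" by (rule sum_left[OF F X h])
  also have "\<dots> = (\<Sum>x\<in>F. c x * (\<Sum>y\<in>F. c y * ip (X x) (X y)))"
    by (intro sum.cong refl arg_cong2[of _ _ _ _ "(*)"] sum_right F X)
  finally have "ip ?h ?h = quad (\<lambda>s t. ip (X s) (X t)) F c" unfolding quad_alt .
  moreover have "ip f ?h = (\<Sum>x\<in>F. c x * ip f (X x))" by (rule sum_right[OF F X f])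
  ultimately show ?thesis unfolding dual_value_def norm_diff[OF f h] by simp
qed

text \<open>Only the projection \<open>p\<close> of \<open>f\<close> matters for the values \<open>\<langle>f, X\<^sub>x\<rangle>\<close> on \<open>J\<close>, and the supremum of
  \<open>\<parallel>p\<parallel>\<^sup>2 - \<parallel>p - h\<parallel>\<^sup>2\<close> over the span is \<open>\<parallel>p\<parallel>\<^sup>2\<close> because \<open>p\<close> is a limit of elements \<open>h\<close>.\<close>

lemma energy_eq_norm_projection:
  assumes f: "f \<in> H" and X: "\<And>x. x \<in> J \<Longrightarrow> X x \<in> H"
    and p: "p \<in> closed_span H ip X J" and orth: "\<And>x. x \<in> J \<Longrightarrow> ip (\<lambda>u. f u - p u) (X x) = 0"
  shows "finite_energy J (\<lambda>s t. ip (X s) (X t)) (\<lambda>x. ip f (X x))"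
    and "energy J (\<lambda>s t. ip (X s) (X t)) (\<lambda>x. ip f (X x)) = ip p p"
proof -
  let ?K = "\<lambda>s t. ip (X s) (X t)"
  have pH: "p \<in> H" using closed_span_in p by auto
  have eq: "ip f (X x) = ip p (X x)" if "x \<in> J" for x
    using orth[OF that] diff_left[OF f pH X[OF that]] by simp
  have dv: "dual_value ?K (\<lambda>x. ip f (X x)) F c =
    ip p p - sq_norm (\<lambda>u. p u - (\<Sum>x\<in>F. c x * X x u))"
    if F: "finite F" "F \<subseteq> J" for F c
  proof -
    have "dual_value ?K (\<lambda>x. ip f (X x)) F c = dual_value ?K (\<lambda>x. ip p (X x)) F c"
      by (rule dual_value_cong) (use eq F in auto)
    then show ?thesis using dual_value_eq[OF pH _ F(1), of X c] X F(2) by auto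
  qed
  have le: "dual_value ?K (\<lambda>x. ip f (X x)) F c \<le> ip p p" if F: "finite F" "F \<subseteq> J" for F c
  proof -
    have "(\<lambda>u. \<Sum>x\<in>F. c x * X x u) \<in> H" by (rule sum_in) (use F X in auto)
    then show ?thesis unfolding dv[OF F] using nonneg[OF diff_in[OF pH]] by simp
  qed
  show fe: "finite_energy J ?K (\<lambda>x. ip f (X x))" by (rule finite_energyI[OF le])
  show "energy J ?K (\<lambda>x. ip f (X x)) = ip p p"
  proof (rule antisym)
    show "energy J ?K (\<lambda>x. ip f (X x)) \<le> ip p p" by (rule energy_least[OF le])
    show "ip p p \<le> energy J ?K (\<lambda>x. ip f (X x))"
    proof (rule field_le_epsilon)
      fix e :: real assume "e > 0"
      then obtain h where h: "h \<in> span_of X J" "sq_norm (\<lambda>u. p u - h u) < e"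
        using p unfolding closed_span_def by blast
      obtain F c where F: "h = (\<lambda>u. \<Sum>x\<in>F. c x * X x u)" "finite F" "F \<subseteq> J"
        using h(1) unfolding span_of_def by blast
      have "ip p p = dual_value ?K (\<lambda>x. ip f (X x)) F c + sq_norm (\<lambda>u. p u - h u)"
        unfolding dv[OF F(2,3)] F(1) by simp
      also have "\<dots> \<le> energy J ?K (\<lambda>x. ip f (X x)) + e"
        using dual_value_le_energy[OF fe F(2,3), of c] h(2) by linarith
      finally show "ip p p \<le> energy J ?K (\<lambda>x. ip f (X x)) + e" .
    qed
  qed
qed

text \<open>The polarised form: inner products in the reproducing kernel space of a Gram kernel are inner
  products of projections.\<close>

lemma energy_inner_eq_projection:
  assumes f: "f \<in> H" and g: "g \<in> H" and X: "\<And>x. x \<in> J \<Longrightarrow> X x \<in> H"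
    and p: "p \<in> closed_span H ip X J" "\<And>x. x \<in> J \<Longrightarrow> ip (\<lambda>u. f u - p u) (X x) = 0"
    and q: "q \<in> closed_span H ip X J" "\<And>x. x \<in> J \<Longrightarrow> ip (\<lambda>u. g u - q u) (X x) = 0"
  shows "energy_inner J (\<lambda>s t. ip (X s) (X t)) (\<lambda>x. ip f (X x)) (\<lambda>x. ip g (X x)) = ip p q"
proof -
  have H: "p \<in> H" "q \<in> H" using closed_span_in p q by auto
  let ?K = "\<lambda>s t. ip (X s) (X t)"
  have "energy J ?K (\<lambda>x. ip (\<lambda>u. f u + g u) (X x)) = sq_norm (\<lambda>u. p u + q u)"
  proof (rule energy_eq_norm_projection(2)[OF add_in[OF f g] X closed_span_add[OF X p(1) q(1)]])
    show "ip (\<lambda>u. f u + g u - (p u + q u)) (X x) = 0" if "x \<in> J" for x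
      using p(2)[OF that] q(2)[OF that] f g H X[OF that]
      by (simp add: add_left diff_left add_in diff_in)
  qed
  moreover have "energy J ?K (\<lambda>x. ip (\<lambda>u. f u - g u) (X x)) = sq_norm (\<lambda>u. p u - q u)"
  proof (rule energy_eq_norm_projection(2)[OF diff_in[OF f g] X closed_span_diff[OF X p(1) q(1)]])
    show "ip (\<lambda>u. f u - g u - (p u - q u)) (X x) = 0" if "x \<in> J" for x
      using p(2)[OF that] q(2)[OF that] f g H X[OF that]
      by (simp add: add_left diff_left add_in diff_in)
  qed
  moreover have "energy J ?K (\<lambda>x. ip (\<lambda>u. f u + g u) (X x)) = energy J ?K (\<lambda>x. ip f (X x) + ip g (X x))"
    "energy J ?K (\<lambda>x. ip (\<lambda>u. f u - g u) (X x)) = energy J ?K (\<lambda>x. ip f (X x) - ip g (X x))"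
    by (rule energy_cong; use f g X in \<open>auto simp: add_left diff_left\<close>)+
  ultimately show ?thesis
    unfolding energy_inner_def using H sym[OF H(2,1)]
    by (simp add: add_left add_right diff_left diff_right add_in diff_in)
qed

end

section \<open>The reproducing kernel inner product is the polarised energy\<close>

lemma semi_inner_energy:
  assumes cov: "covariance_on J K"
  shows "semi_inner {f. finite_energy J K f} (energy_inner J K)"
  by unfold_locales
    (use energy_zero[OF cov] parallelogram_le(1)[OF cov] energy_scale_le(1)[OF cov]
      energy_inner_sym[OF cov] energy_inner_add[OF cov] energy_inner_scale[OF cov]
      energy_inner_self[OF cov] energy_nonneg in \<open>simp_all\<close>)

text \<open>The norm of a reproducing kernel space is determined by the kernel because the kernel sections
  have dense span: the difference of \<open>f\<close> and its projection onto their closed span vanishes at every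
  point by the reproducing property, so \<open>f\<close> is its own projection.\<close>

lemma rkhs_norm_eq_energy:
  assumes "rkhs J K H ip" and f: "f \<in> H"
  shows "finite_energy J K f \<and> energy J K f = ip f f"
proof -
  interpret rkhs J K H ip by fact
  interpret semi_inner H ip
    by unfold_locales (fact zero_mem add_mem scale_mem ip_sym ip_add ip_scale ip_nonneg)+
  define X where "X t = zero_ext J (K t)" for t
  have X: "X t \<in> H" if "t \<in> J" for t unfolding X_def by (rule kernel_mem[OF that])
  have rep: "ip g (X t) = g t" if "g \<in> H" "t \<in> J" for g t
    unfolding X_def by (rule reproducing[OF that])
  have complete: "\<exists>p\<in>H. (\<lambda>n. ip (\<lambda>u. \<sigma> n u - p u) (\<lambda>u. \<sigma> n u - p u)) \<longlonglongrightarrow> 0"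
    if \<sigma>: "\<And>n. \<sigma> n \<in> span_of X J"
      "\<And>\<epsilon>. \<epsilon> > 0 \<Longrightarrow> \<exists>N. \<forall>m\<ge>N. \<forall>n\<ge>N. ip (\<lambda>u. \<sigma> m u - \<sigma> n u) (\<lambda>u. \<sigma> m u - \<sigma> n u) < \<epsilon>" for \<sigma>
  proof -
    have H: "\<sigma> n \<in> H" for n using span_of_in[OF X \<sigma>(1)] .
    have "\<exists>N. \<forall>m\<ge>N. \<forall>n\<ge>N. sqrt (ip (\<lambda>u. \<sigma> m u - \<sigma> n u) (\<lambda>u. \<sigma> m u - \<sigma> n u)) < \<epsilon>" if e: "0 < \<epsilon>" for \<epsilon>
    proof -
      have "sqrt x < \<epsilon>" if "x < \<epsilon>\<^sup>2" for x
        using real_sqrt_less_mono[OF that] e by simp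
      moreover have "\<epsilon>\<^sup>2 > 0" using e by simp
      ultimately show ?thesis using \<sigma>(2)[of "\<epsilon>\<^sup>2"] by blast
    qed
    from ip_complete[OF H this] obtain p where p: "p \<in> H"
      "(\<lambda>n. sqrt (ip (\<lambda>u. \<sigma> n u - p u) (\<lambda>u. \<sigma> n u - p u))) \<longlonglongrightarrow> 0" by blast
    have "(\<lambda>n. (sqrt (ip (\<lambda>u. \<sigma> n u - p u) (\<lambda>u. \<sigma> n u - p u)))\<^sup>2) \<longlonglongrightarrow> 0\<^sup>2"
      by (rule tendsto_power[OF p(2)])
    moreover have "(sqrt (ip (\<lambda>u. \<sigma> n u - p u) (\<lambda>u. \<sigma> n u - p u)))\<^sup>2 = ip (\<lambda>u. \<sigma> n u - p u) (\<lambda>u. \<sigma> n u - p u)" for n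
      by (rule real_sqrt_pow2[OF nonneg[OF diff_in[OF H p(1)]]])
    ultimately show ?thesis using p(1) by (auto intro!: bexI[of _ p])
  qed
  have "\<exists>p\<in>H. p \<in> closed_span H ip X J \<and> (\<forall>x\<in>J. ip (\<lambda>u. f u - p u) (X x) = 0)"
    by (rule projection_exists[OF f X subset_refl complete])
  then obtain p where p: "p \<in> H" "p \<in> closed_span H ip X J" "\<forall>x\<in>J. ip (\<lambda>u. f u - p u) (X x) = 0"
    by blast
  have "f t = p t" for t
  proof (cases "t \<in> J")
    case True then show ?thesis using p(3) rep[OF diff_in[OF f p(1)] True] by simp
  next
    case False then show ?thesis using zero_off[OF f False] zero_off[OF p(1) False] by simp
  qed
  then have fp: "f = p" by blast
  have "finite_energy J (\<lambda>s t. ip (X s) (X t)) (\<lambda>x. ip f (X x)) \<and>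
    energy J (\<lambda>s t. ip (X s) (X t)) (\<lambda>x. ip f (X x)) = ip f f"
    using energy_eq_norm_projection[OF f X p(2)] p(3) fp by blast
  moreover have "ip (X s) (X t) = K s t" if "s \<in> J" "t \<in> J" for s t
    using rep[OF X[OF that(1)] that(2)] that unfolding X_def by (simp add: zero_ext_def)
  ultimately show ?thesis
    using rep[OF f] energy_cong[of J "\<lambda>s t. ip (X s) (X t)" K "\<lambda>x. ip f (X x)" f]
      finite_energy_cong[of J "\<lambda>s t. ip (X s) (X t)" K "\<lambda>x. ip f (X x)" f] by simp
qed

lemma rkhs_inner_eq_energy_inner:
  assumes cov: "covariance_on J K" and f: "finite_energy J K f" and g: "finite_energy J K g"
  shows "rkhs_inner J K f g = energy_inner J K f g"
proof -
  have fz: "finite_energy J K (zero_ext J f)" "finite_energy J K (zero_ext J g)"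
    using f g finite_energy_cong[of J K K "zero_ext J f" f] finite_energy_cong[of J K K "zero_ext J g" g]
    by (simp_all add: zero_ext_def)
  have eq: "energy_inner J K (zero_ext J f) (zero_ext J g) = energy_inner J K f g"
    by (rule energy_inner_cong) (auto simp: zero_ext_def)
  show ?thesis unfolding rkhs_inner_def
  proof (rule the_equality)
    show "\<exists>H ip. rkhs J K H ip \<and> zero_ext J f \<in> H \<and> zero_ext J g \<in> H \<and>
        energy_inner J K f g = ip (zero_ext J f) (zero_ext J g)"
      using rkhs_energy[OF cov] fz eq
      by (intro exI[of _ "{f. (\<forall>u. u \<notin> J \<longrightarrow> f u = 0) \<and> finite_energy J K f}"] exI[of _ "energy_inner J K"])
        (auto simp: zero_ext_def)
    fix r assume "\<exists>H ip. rkhs J K H ip \<and> zero_ext J f \<in> H \<and> zero_ext J g \<in> H \<and> r = ip (zero_ext J f) (zero_ext J g)"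
    then obtain H ip where h: "rkhs J K H ip" "zero_ext J f \<in> H" "zero_ext J g \<in> H"
      "r = ip (zero_ext J f) (zero_ext J g)" by blast
    interpret rkhs J K H ip by fact
    interpret semi_inner H ip
      by unfold_locales (fact zero_mem add_mem scale_mem ip_sym ip_add ip_scale ip_nonneg)+
    have "energy_inner J K (zero_ext J f) (zero_ext J g) = ip (zero_ext J f) (zero_ext J g)"
      unfolding energy_inner_def
      using rkhs_norm_eq_energy[OF h(1) add_in[OF h(2,3)]] rkhs_norm_eq_energy[OF h(1) diff_in[OF h(2,3)]] h(2,3)
        sym[OF h(3,2)]
      by (simp add: add_left add_right diff_left diff_right add_in diff_in)
    then show "r = energy_inner J K f g" using h(4) eq by simp
  qed
qed

section \<open>Gluing two covariances along the intersection of their domains\<close>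

text \<open>Split a finite combination into its part on \<open>A\<close> and the rest, which lies in \<open>B\<close>, and let \<open>f\<close> and
  \<open>g\<close> be their restrictions to \<open>A \<inter> B\<close>. The two diagonal quadratic forms are at least \<open>\<parallel>f\<parallel>\<^sup>2\<close> and
  \<open>\<parallel>g\<parallel>\<^sup>2\<close>, and the cross terms sum to \<open>\<langle>f, g\<rangle>\<close>; the total is at least \<open>\<parallel>f + g\<parallel>\<^sup>2\<close>.\<close>

lemma covariance_glue:
  assumes A: "covariance_on A K" and B: "covariance_on B K"
    and swap: "\<And>s t. s \<in> A \<Longrightarrow> t \<in> B \<Longrightarrow> K s t = K t s"
    and cross: "\<And>s t. s \<in> A - B \<Longrightarrow> t \<in> B - A \<Longrightarrow> K s t = energy_inner (A \<inter> B) K (K s) (K t)"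
  shows "covariance_on (A \<union> B) K"
proof -
  let ?J = "A \<inter> B"
  have J: "covariance_on ?J K" by (rule covariance_on_subset[OF A]) auto
  interpret semi_inner "{f. finite_energy ?J K f}" "energy_inner ?J K" by (rule semi_inner_energy[OF J])
  have feA: "finite_energy ?J K (K s)" if "s \<in> A" for s by (rule finite_energy_kernel[OF A _ that]) auto
  have feB: "finite_energy ?J K (K s)" if "s \<in> B" for s by (rule finite_energy_kernel[OF B _ that]) auto
  have Ksym: "K s t = K t s" if "s \<in> A \<union> B" "t \<in> A \<union> B" for s t
    using that swap covariance_on_sym[OF A] covariance_on_sym[OF B] by (metis UnE)
  \<comment> \<open>for \<open>s\<close> in the intersection the gluing formula is the reproducing property\<close>
  have cross': "K s t = energy_inner ?J K (K s) (K t)" if s: "s \<in> A" and t: "t \<in> B - A" for s t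
  proof (cases "s \<in> B")
    case True
    have "energy_inner ?J K (K s) (K t) = energy_inner ?J K (K t) (K s)"
      by (rule energy_inner_sym[OF J]) (use s t feA feB in auto)
    also have "\<dots> = K t s" by (rule energy_inner_reproducing[OF J]) (use s t feB True in auto)
    finally show ?thesis using swap[OF s, of t] t by simp
  next
    case False then show ?thesis using cross s t by simp
  qed
  have "0 \<le> quad K F c" if F: "finite F" "F \<subseteq> A \<union> B" for F c
  proof -
    define P Q where "P = F \<inter> A" and "Q = F - A"
    have PQ: "finite P" "finite Q" "P \<inter> Q = {}" "F = P \<union> Q" "P \<subseteq> A" "Q \<subseteq> B" "Q \<subseteq> B - A"
      using F unfolding P_def Q_def by auto
    define f g where "f = (\<lambda>u. \<Sum>x\<in>P. c x * K x u)" and "g = (\<lambda>u. \<Sum>x\<in>Q. c x * K x u)"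
    have f: "finite_energy ?J K f" "energy ?J K f \<le> quad K P c" unfolding f_def
      by (rule energy_restrict_le[OF A _ PQ(1,5)]; auto)+
    have g: "finite_energy ?J K g" "energy ?J K g \<le> quad K Q c" unfolding g_def
      by (rule energy_restrict_le[OF B _ PQ(2,6)]; auto)+
    have "energy_inner ?J K f g = (\<Sum>x\<in>P. c x * energy_inner ?J K (K x) g)"
      unfolding f_def by (rule sum_left) (use PQ feA g in auto)
    also have "\<dots> = (\<Sum>x\<in>P. c x * (\<Sum>y\<in>Q. c y * energy_inner ?J K (K x) (K y)))"
      unfolding g_def by (intro sum.cong refl arg_cong2[of _ _ _ _ "(*)"] sum_right) (use PQ feA feB in auto)
    also have "\<dots> = (\<Sum>x\<in>P. \<Sum>y\<in>Q. c x * c y * K x y)"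
      unfolding sum_distrib_left
      by (intro sum.cong refl) (use cross' PQ in \<open>auto simp: mult.assoc subset_iff\<close>)
    finally have fg: "energy_inner ?J K f g = (\<Sum>x\<in>P. \<Sum>y\<in>Q. c x * c y * K x y)" .
    have qp: "(\<Sum>x\<in>Q. \<Sum>y\<in>P. c x * c y * K x y) = (\<Sum>x\<in>P. \<Sum>y\<in>Q. c x * c y * K x y)"
      by (subst sum.swap, intro sum.cong refl) (use Ksym PQ in \<open>auto simp: mult_ac subset_iff\<close>)
    have "quad K F c = quad K P c + 2 * energy_inner ?J K f g + quad K Q c"
      unfolding quad_def PQ(4) fg using qp
      by (simp add: sum.union_disjoint PQ(1,2,3) sum.distrib)
    also have "\<dots> \<ge> energy_inner ?J K f f + 2 * energy_inner ?J K f g + energy_inner ?J K g g"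
      using f g energy_inner_self[OF J] by simp
    moreover have "energy_inner ?J K f f + 2 * energy_inner ?J K f g + energy_inner ?J K g g
        = energy_inner ?J K (\<lambda>u. f u + g u) (\<lambda>u. f u + g u)"
      using f g energy_inner_sym[OF J f(1) g(1)] parallelogram_le(1)[OF J f(1) g(1)]
      by (simp add: add_left add_right)
    moreover have "\<dots> \<ge> 0" by (rule nonneg) (use f g parallelogram_le(1)[OF J] in auto)
    ultimately show ?thesis by linarith
  qed
  then show ?thesis unfolding covariance_on_iff_quad using Ksym by blast
qed

section \<open>Conditional uncorrelatedness as a property of the kernel\<close>

text \<open>For centred Gaussian variables with covariance \<open>K\<close>, the right-hand side is the covariance of the
  conditional expectations of \<open>X\<^sub>s\<close> and \<open>X\<^sub>t\<close> given \<open>X\<^sub>J\<close>, so the equation says that their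
  conditional covariance vanishes (\<open>conditional_covariance_zero_iff\<close>).\<close>

definition cond_uncorrelated :: "('a \<Rightarrow> 'a \<Rightarrow> real) \<Rightarrow> 'a set \<Rightarrow> 'a \<Rightarrow> 'a \<Rightarrow> bool" where
  "cond_uncorrelated K J s t \<longleftrightarrow> K s t = energy_inner J K (K s) (K t)"

lemma cond_uncorrelated_cong:
  assumes "\<And>x y. x \<in> A \<Longrightarrow> y \<in> A \<Longrightarrow> K x y = K' x y" "J \<subseteq> A" "s \<in> A" "t \<in> A"
  shows "cond_uncorrelated K J s t \<longleftrightarrow> cond_uncorrelated K' J s t"
proof -
  have "energy_inner J K (K s) (K t) = energy_inner J K' (K' s) (K' t)"
    by (rule energy_inner_cong) (use assms in auto)
  then show ?thesis unfolding cond_uncorrelated_def using assms by simp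
qed

lemma cond_uncorrelated_sym:
  assumes cov: "covariance_on S K" and "J \<subseteq> S" "s \<in> S" "t \<in> S"
  shows "cond_uncorrelated K J s t \<longleftrightarrow> cond_uncorrelated K J t s"
proof -
  have "energy_inner J K (K s) (K t) = energy_inner J K (K t) (K s)"
    by (rule energy_inner_sym[OF covariance_on_subset[OF cov assms(2)]
          finite_energy_kernel[OF cov assms(2,3)] finite_energy_kernel[OF cov assms(2,4)]])
  then show ?thesis unfolding cond_uncorrelated_def using covariance_on_sym[OF cov assms(3,4)] by simp
qed

text \<open>Projections onto closed spans are what completeness is needed for, so their existence is assumed
  instead.\<close>

locale hilbert_family = semi_inner H ip
  for H :: "('w \<Rightarrow> real) set" and ip :: "('w \<Rightarrow> real) \<Rightarrow> ('w \<Rightarrow> real) \<Rightarrow> real" +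
  fixes X :: "'i \<Rightarrow> 'w \<Rightarrow> real" and I :: "'i set"
  assumes X_in: "t \<in> I \<Longrightarrow> X t \<in> H"
    and projection: "f \<in> H \<Longrightarrow> J \<subseteq> I \<Longrightarrow>
      \<exists>p\<in>closed_span H ip X J. \<forall>x\<in>J. ip (\<lambda>u. f u - p u) (X x) = 0"
begin

definition gram :: "'i \<Rightarrow> 'i \<Rightarrow> real" where "gram s t = ip (X s) (X t)"

lemma orthogonal_closed_span':
  assumes "J \<subseteq> I" "V \<in> H" "\<And>x. x \<in> J \<Longrightarrow> ip V (X x) = 0" "p \<in> closed_span H ip X J"
  shows "ip V p = 0"
  by (rule orthogonal_closed_span[of J X V p]) (use assms X_in in auto)

text \<open>The inner product of \<open>X\<^sub>t\<close> with the residual of \<open>X\<^sub>s\<close> is the conditional covariance.\<close>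

lemma residual_inner_eq:
  assumes J: "J \<subseteq> I" and st: "s \<in> I" "t \<in> I"
    and p: "p \<in> closed_span H ip X J" "\<And>x. x \<in> J \<Longrightarrow> ip (\<lambda>u. X s u - p u) (X x) = 0"
  shows "ip (\<lambda>u. X s u - p u) (X t) = gram s t - energy_inner J gram (gram s) (gram t)"
proof -
  obtain q where q: "q \<in> closed_span H ip X J" "\<And>x. x \<in> J \<Longrightarrow> ip (\<lambda>u. X t u - q u) (X x) = 0"
    using projection[OF X_in[OF st(2)] J] by blast
  have XJ: "\<And>x. x \<in> J \<Longrightarrow> X x \<in> H" using J X_in by auto
  note H = closed_span_in[OF p(1)] closed_span_in[OF q(1)] X_in[OF st(1)] X_in[OF st(2)]
  have "energy_inner J gram (gram s) (gram t) = ip p q"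
    using energy_inner_eq_projection[OF H(3,4) XJ p q] unfolding gram_def[abs_def] .
  moreover have "ip (\<lambda>u. X t u - q u) p = 0"
    by (rule orthogonal_closed_span'[OF J diff_in[OF H(4,2)] q(2) p(1)])
  ultimately show ?thesis
    using H sym[OF H(1,4)] sym[OF H(1,2)] by (simp add: diff_left gram_def)
qed

lemma residual_orthogonal_iff:
  assumes "J \<subseteq> I" "s \<in> I" "t \<in> I"
    and "p \<in> closed_span H ip X J" "\<And>x. x \<in> J \<Longrightarrow> ip (\<lambda>u. X s u - p u) (X x) = 0"
  shows "ip (\<lambda>u. X s u - p u) (X t) = 0 \<longleftrightarrow> cond_uncorrelated gram J s t"
proof -
  have "ip (\<lambda>u. X s u - p u) (X t) = gram s t - energy_inner J gram (gram s) (gram t)"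
    by (rule residual_inner_eq) (use assms in auto)
  then show ?thesis unfolding cond_uncorrelated_def by simp
qed

lemma gram_sym: "s \<in> I \<Longrightarrow> t \<in> I \<Longrightarrow> gram s t = gram t s"
  unfolding gram_def by (rule sym) (use X_in in auto)

lemma covariance_on_gram: "covariance_on I gram"
  unfolding covariance_on_iff_quad
proof (intro conjI ballI allI impI)
  fix F :: "'i set" and c assume F: "finite F \<and> F \<subseteq> I"
  let ?h = "\<lambda>u. \<Sum>x\<in>F. c x * X x u"
  have XF: "\<And>x. x \<in> F \<Longrightarrow> X x \<in> H" using F X_in by auto
  have h: "?h \<in> H" by (rule sum_in) (use F XF in auto)
  have "ip ?h ?h = (\<Sum>x\<in>F. c x * ip (X x) ?h)" by (rule sum_left) (use F XF h in auto)
  also have "\<dots> = (\<Sum>x\<in>F. c x * (\<Sum>y\<in>F. c y * ip (X x) (X y)))"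
    by (intro sum.cong refl arg_cong2[of _ _ _ _ "(*)"] sum_right) (use F XF in auto)
  finally show "0 \<le> quad gram F c" using nonneg[OF h] by (simp add: quad_alt gram_def)
qed (rule gram_sym)

text \<open>If \<open>A\<close> and \<open>B\<close> are uncorrelated given \<open>C\<close>, they remain so given any larger \<open>J \<subseteq> A \<union> B\<close>.
  Let \<open>Y\<close> be the residual of \<open>X\<^sub>s\<close> after projection onto the closed span over \<open>J \<inter> A\<close> alone. Each
  \<open>X\<^sub>v\<close> with \<open>v \<in> B\<close> is the sum of its projection over \<open>C\<close>, to which \<open>Y\<close> is orthogonal since
  \<open>C \<subseteq> J \<inter> A\<close>, and a residual orthogonal to everything over \<open>A\<close>, in particular to \<open>Y\<close>. Hence \<open>Y\<close>
  is orthogonal to \<open>X\<^sub>v\<close>; it is thus the residual for all of \<open>J\<close> and orthogonal to \<open>X\<^sub>t\<close>.\<close>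

lemma cond_uncorrelated_enlarge:
  assumes sub: "A \<subseteq> I" "B \<subseteq> I" "C \<subseteq> A" "C \<subseteq> B" "C \<subseteq> J" "J \<subseteq> A \<union> B"
    and ci: "\<And>x y. x \<in> A \<Longrightarrow> y \<in> B \<Longrightarrow> cond_uncorrelated gram C x y"
    and st: "s \<in> A" "t \<in> B"
  shows "cond_uncorrelated gram J s t"
proof -
  have JA: "J \<inter> A \<subseteq> I" and CI: "C \<subseteq> I" and sI: "s \<in> I" and tI: "t \<in> I" using sub st by auto
  obtain p where p: "p \<in> closed_span H ip X (J \<inter> A)" "\<And>x. x \<in> J \<inter> A \<Longrightarrow> ip (\<lambda>u. X s u - p u) (X x) = 0"
    using projection[OF X_in[OF sI] JA] by blast
  have pH: "p \<in> H" using closed_span_in p(1) by auto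
  let ?Y = "\<lambda>u. X s u - p u"
  have Y: "?Y \<in> H" using diff_in X_in[OF sI] pH by auto
  have XA: "X x \<in> H" if "x \<in> A" for x using that sub X_in by auto
  have YA: "?Y \<in> closed_span H ip X A"
    by (rule closed_span_diff[OF XA closed_span_base[of s A X, OF st(1) XA[OF st(1)]]])
      (use p(1) closed_span_mono[of "J \<inter> A" A] in auto)
  have YB: "ip ?Y (X v) = 0" if v: "v \<in> B" for v
  proof -
    have vI: "v \<in> I" using v sub by auto
    obtain q where q: "q \<in> closed_span H ip X C" "\<And>x. x \<in> C \<Longrightarrow> ip (\<lambda>u. X v u - q u) (X x) = 0"
      using projection[OF X_in[OF vI] CI] by blast
    have qH: "q \<in> H" using closed_span_in q(1) by auto
    have "ip (\<lambda>u. X v u - q u) (X x) = 0" if x: "x \<in> A" for x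
    proof -
      have "x \<in> I" using x sub by auto
      then have "cond_uncorrelated gram C v x"
        using ci[OF x v] cond_uncorrelated_sym[OF covariance_on_gram CI vI] by blast
      then show ?thesis using residual_orthogonal_iff[OF CI vI \<open>x \<in> I\<close> q] by blast
    qed
    then have "ip (\<lambda>u. X v u - q u) ?Y = 0"
      by (intro orthogonal_closed_span'[OF sub(1) diff_in[OF X_in[OF vI] qH] _ YA])
    moreover have "ip ?Y q = 0"
      by (rule orthogonal_closed_span'[OF JA Y p(2)])
        (use q(1) closed_span_mono[of C "J \<inter> A"] sub in auto)
    ultimately show ?thesis
      using diff_left[OF X_in[OF vI] qH Y] sym[OF Y qH] sym[OF Y X_in[OF vI]] by simp
  qed
  have JI: "J \<subseteq> I" using sub by auto
  have pJ: "p \<in> closed_span H ip X J" using p(1) closed_span_mono[of "J \<inter> A" J] by auto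
  have orth: "ip ?Y (X x) = 0" if "x \<in> J" for x
    using that sub(6) p(2)[of x] YB[of x] by auto
  show ?thesis using residual_orthogonal_iff[OF JI sI tI pJ orth] YB[OF st(2)] by blast
qed

text \<open>The residual of \<open>X\<^sub>x\<close> given \<open>C\<close> lies in the closed span over \<open>U\<close>, so it sees only the projection of
  \<open>X\<^sub>y\<close> over \<open>D\<close>; and it is orthogonal to everything over \<open>D\<close>.\<close>

lemma cond_uncorrelated_chain:
  assumes sub: "U \<subseteq> I" "C \<subseteq> U" "D \<subseteq> I" and x: "x \<in> U" and y: "y \<in> I"
    and near: "\<And>z. z \<in> D \<Longrightarrow> cond_uncorrelated gram C x z"
    and far: "\<And>x'. x' \<in> U \<Longrightarrow> cond_uncorrelated gram D x' y"
  shows "cond_uncorrelated gram C x y"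
proof -
  have CI: "C \<subseteq> I" and xI: "x \<in> I" using sub x by auto
  obtain p where p: "p \<in> closed_span H ip X C" "\<And>z. z \<in> C \<Longrightarrow> ip (\<lambda>u. X x u - p u) (X z) = 0"
    using projection[OF X_in[OF xI] CI] by blast
  obtain q where q: "q \<in> closed_span H ip X D" "\<And>z. z \<in> D \<Longrightarrow> ip (\<lambda>u. X y u - q u) (X z) = 0"
    using projection[OF X_in[OF y] sub(3)] by blast
  have H: "p \<in> H" "q \<in> H" using closed_span_in p(1) q(1) by auto
  let ?Y = "\<lambda>u. X x u - p u"
  have Y: "?Y \<in> H" using diff_in X_in[OF xI] H by auto
  have XU: "X z \<in> H" if "z \<in> U" for z using that sub X_in by auto
  have YU: "?Y \<in> closed_span H ip X U"
    by (rule closed_span_diff[OF XU closed_span_base[of x U X, OF x XU[OF x]]])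
      (use p(1) closed_span_mono[OF sub(2)] in auto)
  have "ip (\<lambda>u. X y u - q u) (X z) = 0" if z: "z \<in> U" for z
  proof -
    have zI: "z \<in> I" using z sub by auto
    show ?thesis
      using far[OF z] cond_uncorrelated_sym[OF covariance_on_gram sub(3) zI y]
        residual_orthogonal_iff[OF sub(3) y zI q] by blast
  qed
  then have 1: "ip (\<lambda>u. X y u - q u) ?Y = 0"
    by (intro orthogonal_closed_span'[OF sub(1) diff_in[OF X_in[OF y] H(2)] _ YU])
  have "ip ?Y (X z) = 0" if "z \<in> D" for z
    using near[OF that] residual_orthogonal_iff[OF CI xI _ p, of z] that sub by blast
  then have 2: "ip ?Y q = 0" by (rule orthogonal_closed_span'[OF sub(3) Y _ q(1)])
  have "ip ?Y (X y) = 0"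
    using 1 2 diff_left[OF X_in[OF y] H(2) Y] sym[OF Y H(2)] sym[OF Y X_in[OF y]] by simp
  then show ?thesis using residual_orthogonal_iff[OF CI xI y p] by blast
qed

end

section \<open>Combinatorics of serrated covers\<close>

locale serrated =
  fixes I :: "real set" and m :: nat and Is :: "nat \<Rightarrow> real set"
  assumes cover: "serrated_cover I m Is"
begin

definition left_part :: "nat \<Rightarrow> real set" where "left_part p = (\<Union>j\<in>{1..p}. Is j)"
definition right_part :: "nat \<Rightarrow> real set" where "right_part p = (\<Union>j\<in>{p<..m}. Is j)"
definition overlap :: "nat \<Rightarrow> real set" where "overlap p = Is p \<inter> Is (Suc p)"

abbreviation "\<Omega> \<equiv> serrated_domain m Is"

lemma Is_subset: "1 \<le> j \<Longrightarrow> j \<le> m \<Longrightarrow> Is j \<subseteq> I"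
  using cover unfolding serrated_cover_def by auto

lemma left_part_subset: "p \<le> m \<Longrightarrow> left_part p \<subseteq> I"
  unfolding left_part_def using Is_subset by fastforce

lemma left_part_m: "left_part m = I"
  using cover unfolding serrated_cover_def left_part_def by auto

lemma right_part_subset: "right_part p \<subseteq> I"
  unfolding right_part_def using Is_subset by (intro UN_least) auto

lemma left_part_Suc: "left_part (Suc p) = left_part p \<union> Is (Suc p)"
  unfolding left_part_def by (auto simp: atLeastAtMostSuc_conv)

lemma Is_subset_left_part: "1 \<le> j \<Longrightarrow> j \<le> p \<Longrightarrow> Is j \<subseteq> left_part p"
  unfolding left_part_def by auto

lemma left_part_mono: "p \<le> q \<Longrightarrow> left_part p \<subseteq> left_part q"
  unfolding left_part_def by fastforce

text \<open>If \<open>x\<close> were missing from the middle interval, it would lie both to the left and to the right of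
  its points.\<close>

lemma in_between:
  assumes "1 \<le> a" "a \<le> b" "b \<le> c" "c \<le> m" "x \<in> Is a" "x \<in> Is c"
  shows "x \<in> Is b"
proof (rule ccontr)
  assume x: "x \<notin> Is b"
  then have lt: "a < b" "b < c" using assms by (metis le_neq_implies_less)+
  have mem: "a \<in> {1..m}" "b \<in> {1..m}" "c \<in> {1..m}" using assms by auto
  then obtain y where y: "y \<in> Is b" using cover unfolding serrated_cover_def by blast
  have ord: "\<And>p q. p \<in> {1..m} \<Longrightarrow> q \<in> {1..m} \<Longrightarrow> p < q \<Longrightarrow>
      (\<forall>x\<in>Is p - Is q. \<forall>y\<in>Is q. x < y) \<and> (\<forall>x\<in>Is q - Is p. \<forall>y\<in>Is p. y < x)"
    using cover unfolding serrated_cover_def by blast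
  have "x < y" using ord[OF mem(1,2) lt(1)] assms(5) x y by blast
  moreover have "y < x" using ord[OF mem(2,3) lt(2)] assms(6) x y by blast
  ultimately show False by simp
qed

text \<open>The left part meets the later intervals only in the overlap.\<close>

lemma left_right_overlap:
  assumes "1 \<le> p" "p < q" "q \<le> m" "x \<in> left_part p" "x \<in> Is q"
  shows "x \<in> overlap p"
proof -
  obtain a where a: "1 \<le> a" "a \<le> p" "x \<in> Is a" using assms(4) unfolding left_part_def by auto
  show ?thesis unfolding overlap_def
    using in_between[of a p q x] in_between[of a "Suc p" q x] a assms by auto
qed

lemma left_part_Int_Is: "1 \<le> p \<Longrightarrow> p < m \<Longrightarrow> left_part p \<inter> Is (Suc p) = overlap p"
  using left_right_overlap[of p "Suc p"] Is_subset_left_part[of p p] unfolding overlap_def by auto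

lemma stage_domain_alt: "stage_domain m Is p = left_part p \<times> left_part p \<union> (\<Union>j\<in>{p<..m}. Is j \<times> Is j)"
  unfolding stage_domain_def left_part_def ..

text \<open>Two points become comparable at stage \<open>p + 1\<close> exactly if one lies strictly left of the interval
  \<open>Is (p + 1)\<close> and the other is new in it: a point strictly left of it lies in no later interval.\<close>

lemma stage_domain_new:
  assumes "1 \<le> p" "p < m"
  shows "(s, t) \<in> stage_domain m Is (p + 1) - stage_domain m Is p \<longleftrightarrow>
    (s \<in> left_part p - Is (Suc p) \<and> t \<in> Is (Suc p) - left_part p) \<or>
    (t \<in> left_part p - Is (Suc p) \<and> s \<in> Is (Suc p) - left_part p)" (is "?L \<longleftrightarrow> ?R")
proof
  assume L: ?L
  have "\<not> (s \<in> Is (Suc p) \<and> t \<in> Is (Suc p))" using L assms unfolding stage_domain_alt by force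
  moreover have "\<not> (s \<in> left_part p \<and> t \<in> left_part p)" using L unfolding stage_domain_alt by blast
  moreover have "s \<in> left_part (Suc p) \<and> t \<in> left_part (Suc p)" using L unfolding stage_domain_alt by auto
  ultimately show ?R unfolding left_part_Suc by blast
next
  have aux: "(s, t) \<notin> stage_domain m Is p \<and> (t, s) \<notin> stage_domain m Is p"
    if "s \<in> left_part p - Is (Suc p)" "t \<in> Is (Suc p) - left_part p" for s t
  proof -
    have "s \<notin> Is q" if "p < q" "q \<le> m" for q
      using left_right_overlap[OF assms(1) that, of s] \<open>s \<in> left_part p - Is (Suc p)\<close> unfolding overlap_def by blast
    then show ?thesis using that unfolding stage_domain_alt by auto
  qed
  assume R: ?R
  then have "s \<in> left_part (Suc p)" "t \<in> left_part (Suc p)" unfolding left_part_Suc by auto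
  then have "(s, t) \<in> stage_domain m Is (p + 1)" unfolding stage_domain_alt by simp
  then show ?L using R aux by blast
qed

lemma serrated_domain_subset_stage: "\<Omega> \<subseteq> stage_domain m Is p"
proof
  fix x assume "x \<in> \<Omega>"
  then obtain j where j: "1 \<le> j" "j \<le> m" "x \<in> Is j \<times> Is j" unfolding serrated_domain_def by auto
  show "x \<in> stage_domain m Is p"
  proof (cases "j \<le> p")
    case True then show ?thesis using j Is_subset_left_part[of j p] unfolding stage_domain_alt by blast
  next
    case False then show ?thesis using j unfolding stage_domain_alt by auto
  qed
qed

lemma serrated_domain_sym: "(s, t) \<in> \<Omega> \<Longrightarrow> (t, s) \<in> \<Omega>"
  unfolding serrated_domain_def by auto

text \<open>Consider the first step at which a path leaves the left part. It takes place inside an interval with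
  index greater than \<open>p\<close>, so its starting point lies in the overlap.\<close>

lemma overlap_separates:
  assumes p: "1 \<le> p" "p < m" and s: "s \<in> left_part p - Is (Suc p)" and t: "t \<notin> left_part p"
  shows "separates I \<Omega> (overlap p) s t"
  unfolding separates_def
proof (intro allI impI)
  fix r :: nat and \<tau> :: "nat \<Rightarrow> real"
  assume path: "1 \<le> r \<and> (\<forall>i\<in>{1..r}. \<tau> i \<in> I) \<and> \<tau> 1 = s \<and> \<tau> r = t \<and>
    (\<forall>i. 1 \<le> i \<and> i < r \<longrightarrow> (\<tau> i, \<tau> (i + 1)) \<in> \<Omega>)"
  define k where "k = (LEAST i. 1 \<le> i \<and> \<tau> i \<notin> left_part p)"
  have kr: "1 \<le> r \<and> \<tau> r \<notin> left_part p" using path t by simp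
  have k: "1 \<le> k" "\<tau> k \<notin> left_part p" "k \<le> r"
    using LeastI[of "\<lambda>i. 1 \<le> i \<and> \<tau> i \<notin> left_part p", OF kr]
      Least_le[of "\<lambda>i. 1 \<le> i \<and> \<tau> i \<notin> left_part p", OF kr] unfolding k_def by auto
  have "k \<noteq> 1" using k(2) path s by auto
  define j where "j = k - 1"
  have j: "1 \<le> j" "j < k" "k = j + 1" using k(1) \<open>k \<noteq> 1\<close> unfolding j_def by auto
  have jl: "\<tau> j \<in> left_part p"
    using not_less_Least[of j "\<lambda>i. 1 \<le> i \<and> \<tau> i \<notin> left_part p"] j unfolding k_def by blast
  have "(\<tau> j, \<tau> k) \<in> \<Omega>" using path j k(3) by auto
  then obtain q where q: "1 \<le> q" "q \<le> m" "\<tau> j \<in> Is q" "\<tau> k \<in> Is q" unfolding serrated_domain_def by auto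
  have "p < q" using q k(2) Is_subset_left_part[of q p] by (meson not_less subsetD)
  then have ov: "\<tau> j \<in> overlap p" using left_right_overlap[OF p(1) _ q(2) jl q(3)] by blast
  have "j \<noteq> 1" using ov path s unfolding overlap_def by auto
  then show "\<exists>j. 1 < j \<and> j < r \<and> \<tau> j \<in> overlap p" using j k(3) ov by (intro exI[of _ j]) auto
qed

text \<open>Paths can be reversed.\<close>

lemma separates_sym:
  assumes "separates I \<Omega> J s t" shows "separates I \<Omega> J t s"
  unfolding separates_def
proof (intro allI impI)
  fix r :: nat and \<tau> :: "nat \<Rightarrow> real"
  assume path: "1 \<le> r \<and> (\<forall>i\<in>{1..r}. \<tau> i \<in> I) \<and> \<tau> 1 = t \<and> \<tau> r = s \<and>
    (\<forall>i. 1 \<le> i \<and> i < r \<longrightarrow> (\<tau> i, \<tau> (i + 1)) \<in> \<Omega>)"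
  define \<rho> where "\<rho> i = \<tau> (r + 1 - i)" for i
  have "(\<rho> i, \<rho> (i + 1)) \<in> \<Omega>" if i: "1 \<le> i" "i < r" for i
  proof -
    have "(\<tau> (r - i), \<tau> (r - i + 1)) \<in> \<Omega>" using path i by auto
    moreover have "r + 1 - i = r - i + 1" "r + 1 - (i + 1) = r - i" using i by auto
    ultimately show ?thesis unfolding \<rho>_def using serrated_domain_sym by simp
  qed
  moreover have "\<forall>i\<in>{1..r}. \<rho> i \<in> I"
  proof
    fix i assume "i \<in> {1..r}"
    then have "r + 1 - i \<in> {1..r}" by auto
    then show "\<rho> i \<in> I" using path unfolding \<rho>_def by blast
  qed
  moreover have "\<rho> 1 = s" "\<rho> r = t" using path unfolding \<rho>_def by auto
  ultimately have "\<exists>j. 1 < j \<and> j < r \<and> \<rho> j \<in> J" using assms path unfolding separates_def by blast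
  then obtain j where j: "1 < j" "j < r" "\<rho> j \<in> J" by blast
  show "\<exists>j. 1 < j \<and> j < r \<and> \<tau> j \<in> J"
    by (rule exI[of _ "r + 1 - j"]) (use j in \<open>auto simp: \<rho>_def\<close>)
qed

text \<open>Otherwise choose a point outside \<open>J\<close> in each overlap between the intervals of \<open>s\<close> and \<open>t\<close>.
  Consecutive points share an interval, so they form a path from \<open>s\<close> to \<open>t\<close> whose interior
  avoids \<open>J\<close>.\<close>

lemma separator_contains_overlap:
  assumes sep: "separates I \<Omega> J s t" and ab: "1 \<le> a" "a \<le> b" "b \<le> m" and s: "s \<in> Is a" and t: "t \<in> Is b"
  shows "\<exists>p. a \<le> p \<and> p < b \<and> overlap p \<subseteq> J"
proof (rule ccontr)
  assume neg: "\<not> ?thesis"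
  have "\<exists>x. x \<in> overlap p - J" if "a \<le> p" "p < b" for p using that neg by blast
  then obtain x where x: "\<And>p. a \<le> p \<Longrightarrow> p < b \<Longrightarrow> x p \<in> overlap p - J" by metis
  have inI: "Is j \<subseteq> I" if "a \<le> j" "j \<le> b" for j using Is_subset that ab by auto
  \<comment> \<open>the path runs through \<open>s\<close>, the \<open>b - a\<close> points \<open>x a, \<dots>, x (b - 1)\<close>, and \<open>t\<close>\<close>
  define r where "r = b - a + 2"
  define \<tau> where "\<tau> i = (if i \<le> 1 then s else if i < r then x (a + i - 2) else t)" for i
  have edge: "\<tau> i \<in> Is (a + i - 1) \<and> \<tau> (i + 1) \<in> Is (a + i - 1)" if i: "1 \<le> i" "i < r" for i
  proof
    show "\<tau> i \<in> Is (a + i - 1)"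
    proof (cases "i = 1")
      case True then show ?thesis using s unfolding \<tau>_def by simp
    next
      case False
      then have "x (a + i - 2) \<in> overlap (a + i - 2)" using x[of "a + i - 2"] i ab unfolding r_def by auto
      moreover have "Suc (a + i - 2) = a + i - 1" using False i by auto
      ultimately show ?thesis using False i unfolding \<tau>_def overlap_def by auto
    qed
    show "\<tau> (i + 1) \<in> Is (a + i - 1)"
    proof (cases "i + 1 < r")
      case True
      then have "x (a + i - 1) \<in> overlap (a + i - 1)" using x[of "a + i - 1"] i ab unfolding r_def by auto
      then show ?thesis using True i unfolding \<tau>_def overlap_def by auto
    next
      case False
      then have "a + i - 1 = b" using i ab unfolding r_def by auto
      then show ?thesis using False i t unfolding \<tau>_def by auto
    qed
  qed
  have idx: "1 \<le> a + i - 1 \<and> a + i - 1 \<le> b" if "1 \<le> i" "i < r" for i using that ab unfolding r_def by auto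
  have e: "(\<tau> i, \<tau> (i + 1)) \<in> \<Omega>" if "1 \<le> i" "i < r" for i
    using edge[OF that] idx[OF that] ab unfolding serrated_domain_def by auto
  have r2: "2 \<le> r" unfolding r_def by simp
  have I: "\<tau> i \<in> I" if i: "i \<in> {1..r}" for i
  proof (cases "i < r")
    case True
    then have "Is (a + i - 1) \<subseteq> I" using idx[of i] i by (intro inI) auto
    then show ?thesis using edge[of i] True i by auto
  next
    case False
    then show ?thesis using i inI[of b] t ab r2 unfolding \<tau>_def by auto
  qed
  have "\<tau> 1 = s" "\<tau> r = t" using r2 unfolding \<tau>_def by auto
  then obtain j where j: "1 < j" "j < r" "\<tau> j \<in> J"
    using sep[unfolded separates_def, rule_format, of r \<tau>] e I r2 by auto
  then have "x (a + j - 2) \<in> overlap (a + j - 2) - J" using x[of "a + j - 2"] ab unfolding r_def by auto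
  then show False using j unfolding \<tau>_def by auto
qed

end

section \<open>The canonical completion\<close>

locale serrated_covariance = serrated I m Is for I :: "real set" and m :: nat and Is :: "nat \<Rightarrow> real set" +
  fixes K\<^sub>\<Omega> :: "real \<Rightarrow> real \<Rightarrow> real"
  assumes partial: "partial_covariance I \<Omega> K\<^sub>\<Omega>"
begin

abbreviation "stage \<equiv> canonical_stage m Is K\<^sub>\<Omega>"

lemma covariance_on_Is: "1 \<le> j \<Longrightarrow> j \<le> m \<Longrightarrow> covariance_on (Is j) K\<^sub>\<Omega>"
proof -
  assume j: "1 \<le> j" "j \<le> m"
  have "Is j \<times> Is j \<subseteq> \<Omega>" using j unfolding serrated_domain_def by (intro UN_upper) simp
  then show ?thesis using partial Is_subset[OF j] unfolding partial_covariance_def by simp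
qed

lemma Is_in_domain: "1 \<le> j \<Longrightarrow> j \<le> m \<Longrightarrow> s \<in> Is j \<Longrightarrow> t \<in> Is j \<Longrightarrow> (s, t) \<in> \<Omega>"
  unfolding serrated_domain_def by auto

lemma stage_old: "(s, t) \<in> stage_domain m Is (Suc n) \<Longrightarrow> stage (Suc n) s t = stage n s t"
  by (simp add: Let_def)

lemma stage_new:
  assumes "Suc n < m"
    and "(s \<in> left_part (Suc n) - Is (Suc (Suc n)) \<and> t \<in> Is (Suc (Suc n)) - left_part (Suc n)) \<or>
      (t \<in> left_part (Suc n) - Is (Suc (Suc n)) \<and> s \<in> Is (Suc (Suc n)) - left_part (Suc n))"
  shows "stage (Suc n) s t = rkhs_inner (overlap (Suc n)) K\<^sub>\<Omega> (stage n s) (\<lambda>u. stage n u t)"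
proof -
  have "(s, t) \<in> stage_domain m Is (Suc n + 1) - stage_domain m Is (Suc n)"
    using stage_domain_new[of "Suc n" s t] assms by simp
  then show ?thesis by (simp add: Let_def overlap_def)
qed

lemma stage_on_domain: "(s, t) \<in> \<Omega> \<Longrightarrow> stage n s t = K\<^sub>\<Omega> s t"
proof (induction n)
  case 0 then show ?case by simp
next
  case (Suc n) then show ?case using stage_old[of s t n] serrated_domain_subset_stage by auto
qed

text \<open>The induction along the construction. Besides positivity it records the gluing identity for all
  earlier overlaps, which persists because later stages leave the values on the left part unchanged.\<close>

lemma stage_properties:
  assumes "n < m"
  shows "covariance_on (left_part (Suc n)) (stage n) \<and>
    (\<forall>k s t. 1 \<le> k \<and> k \<le> n \<and> s \<in> left_part k \<and> t \<in> Is (Suc k) \<longrightarrow>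
      cond_uncorrelated (stage n) (overlap k) s t)"
  using assms
proof (induction n)
  case 0
  have "left_part (Suc 0) = Is 1" unfolding left_part_def by simp
  then show ?case using covariance_on_Is[of 1] 0 by auto
next
  case (Suc n)
  define p where "p = Suc n"
  have p: "1 \<le> p" "p < m" using Suc.prems unfolding p_def by auto
  define A B where "A = left_part p" and "B = Is (Suc p)"
  have AB: "A \<inter> B = overlap p" using left_part_Int_Is[OF p] unfolding A_def B_def .
  define K where "K = stage n"
  define K' where "K' = stage p"
  have covK: "covariance_on A K" using Suc unfolding A_def p_def K_def by simp
  have KA: "K' s t = K s t" if "s \<in> A" "t \<in> A" for s t
    using stage_old[of s t n] that unfolding K'_def K_def p_def[symmetric] stage_domain_alt A_def by blast
  have KB: "K' s t = K\<^sub>\<Omega> s t" "K s t = K\<^sub>\<Omega> s t" if "s \<in> B" "t \<in> B" for s t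
    using stage_on_domain[OF Is_in_domain[of "Suc p" s t]] that p unfolding B_def K'_def K_def by auto
  have A: "covariance_on A K'" using covK covariance_on_cong[of A K K'] KA by simp
  have B\<Omega>: "covariance_on B K\<^sub>\<Omega>" using covariance_on_Is p unfolding B_def by simp
  then have B: "covariance_on B K'" using covariance_on_cong[of B K\<^sub>\<Omega> K'] KB by simp
  have J\<Omega>: "covariance_on (A \<inter> B) K\<^sub>\<Omega>" by (rule covariance_on_subset[OF B\<Omega>]) auto
  have J: "covariance_on (A \<inter> B) K'" by (rule covariance_on_subset[OF B]) auto
  have feA: "finite_energy (A \<inter> B) K' (K' s)" if "s \<in> A" for s by (rule finite_energy_kernel[OF A _ that]) auto
  have feB: "finite_energy (A \<inter> B) K' (K' s)" if "s \<in> B" for s by (rule finite_energy_kernel[OF B _ that]) auto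
  have inner: "rkhs_inner (A \<inter> B) K\<^sub>\<Omega> f g = energy_inner (A \<inter> B) K' (K' s) (K' t)"
    if f: "\<And>u. u \<in> A \<inter> B \<Longrightarrow> f u = K' s u" and g: "\<And>u. u \<in> A \<inter> B \<Longrightarrow> g u = K' t u"
      and fe: "finite_energy (A \<inter> B) K' (K' s)" "finite_energy (A \<inter> B) K' (K' t)" for f g s t
  proof -
    have "finite_energy (A \<inter> B) K\<^sub>\<Omega> f = finite_energy (A \<inter> B) K' (K' s)"
      by (rule finite_energy_cong) (use f KB in auto)
    moreover have "finite_energy (A \<inter> B) K\<^sub>\<Omega> g = finite_energy (A \<inter> B) K' (K' t)"
      by (rule finite_energy_cong) (use g KB in auto)
    ultimately have "rkhs_inner (A \<inter> B) K\<^sub>\<Omega> f g = energy_inner (A \<inter> B) K\<^sub>\<Omega> f g"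
      using rkhs_inner_eq_energy_inner[OF J\<Omega>] fe by simp
    also have "\<dots> = energy_inner (A \<inter> B) K' (K' s) (K' t)"
      by (rule energy_inner_cong) (use f g KB in auto)
    finally show ?thesis .
  qed
  \<comment> \<open>Both orders of the arguments are covered by the defining formula; its symmetry is that of the inner product.\<close>
  have cross1: "K' s t = energy_inner (A \<inter> B) K' (K' s) (K' t)" if s: "s \<in> A - B" and t: "t \<in> B - A" for s t
  proof -
    have "K' s t = rkhs_inner (A \<inter> B) K\<^sub>\<Omega> (K s) (\<lambda>u. K u t)"
      using stage_new[of n s t] p s t unfolding AB unfolding K_def K'_def A_def B_def p_def[symmetric]
      by simp
    also have "\<dots> = energy_inner (A \<inter> B) K' (K' s) (K' t)"
    proof (rule inner)
      show "K s u = K' s u" if "u \<in> A \<inter> B" for u using KA s that by simp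
      show "K u t = K' t u" if "u \<in> A \<inter> B" for u
        using KB[of t u] KB[of u t] covariance_on_sym[OF B\<Omega>, of u t] t that by simp
    qed (use feA feB s t in auto)
    finally show ?thesis .
  qed
  have cross2: "K' t s = energy_inner (A \<inter> B) K' (K' t) (K' s)" if s: "s \<in> A - B" and t: "t \<in> B - A" for s t
  proof -
    have "K' t s = rkhs_inner (A \<inter> B) K\<^sub>\<Omega> (K t) (\<lambda>u. K u s)"
      using stage_new[of n t s] p s t unfolding AB unfolding K_def K'_def A_def B_def p_def[symmetric]
      by simp
    also have "\<dots> = energy_inner (A \<inter> B) K' (K' t) (K' s)"
    proof (rule inner)
      show "K t u = K' t u" if "u \<in> A \<inter> B" for u using KB[of t u] t that by simp
      show "K u s = K' s u" if "u \<in> A \<inter> B" for u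
        using KA[of s u] covariance_on_sym[OF covK, of u s] s that by simp
    qed (use feA feB s t in auto)
    finally show ?thesis .
  qed
  have sym: "K' s t = K' t s" if s: "s \<in> A" and t: "t \<in> B" for s t
  proof (cases "s \<in> B \<or> t \<in> A")
    case True then show ?thesis using covariance_on_sym[OF A] covariance_on_sym[OF B] s t by blast
  next
    case False
    then show ?thesis using cross1[of s t] cross2[of s t] s t energy_inner_sym[OF J feA[OF s] feB[OF t]] by simp
  qed
  have cov: "covariance_on (A \<union> B) K'"
    by (rule covariance_glue[OF A B sym cross1])
  have cu: "cond_uncorrelated K' (A \<inter> B) s t" if s: "s \<in> A" and t: "t \<in> B" for s t
  proof (cases "s \<in> B")
    case True
    have "energy_inner (A \<inter> B) K' (K' s) (K' t) = energy_inner (A \<inter> B) K' (K' t) (K' s)"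
      by (rule energy_inner_sym[OF J feA[OF s] feB[OF t]])
    also have "\<dots> = K' t s" by (rule energy_inner_reproducing[OF J feB[OF t]]) (use s True in auto)
    finally show ?thesis unfolding cond_uncorrelated_def using sym s t by simp
  next
    case False
    show ?thesis
    proof (cases "t \<in> A")
      case True
      then show ?thesis unfolding cond_uncorrelated_def
        using energy_inner_reproducing[OF J feA[OF s], of t] t by simp
    next
      case False
      then show ?thesis unfolding cond_uncorrelated_def using cross1 s t \<open>s \<notin> B\<close> by blast
    qed
  qed
  have "cond_uncorrelated K' (overlap k) s t"
    if k: "1 \<le> k" "k \<le> p" "s \<in> left_part k" "t \<in> Is (Suc k)" for k s t
  proof (cases "k = p")
    case True then show ?thesis using cu[of s t] k AB unfolding A_def B_def by simp
  next
    case False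
    then have kn: "k \<le> n" "Suc k \<le> p" using k unfolding p_def by auto
    have "cond_uncorrelated K (overlap k) s t" using Suc kn k unfolding K_def by simp
    moreover have "cond_uncorrelated K' (overlap k) s t = cond_uncorrelated K (overlap k) s t"
    proof (rule cond_uncorrelated_cong[OF KA])
      show "overlap k \<subseteq> A" "s \<in> A" "t \<in> A"
        using left_part_mono[of k p] Is_subset_left_part[of k p] Is_subset_left_part[of "Suc k" p] k kn
        unfolding A_def overlap_def by auto
    qed
    ultimately show ?thesis by simp
  qed
  then show ?case using cov left_part_Suc[of p] unfolding A_def B_def K'_def p_def by auto
qed

abbreviation "Kstar \<equiv> canonical_completion m Is K\<^sub>\<Omega>"

lemma covariance_on_Kstar: "covariance_on I Kstar"
proof (cases "m = 0")
  case True
  then have "I = {}" using left_part_m unfolding left_part_def by simp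
  then show ?thesis unfolding covariance_on_def by force
next
  case False
  then show ?thesis using stage_properties[of "m - 1"] left_part_m unfolding canonical_completion_def by simp
qed

lemma is_completion_Kstar: "is_completion I \<Omega> K\<^sub>\<Omega> Kstar"
  unfolding is_completion_def using covariance_on_Kstar stage_on_domain unfolding canonical_completion_def by auto

lemma Kstar_cond_uncorrelated:
  assumes "1 \<le> p" "p < m" "s \<in> left_part p" "t \<in> Is (Suc p)"
  shows "cond_uncorrelated Kstar (overlap p) s t"
  using stage_properties[of "m - 1"] assms unfolding canonical_completion_def by auto

text \<open>The values of a kernel on the next interval against the left part are inner products of sections
  over the overlap, and these sections agree by induction.\<close>

lemma completion_unique:
  assumes K: "is_completion I \<Omega> K\<^sub>\<Omega> K" and K': "is_completion I \<Omega> K\<^sub>\<Omega> K'"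
    and cu: "\<And>p s t. 1 \<le> p \<Longrightarrow> p < m \<Longrightarrow> s \<in> left_part p - Is (Suc p) \<Longrightarrow> t \<in> Is (Suc p) - left_part p \<Longrightarrow>
      cond_uncorrelated K (overlap p) s t \<and> cond_uncorrelated K' (overlap p) s t"
    and st: "s \<in> I" "t \<in> I"
  shows "K s t = K' s t"
proof -
  have cov: "covariance_on I K" "covariance_on I K'" using K K' unfolding is_completion_def by auto
  have on: "K s t = K' s t" if "(s, t) \<in> \<Omega>" for s t using K K' that unfolding is_completion_def by fastforce
  have "p \<le> m \<longrightarrow> (\<forall>s\<in>left_part p. \<forall>t\<in>left_part p. K s t = K' s t)" for p
  proof (induction p)
    case 0 then show ?case unfolding left_part_def by simp
  next
    case (Suc p)
    show ?case
    proof
      assume pm: "Suc p \<le> m"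
      have inI: "left_part p \<subseteq> I" "Is (Suc p) \<subseteq> I" using left_part_subset Is_subset pm by auto
      have IH: "K s t = K' s t" if "s \<in> left_part p" "t \<in> left_part p" for s t using Suc pm that by simp
      have new: "K s t = K' s t" if "s \<in> Is (Suc p)" "t \<in> Is (Suc p)" for s t
        by (rule on[OF Is_in_domain[of "Suc p"]]) (use that pm in auto)
      have cross: "K s t = K' s t" if s: "s \<in> left_part p" and t: "t \<in> Is (Suc p)" for s t
      proof (cases "s \<in> Is (Suc p) \<or> t \<in> left_part p")
        case True then show ?thesis using IH new s t by blast
      next
        case False
        have "p \<noteq> 0" using s unfolding left_part_def by (cases p) auto
        then have p: "1 \<le> p" "p < m" using pm by auto
        have ov: "overlap p \<subseteq> left_part p" "overlap p \<subseteq> Is (Suc p)"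
          using left_part_Int_Is[OF p] by auto
        have "K s t = energy_inner (overlap p) K (K s) (K t)"
          using cu[OF p, of s t] s t False unfolding cond_uncorrelated_def by blast
        also have "\<dots> = energy_inner (overlap p) K' (K' s) (K' t)"
        proof (rule energy_inner_cong)
          show "K x y = K' x y" if "x \<in> overlap p" "y \<in> overlap p" for x y
            using new[of x y] ov that by blast
        qed (use IH[of s] new[of t] ov s t in auto)
        also have "\<dots> = K' s t" using cu[OF p, of s t] s t False unfolding cond_uncorrelated_def by simp
        finally show ?thesis .
      qed
      have cross': "K s t = K' s t" if "t \<in> left_part p" "s \<in> Is (Suc p)" for s t
      proof -
        have "s \<in> I" "t \<in> I" using that inI by auto
        then show ?thesis
          using cross[OF that] covariance_on_sym[OF cov(1), of s t] covariance_on_sym[OF cov(2), of s t] by simp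
      qed
      show "\<forall>s\<in>left_part (Suc p). \<forall>t\<in>left_part (Suc p). K s t = K' s t"
        unfolding left_part_Suc using IH new cross cross' by blast
    qed
  qed
  from this[of m] show ?thesis using left_part_m st by simp
qed

end

section \<open>The global Markov property of a chain of overlapping sets\<close>

locale markov_family = serrated I m Is + hilbert_family H ip X I
  for I :: "real set" and m Is and H :: "('w \<Rightarrow> real) set" and ip X +
  assumes steps: "1 \<le> p \<Longrightarrow> p < m \<Longrightarrow> s \<in> left_part p \<Longrightarrow> t \<in> Is (Suc p) \<Longrightarrow>
    cond_uncorrelated gram (overlap p) s t"
begin

text \<open>By induction over the intervals to the right: the next interval is attached to everything before it
  through its overlap with the preceding interval, for which the claim is already known.\<close>

lemma cond_uncorrelated_left_right:
  assumes p: "1 \<le> p" "p < q" "q \<le> m" and s: "s \<in> left_part p" and t: "t \<in> Is q"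
  shows "cond_uncorrelated gram (overlap p) s t"
  using p(2,3) t
proof (induction q arbitrary: t)
  case 0 then show ?case by simp
next
  case (Suc q)
  show ?case
  proof (cases "p = q")
    case True then show ?thesis using steps[of p s t] Suc p s by auto
  next
    case False
    then have q: "1 \<le> q" "p < q" "q < m" using Suc p by auto
    show ?thesis
    proof (rule cond_uncorrelated_chain[of "left_part q" "overlap p" "overlap q"])
      show "left_part q \<subseteq> I" using left_part_subset q by auto
      show "overlap p \<subseteq> left_part q" using Is_subset_left_part[of p q] p q unfolding overlap_def by auto
      show "overlap q \<subseteq> I" using Is_subset[of q] q unfolding overlap_def by auto
      show "s \<in> left_part q" using s left_part_mono[of p q] q by auto
      show "t \<in> I" using Is_subset[of "Suc q"] Suc.prems by auto
      show "cond_uncorrelated gram (overlap p) s z" if "z \<in> overlap q" for z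
        using Suc.IH[of z] q that unfolding overlap_def by auto
      show "cond_uncorrelated gram (overlap q) x' t" if "x' \<in> left_part q" for x'
        using steps[OF q(1,3) that Suc.prems(3)] .
    qed
  qed
qed

text \<open>A separating set contains an overlap, by which the two parts are uncorrelated; then
  \<open>cond_uncorrelated_enlarge\<close> applies.\<close>

lemma cond_uncorrelated_of_separates:
  assumes J: "J \<subseteq> I" and sep: "separates I \<Omega> J s t" and st: "s \<in> I" "t \<in> I"
  shows "cond_uncorrelated gram J s t"
proof -
  have main: "cond_uncorrelated gram J s t"
    if sep: "separates I \<Omega> J s t" and ab: "1 \<le> a" "a \<le> b" "b \<le> m" and s: "s \<in> Is a" and t: "t \<in> Is b" for s t a b
  proof -
    obtain p where p: "a \<le> p" "p < b" "overlap p \<subseteq> J"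
      using separator_contains_overlap[OF sep ab s t] by blast
    have p1: "1 \<le> p" "p < m" using p ab by auto
    show ?thesis
    proof (rule cond_uncorrelated_enlarge[of "left_part p" "right_part p" "overlap p"])
      show "left_part p \<subseteq> I" using left_part_subset p1 by auto
      show "right_part p \<subseteq> I" by (rule right_part_subset)
      show "overlap p \<subseteq> left_part p" using Is_subset_left_part[of p p] p1 unfolding overlap_def by auto
      have "Suc p \<in> {p<..m}" using p1 by simp
      then show "overlap p \<subseteq> right_part p" unfolding overlap_def right_part_def by blast
      show "J \<subseteq> left_part p \<union> right_part p"
      proof
        fix x assume "x \<in> J"
        then have "x \<in> left_part m" using J left_part_m by auto
        then obtain j where j: "1 \<le> j" "j \<le> m" "x \<in> Is j" unfolding left_part_def by auto
        show "x \<in> left_part p \<union> right_part p"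
        proof (cases "j \<le> p")
          case True then show ?thesis using j Is_subset_left_part[of j p] by blast
        next
          case False
          then have "j \<in> {p<..m}" using j by simp
          then show ?thesis using j unfolding right_part_def by blast
        qed
      qed
      show "cond_uncorrelated gram (overlap p) x y" if "x \<in> left_part p" "y \<in> right_part p" for x y
        using cond_uncorrelated_left_right[OF p1(1) _ _ that(1)] that(2) unfolding right_part_def by auto
      show "s \<in> left_part p" using Is_subset_left_part[of a p] ab p s by auto
      show "t \<in> right_part p" using p ab t unfolding right_part_def by auto
    qed fact
  qed
  obtain a b where a: "1 \<le> a" "a \<le> m" "s \<in> Is a" and b: "1 \<le> b" "b \<le> m" "t \<in> Is b"
    using st left_part_m unfolding left_part_def by (metis (no_types, lifting) UN_E atLeastAtMost_iff)
  show ?thesis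
  proof (cases "a \<le> b")
    case True show ?thesis by (rule main[OF sep a(1) True b(2) a(3) b(3)])
  next
    case False
    then have "b \<le> a" by simp
    then have "cond_uncorrelated gram J t s" by (rule main[OF separates_sym[OF sep] b(1) _ a(2) b(3) a(3)])
    then show ?thesis using cond_uncorrelated_sym[OF covariance_on_gram J st] by blast
  qed
qed

end

section \<open>Random variables annihilated by trigonometric functions\<close>

text \<open>After normalisation, the positive and negative parts of \<open>W\<close> are densities for which \<open>Z\<close> has the
  same characteristic function, hence the same distribution by Levy's uniqueness theorem.\<close>

lemma (in prob_space) integral_indicator_eq_0_if_fourier_eq_0_real:
  fixes W Z :: "'a \<Rightarrow> real"
  assumes W: "integrable M W" and Z [measurable]: "Z \<in> borel_measurable M"
    and fourier: "\<And>c. (\<integral>\<omega>. complex_of_real (W \<omega>) * iexp (c * Z \<omega>) \<partial>M) = 0"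
    and A: "A \<in> sets borel"
  shows "(\<integral>\<omega>. W \<omega> * indicator A (Z \<omega>) \<partial>M) = 0"
proof -
  have [measurable]: "W \<in> borel_measurable M" using W by auto
  define Wp Wn where "Wp \<omega> = max 0 (W \<omega>)" and "Wn \<omega> = max 0 (- W \<omega>)" for \<omega>
  have Wpn: "W \<omega> = Wp \<omega> - Wn \<omega>" for \<omega> unfolding Wp_def Wn_def by auto
  have int: "integrable M Wp" "integrable M Wn" unfolding Wp_def[abs_def] Wn_def[abs_def] using W by auto
  have [measurable]: "Wp \<in> borel_measurable M" "Wn \<in> borel_measurable M" using int by auto
  have nn: "0 \<le> Wp \<omega>" "0 \<le> Wn \<omega>" for \<omega> unfolding Wp_def Wn_def by auto
  have "(\<integral>\<omega>. W \<omega> \<partial>M) = 0"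
    using fourier[of 0] unfolding of_real_eq_0_iff[where 'a = complex, symmetric] by simp
  then have eq: "(\<integral>\<omega>. Wp \<omega> \<partial>M) = (\<integral>\<omega>. Wn \<omega> \<partial>M)" unfolding Wpn using int by simp
  define w where "w = (\<integral>\<omega>. Wp \<omega> \<partial>M)"
  have w0: "0 \<le> w" unfolding w_def by (rule integral_nonneg_AE) (use nn in auto)
  show ?thesis
  proof (cases "w = 0")
    case True
    have "AE \<omega> in M. Wp \<omega> = 0" "AE \<omega> in M. Wn \<omega> = 0"
      using integral_nonneg_eq_0_iff_AE[OF int(1)] integral_nonneg_eq_0_iff_AE[OF int(2)] nn True eq
      unfolding w_def by auto
    then have "AE \<omega> in M. W \<omega> * indicator A (Z \<omega>) = 0" unfolding Wpn by auto
    then show ?thesis by (rule integral_eq_zero_AE)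
  next
    case False
    then have w: "0 < w" using w0 by simp
    define \<mu> where "\<mu> V = distr (density M (\<lambda>\<omega>. ennreal (V \<omega> / w))) borel Z" for V
    have props: "real_distribution (\<mu> V)"
      "\<And>c. char (\<mu> V) c = (\<integral>\<omega>. (V \<omega> / w) *\<^sub>R iexp (c * Z \<omega>) \<partial>M)"
      "measure (\<mu> V) A = (\<integral>\<omega>. V \<omega> * indicator A (Z \<omega>) \<partial>M) / w"
      if V: "integrable M V" "\<And>\<omega>. 0 \<le> V \<omega>" "(\<integral>\<omega>. V \<omega> \<partial>M) = w" for V
    proof -
      have [measurable]: "V \<in> borel_measurable M" using V by auto
      have "emeasure (density M (\<lambda>\<omega>. ennreal (V \<omega> / w))) (space M) = (\<integral>\<^sup>+\<omega>. ennreal (V \<omega> / w) \<partial>M)"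
        by (subst emeasure_density) (auto intro!: nn_integral_cong)
      also have "\<dots> = ennreal (\<integral>\<omega>. V \<omega> / w \<partial>M)"
        by (rule nn_integral_eq_integral) (use V w in auto)
      also have "\<dots> = 1" using V w by simp
      finally interpret D: prob_space "density M (\<lambda>\<omega>. ennreal (V \<omega> / w))" by (intro prob_spaceI) simp
      have "prob_space (\<mu> V)" unfolding \<mu>_def by (rule D.prob_space_distr) simp
      then show rd: "real_distribution (\<mu> V)"
        unfolding real_distribution_def real_distribution_axioms_def by (simp add: \<mu>_def)
      have gen: "(\<integral>x. f x \<partial>\<mu> V) = (\<integral>\<omega>. (V \<omega> / w) *\<^sub>R f (Z \<omega>) \<partial>M)"
        if [measurable]: "f \<in> borel_measurable borel" for f :: "real \<Rightarrow> 'c::{banach, second_countable_topology}"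
        unfolding \<mu>_def
        by (subst integral_distr, simp, simp, subst integral_density) (use V w in auto)
      show "char (\<mu> V) c = (\<integral>\<omega>. (V \<omega> / w) *\<^sub>R iexp (c * Z \<omega>) \<partial>M)" for c
        unfolding char_def by (rule gen) simp
      have "measure (\<mu> V) A = (\<integral>x. indicator A x \<partial>\<mu> V)"
        using A by (simp add: \<mu>_def)
      also have "\<dots> = (\<integral>\<omega>. (V \<omega> / w) *\<^sub>R indicator A (Z \<omega>) \<partial>M)" by (rule gen) (use A in simp)
      also have "\<dots> = (\<integral>\<omega>. V \<omega> * indicator A (Z \<omega>) / w \<partial>M)" by (intro Bochner_Integration.integral_cong) auto
      finally show "measure (\<mu> V) A = (\<integral>\<omega>. V \<omega> * indicator A (Z \<omega>) \<partial>M) / w" by simp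
    qed
    note p = props[OF int(1) nn(1) w_def[symmetric]]
    note n = props[OF int(2) nn(2) eq[symmetric, folded w_def]]
    have ie: "integrable M (\<lambda>\<omega>. complex_of_real (V \<omega>) * iexp (c * Z \<omega>))" if "integrable M V" for V c
    proof (rule Bochner_Integration.integrable_bound[OF that])
      show "(\<lambda>\<omega>. complex_of_real (V \<omega>) * iexp (c * Z \<omega>)) \<in> borel_measurable M" using that by measurable
    qed (simp add: norm_mult)
    have "char (\<mu> Wp) = char (\<mu> Wn)"
    proof
      fix c
      have "(\<integral>\<omega>. complex_of_real (Wp \<omega>) * iexp (c * Z \<omega>) \<partial>M) - (\<integral>\<omega>. complex_of_real (Wn \<omega>) * iexp (c * Z \<omega>) \<partial>M)
        = (\<integral>\<omega>. complex_of_real (W \<omega>) * iexp (c * Z \<omega>) \<partial>M)"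
        unfolding Wpn by (subst Bochner_Integration.integral_diff[symmetric]) (use ie int in \<open>auto simp: left_diff_distrib\<close>)
      then have same: "(\<integral>\<omega>. complex_of_real (Wp \<omega>) * iexp (c * Z \<omega>) \<partial>M) = (\<integral>\<omega>. complex_of_real (Wn \<omega>) * iexp (c * Z \<omega>) \<partial>M)"
        using fourier[of c] by simp
      have char_eq: "char (\<mu> V) c = (\<integral>\<omega>. complex_of_real (V \<omega>) * iexp (c * Z \<omega>) \<partial>M) / w"
        if "char (\<mu> V) c = (\<integral>\<omega>. (V \<omega> / w) *\<^sub>R iexp (c * Z \<omega>) \<partial>M)" for V
        unfolding that integral_divide_zero[symmetric]
        by (intro Bochner_Integration.integral_cong) (auto simp: scaleR_conv_of_real)
      show "char (\<mu> Wp) c = char (\<mu> Wn) c"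
        unfolding char_eq[OF p(2)] char_eq[OF n(2)] same ..
    qed
    then have "\<mu> Wp = \<mu> Wn" by (rule Levy_uniqueness[OF p(1) n(1)])
    then have "(\<integral>\<omega>. Wp \<omega> * indicator A (Z \<omega>) \<partial>M) = (\<integral>\<omega>. Wn \<omega> * indicator A (Z \<omega>) \<partial>M)"
      using p(3) n(3) w by simp
    moreover have "integrable M (\<lambda>\<omega>. V \<omega> * indicator A (Z \<omega>))" if "integrable M V" for V :: "'a \<Rightarrow> real"
    proof (rule Bochner_Integration.integrable_bound[OF that])
      note [measurable] = borel_measurable_integrable[OF that] A
      show "(\<lambda>\<omega>. V \<omega> * indicator A (Z \<omega>)) \<in> borel_measurable M" by measurable
    qed (auto simp: indicator_def)
    from Bochner_Integration.integral_diff[OF this[OF int(1)] this[OF int(2)]]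
    have "(\<integral>\<omega>. W \<omega> * indicator A (Z \<omega>) \<partial>M)
      = (\<integral>\<omega>. Wp \<omega> * indicator A (Z \<omega>) \<partial>M) - (\<integral>\<omega>. Wn \<omega> * indicator A (Z \<omega>) \<partial>M)"
      unfolding Wpn left_diff_distrib .
    ultimately show ?thesis by linarith
  qed
qed

text \<open>Conjugation replaces \<open>c\<close> by \<open>-c\<close>, so the real and imaginary parts of \<open>W\<close> satisfy the same
  hypothesis.\<close>

lemma (in prob_space) integral_indicator_eq_0_if_fourier_eq_0:
  fixes W :: "'a \<Rightarrow> complex" and Z :: "'a \<Rightarrow> real"
  assumes W: "integrable M W" and Z [measurable]: "Z \<in> borel_measurable M"
    and fourier: "\<And>c. (\<integral>\<omega>. W \<omega> * iexp (c * Z \<omega>) \<partial>M) = 0"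
    and A: "A \<in> sets borel"
  shows "(\<integral>\<omega>. W \<omega> * indicator A (Z \<omega>) \<partial>M) = 0"
proof -
  have [measurable]: "W \<in> borel_measurable M" using W by auto
  have ie: "integrable M (\<lambda>\<omega>. V \<omega> * iexp (c * Z \<omega>))" if "integrable M V" for V c
  proof (rule Bochner_Integration.integrable_bound[OF that])
    show "(\<lambda>\<omega>. V \<omega> * iexp (c * Z \<omega>)) \<in> borel_measurable M" using that by measurable
  qed (simp add: norm_mult)
  have iW: "integrable M (\<lambda>\<omega>. cnj (W \<omega>))" using W by simp
  have conj: "(\<integral>\<omega>. cnj (W \<omega>) * iexp (c * Z \<omega>) \<partial>M) = 0" for c
  proof -
    have "(\<integral>\<omega>. cnj (W \<omega>) * iexp (c * Z \<omega>) \<partial>M) = (\<integral>\<omega>. cnj (W \<omega> * iexp ((- c) * Z \<omega>)) \<partial>M)"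
      by (intro Bochner_Integration.integral_cong refl) (simp add: exp_cnj)
    also have "\<dots> = cnj (\<integral>\<omega>. W \<omega> * iexp ((- c) * Z \<omega>) \<partial>M)" by (rule Bochner_Integration.integral_cnj)
    finally show ?thesis using fourier[of "- c"] by simp
  qed
  have re: "(\<integral>\<omega>. complex_of_real (Re (W \<omega>)) * iexp (c * Z \<omega>) \<partial>M) = 0" for c
  proof -
    have "(\<integral>\<omega>. complex_of_real (Re (W \<omega>)) * iexp (c * Z \<omega>) \<partial>M)
       = (\<integral>\<omega>. (1/2) * (W \<omega> * iexp (c * Z \<omega>) + cnj (W \<omega>) * iexp (c * Z \<omega>)) \<partial>M)"
      by (intro Bochner_Integration.integral_cong refl) (simp add: distrib_right[symmetric] complex_add_cnj)
    also have "\<dots> = (1/2) * ((\<integral>\<omega>. W \<omega> * iexp (c * Z \<omega>) \<partial>M) + (\<integral>\<omega>. cnj (W \<omega>) * iexp (c * Z \<omega>) \<partial>M))"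
      unfolding integral_mult_right_zero
      by (intro arg_cong2[of _ _ _ _ "(*)"] refl Bochner_Integration.integral_add ie W iW)
    finally show ?thesis using fourier[of c] conj[of c] by simp
  qed
  have i_left: "complex_of_real x * (\<i> * y) = \<i> * (complex_of_real x * y)" for x y by (rule mult.left_commute)
  have im: "(\<integral>\<omega>. complex_of_real (Im (W \<omega>)) * iexp (c * Z \<omega>) \<partial>M) = 0" for c
  proof -
    have "(\<integral>\<omega>. complex_of_real (Im (W \<omega>)) * iexp (c * Z \<omega>) \<partial>M)
       = (\<integral>\<omega>. (- \<i>/2) * (W \<omega> * iexp (c * Z \<omega>) - cnj (W \<omega>) * iexp (c * Z \<omega>)) \<partial>M)"
      by (intro Bochner_Integration.integral_cong refl) (simp add: left_diff_distrib[symmetric] complex_diff_cnj i_left)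
    also have "\<dots> = (- \<i>/2) * ((\<integral>\<omega>. W \<omega> * iexp (c * Z \<omega>) \<partial>M) - (\<integral>\<omega>. cnj (W \<omega>) * iexp (c * Z \<omega>) \<partial>M))"
      unfolding integral_mult_right_zero
      by (intro arg_cong2[of _ _ _ _ "(*)"] refl Bochner_Integration.integral_diff ie W iW)
    finally show ?thesis using fourier[of c] conj[of c] by simp
  qed
  have int: "integrable M (\<lambda>\<omega>. W \<omega> * indicator A (Z \<omega>))"
  proof (rule Bochner_Integration.integrable_bound[OF W])
    show "(\<lambda>\<omega>. W \<omega> * indicator A (Z \<omega>)) \<in> borel_measurable M" using A by measurable
  qed (auto simp: indicator_def)
  have "Re (\<integral>\<omega>. W \<omega> * indicator A (Z \<omega>) \<partial>M) = (\<integral>\<omega>. Re (W \<omega>) * indicator A (Z \<omega>) \<partial>M)"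
    unfolding integral_Re[OF int, symmetric]
    by (intro Bochner_Integration.integral_cong refl) (auto simp: indicator_def)
  also have "\<dots> = 0"
    by (rule integral_indicator_eq_0_if_fourier_eq_0_real[OF _ Z re A]) (use W in auto)
  finally have 1: "Re (\<integral>\<omega>. W \<omega> * indicator A (Z \<omega>) \<partial>M) = 0" .
  have "Im (\<integral>\<omega>. W \<omega> * indicator A (Z \<omega>) \<partial>M) = (\<integral>\<omega>. Im (W \<omega>) * indicator A (Z \<omega>) \<partial>M)"
    unfolding integral_Im[OF int, symmetric]
    by (intro Bochner_Integration.integral_cong refl) (auto simp: indicator_def)
  also have "\<dots> = 0"
    by (rule integral_indicator_eq_0_if_fourier_eq_0_real[OF _ Z im A]) (use W in auto)
  finally have 2: "Im (\<integral>\<omega>. W \<omega> * indicator A (Z \<omega>) \<partial>M) = 0" .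
  show ?thesis using 1 2 by (simp add: complex_eq_iff)
qed

text \<open>A substitute for the uniqueness theorem in several variables: the exponentials are replaced by
  indicators one coordinate at a time, the remaining factors being absorbed into \<open>W\<close>.\<close>

lemma (in prob_space) integral_cylinder_eq_0:
  fixes W :: "'a \<Rightarrow> complex" and X :: "'i \<Rightarrow> 'a \<Rightarrow> real"
  assumes "finite F" "integrable M W" "\<And>j. j \<in> F \<Longrightarrow> X j \<in> borel_measurable M"
    and "\<And>c. (\<integral>\<omega>. W \<omega> * iexp (\<Sum>j\<in>F. c j * X j \<omega>) \<partial>M) = 0"
    and "\<And>j. j \<in> F \<Longrightarrow> A j \<in> sets borel"
  shows "(\<integral>\<omega>. W \<omega> * (\<Prod>j\<in>F. indicator (A j) (X j \<omega>)) \<partial>M) = 0"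
  using assms
proof (induction F arbitrary: W rule: finite_induct)
  case empty
  then show ?case by simp
next
  case (insert k F)
  note [measurable] = borel_measurable_integrable[OF insert.prems(1)]
  have [measurable]: "X k \<in> borel_measurable M" using insert by simp
  have XF [measurable]: "\<And>j. j \<in> F \<Longrightarrow> X j \<in> borel_measurable M" using insert by simp
  have Ak: "A k \<in> sets borel" using insert by simp
  have intW: "integrable M (\<lambda>\<omega>. W \<omega> * indicator (A k) (X k \<omega>))"
  proof (rule Bochner_Integration.integrable_bound[OF insert.prems(1)])
    show "(\<lambda>\<omega>. W \<omega> * indicator (A k) (X k \<omega>)) \<in> borel_measurable M" using Ak by measurable
  qed (auto simp: indicator_def)
  have "(\<integral>\<omega>. (W \<omega> * indicator (A k) (X k \<omega>)) * iexp (\<Sum>j\<in>F. c j * X j \<omega>) \<partial>M) = 0" for c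
  proof -
    have i: "integrable M (\<lambda>\<omega>. W \<omega> * iexp (\<Sum>j\<in>F. c j * X j \<omega>))"
    proof (rule Bochner_Integration.integrable_bound[OF insert.prems(1)])
      show "(\<lambda>\<omega>. W \<omega> * iexp (\<Sum>j\<in>F. c j * X j \<omega>)) \<in> borel_measurable M" by measurable
    qed (simp add: norm_mult)
    have "(\<integral>\<omega>. (W \<omega> * iexp (\<Sum>j\<in>F. c j * X j \<omega>)) * indicator (A k) (X k \<omega>) \<partial>M) = 0"
    proof (rule integral_indicator_eq_0_if_fourier_eq_0[OF i _ _ Ak])
      fix a
      have "(\<Sum>j\<in>insert k F. (c(k := a)) j * X j \<omega>) = a * X k \<omega> + (\<Sum>j\<in>F. c j * X j \<omega>)" for \<omega>
        using insert.hyps by (auto intro!: sum.cong)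
      then have "W \<omega> * iexp (\<Sum>j\<in>F. c j * X j \<omega>) * iexp (a * X k \<omega>)
          = W \<omega> * iexp (\<Sum>j\<in>insert k F. (c(k := a)) j * X j \<omega>)" for \<omega>
        by (simp add: exp_add[symmetric] algebra_simps)
      then show "(\<integral>\<omega>. W \<omega> * iexp (\<Sum>j\<in>F. c j * X j \<omega>) * iexp (a * X k \<omega>) \<partial>M) = 0"
        using insert.prems(3)[of "c(k := a)"] by presburger
    qed simp
    then show ?thesis by (simp add: mult_ac)
  qed
  from insert.IH[OF intW _ this] insert.prems
  have "(\<integral>\<omega>. W \<omega> * indicator (A k) (X k \<omega>) * (\<Prod>j\<in>F. indicator (A j) (X j \<omega>)) \<partial>M) = 0" by simp
  then show ?case using insert.hyps by (simp add: mult.assoc)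
qed

lemma generated_algebra_subalgebra:
  assumes "\<And>u. u \<in> J \<Longrightarrow> X u \<in> borel_measurable M"
  shows "subalgebra M (generated_algebra M X J)"
proof -
  have m: "(\<lambda>\<omega>. \<lambda>u\<in>J. X u \<omega>) \<in> measurable M (PiM J (\<lambda>_. borel))"
    by (rule measurable_restrict) (rule assms)
  have "sets (generated_algebra M X J) \<subseteq> sets M"
    unfolding generated_algebra_def
    by (subst sets_vimage_algebra2) (use m measurable_space[OF m] measurable_sets[OF m] in auto)
  then show ?thesis unfolding subalgebra_def generated_algebra_def by simp
qed

lemma measurable_generated_algebra:
  assumes "u \<in> J"
  shows "X u \<in> borel_measurable (generated_algebra M X J)"
proof -
  have "(\<lambda>\<omega>. \<lambda>u\<in>J. X u \<omega>) \<in> measurable (generated_algebra M X J) (PiM J (\<lambda>_. borel))"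
    unfolding generated_algebra_def by (rule measurable_vimage_algebra1) (auto simp: space_PiM)
  from measurable_compose[OF this measurable_component_singleton[OF assms]]
  show ?thesis using assms by simp
qed

text \<open>The cylinders are stable under intersection and generate the product algebra, so a Dynkin system
  argument extends the previous lemma to infinitely many coordinates.\<close>

lemma (in prob_space) integral_generated_algebra_eq_0:
  fixes W :: "'a \<Rightarrow> complex" and X :: "'i \<Rightarrow> 'a \<Rightarrow> real"
  assumes W: "integrable M W" and X: "\<And>u. u \<in> J \<Longrightarrow> X u \<in> borel_measurable M"
    and fourier: "\<And>F c. finite F \<Longrightarrow> F \<subseteq> J \<Longrightarrow> (\<integral>\<omega>. W \<omega> * iexp (\<Sum>j\<in>F. c j * X j \<omega>) \<partial>M) = 0"
    and A: "A \<in> sets (generated_algebra M X J)"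
  shows "(\<integral>\<omega>\<in>A. W \<omega> \<partial>M) = 0"
proof -
  define G where "G = (\<lambda>\<omega>. \<lambda>u\<in>J. X u \<omega>)"
  have G: "G \<in> measurable M (PiM J (\<lambda>_. borel))"
    unfolding G_def by (rule measurable_restrict) (rule X)
  define D where "D B = G -` B \<inter> space M" for B
  have D: "D B \<in> sets M" if "B \<in> sets (PiM J (\<lambda>_. borel))" for B
    unfolding D_def by (rule measurable_sets[OF G that])
  have int: "set_integrable M S W" if "S \<in> sets M" for S
    unfolding set_integrable_def by (rule integrable_mult_indicator[OF that W])
  have W0: "(\<integral>\<omega>. W \<omega> \<partial>M) = 0" using fourier[of "{}"] by simp
  have sp: "(\<Pi>\<^sub>E i\<in>J. space borel) = (\<Pi>\<^sub>E i\<in>J. (UNIV::real set))" by simp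
  have "(\<integral>\<omega>\<in>D B. W \<omega> \<partial>M) = 0" if "B \<in> sets (PiM J (\<lambda>_. borel :: real measure))" for B
  proof -
    have "B \<in> sigma_sets (\<Pi>\<^sub>E i\<in>J. space (borel :: real measure)) (prod_algebra J (\<lambda>_. borel :: real measure))"
      using that unfolding sets_PiM .
    from Int_stable_prod_algebra prod_algebra_sets_into_space this
    show ?thesis
    proof (induction rule: sigma_sets_induct_disjoint)
      case (basic B)
      from prod_algebraE[OF this] obtain F E where E: "B = prod_emb J (\<lambda>_. borel) F (\<Pi>\<^sub>E j\<in>F. E j)"
        "finite F" "F \<subseteq> J" "\<And>i. i \<in> F \<Longrightarrow> E i \<in> sets (borel :: real measure)" by metis
      have "indicator (D B) \<omega> = (\<Prod>j\<in>F. indicator (E j) (X j \<omega>) :: complex)" if "\<omega> \<in> space M" for \<omega>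
      proof -
        have "\<omega> \<in> D B \<longleftrightarrow> (\<forall>j\<in>F. X j \<omega> \<in> E j)"
          using that E(3) unfolding D_def E(1) G_def
          by (auto simp: prod_emb_iff PiE_iff subset_iff)
        moreover have "(\<Prod>j\<in>F. indicator (E j) (X j \<omega>) :: complex) = (if \<forall>j\<in>F. X j \<omega> \<in> E j then 1 else 0)"
          using E(2) by (auto intro!: prod.neutral simp: indicator_def)
        ultimately show ?thesis by (simp add: indicator_def)
      qed
      moreover have "indicator (D B) \<omega> *\<^sub>R W \<omega> = W \<omega> * indicator (D B) \<omega>" for \<omega> by (simp add: indicator_def)
      ultimately have "(\<integral>\<omega>\<in>D B. W \<omega> \<partial>M) = (\<integral>\<omega>. W \<omega> * (\<Prod>j\<in>F. indicator (E j) (X j \<omega>)) \<partial>M)"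
        unfolding set_lebesgue_integral_def by (intro Bochner_Integration.integral_cong refl) simp
      also have "\<dots> = 0"
        by (rule integral_cylinder_eq_0[OF E(2) W X fourier[OF E(2,3)] E(4)]) (use E(3) in auto)
      finally show ?case .
    next
      case empty
      show ?case by (simp add: D_def set_lebesgue_integral_def)
    next
      case (compl B)
      have B: "B \<in> sets (PiM J (\<lambda>_. borel))" using compl.hyps unfolding sets_PiM .
      have "D ((\<Pi>\<^sub>E i\<in>J. space borel) - B) = space M - D B"
        unfolding D_def using measurable_space[OF G] by (auto simp: space_PiM)
      then have "D ((\<Pi>\<^sub>E i\<in>J. space borel) - B) \<union> D B = space M" "D ((\<Pi>\<^sub>E i\<in>J. space borel) - B) \<inter> D B = {}"
        using D[OF B] sets.sets_into_space by auto
      then have "(\<integral>\<omega>\<in>space M. W \<omega> \<partial>M) = (\<integral>\<omega>\<in>D ((\<Pi>\<^sub>E i\<in>J. space borel) - B). W \<omega> \<partial>M) + (\<integral>\<omega>\<in>D B. W \<omega> \<partial>M)"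
        using set_integral_Un[of "D ((\<Pi>\<^sub>E i\<in>J. space borel) - B)" "D B" M W] int
          \<open>D ((\<Pi>\<^sub>E i\<in>J. space borel) - B) = space M - D B\<close> D[OF B] by auto
      moreover have "(\<integral>\<omega>\<in>space M. W \<omega> \<partial>M) = 0" using W0 by (simp add: set_integral_space W)
      ultimately show ?case using compl by simp
    next
      case (union B)
      have B: "B i \<in> sets (PiM J (\<lambda>_. borel))" for i using union.hyps unfolding sets_PiM by auto
      have "D (\<Union>i. B i) = (\<Union>i. D (B i))" unfolding D_def by auto
      moreover have "(\<integral>\<omega>\<in>(\<Union>i. D (B i)). W \<omega> \<partial>M) = (\<Sum>i. (\<integral>\<omega>\<in>D (B i). W \<omega> \<partial>M))"
      proof (rule lebesgue_integral_countable_add)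
        show "D (B i) \<inter> D (B j) = {}" if "i \<noteq> j" for i j
          using union.hyps that unfolding D_def disjoint_family_on_def by blast
        show "set_integrable M (\<Union>i. D (B i)) W" using D[OF B] by (intro int) auto
      qed (rule D[OF B])
      ultimately show ?case using union.IH by simp
    qed
  qed
  moreover obtain B where "B \<in> sets (PiM J (\<lambda>_. borel))" "A = D B"
    using A unfolding generated_algebra_def G_def[symmetric] D_def
    by (subst (asm) sets_vimage_algebra2) (use measurable_space[OF G] in auto)
  ultimately show ?thesis by simp
qed

section \<open>Square-integrable random variables\<close>

definition L2_space :: "'w measure \<Rightarrow> 'w measure \<Rightarrow> ('w \<Rightarrow> real) set" where
  "L2_space M F = {V. V \<in> borel_measurable F \<and> integrable M (\<lambda>\<omega>. (V \<omega>)\<^sup>2)}"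

definition L2_inner :: "'w measure \<Rightarrow> ('w \<Rightarrow> real) \<Rightarrow> ('w \<Rightarrow> real) \<Rightarrow> real" where
  "L2_inner M V W = (\<integral>\<omega>. V \<omega> * W \<omega> \<partial>M)"

abbreviation L2_sq :: "'w measure \<Rightarrow> ('w \<Rightarrow> real) \<Rightarrow> real" where "L2_sq M V \<equiv> L2_inner M V V"

lemma L2_space_subalgebra: "subalgebra M F \<Longrightarrow> L2_space M F \<subseteq> L2_space M M"
  unfolding L2_space_def using measurable_from_subalg by blast

lemma L2_mult_integrable:
  assumes "V \<in> L2_space M M" "W \<in> L2_space M M"
  shows "integrable M (\<lambda>\<omega>. V \<omega> * W \<omega>)"
proof (rule Bochner_Integration.integrable_bound)
  show "integrable M (\<lambda>\<omega>. (V \<omega>)\<^sup>2 + (W \<omega>)\<^sup>2)" using assms unfolding L2_space_def by auto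
  show "(\<lambda>\<omega>. V \<omega> * W \<omega>) \<in> borel_measurable M" using assms unfolding L2_space_def by auto
  have "\<bar>V \<omega> * W \<omega>\<bar> \<le> (V \<omega>)\<^sup>2 + (W \<omega>)\<^sup>2" for \<omega>
  proof -
    have "2 * (\<bar>V \<omega>\<bar> * \<bar>W \<omega>\<bar>) \<le> \<bar>V \<omega>\<bar>\<^sup>2 + \<bar>W \<omega>\<bar>\<^sup>2"
      using sum_squares_bound[of "\<bar>V \<omega>\<bar>" "\<bar>W \<omega>\<bar>"] by (simp add: mult.assoc)
    moreover have "0 \<le> \<bar>V \<omega>\<bar> * \<bar>W \<omega>\<bar>" by simp
    ultimately show ?thesis unfolding abs_mult power2_abs by linarith
  qed
  then show "AE \<omega> in M. norm (V \<omega> * W \<omega>) \<le> norm ((V \<omega>)\<^sup>2 + (W \<omega>)\<^sup>2)" by simp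
qed

context prob_space
begin

lemma L2_integrable: "V \<in> L2_space M M \<Longrightarrow> integrable M V"
  using L2_mult_integrable[of V M "\<lambda>_. 1"] unfolding L2_space_def by simp

lemma semi_inner_L2: "semi_inner (L2_space M M) (L2_inner M)"
proof
  fix f g :: "'a \<Rightarrow> real" and c :: real
  assume f: "f \<in> L2_space M M"
  show "(\<lambda>u. c * f u) \<in> L2_space M M" using f by (auto simp: L2_space_def power_mult_distrib)
  show "0 \<le> L2_inner M f f" unfolding L2_inner_def by simp
  assume g: "g \<in> L2_space M M"
  have sq: "(f \<omega> + g \<omega>)\<^sup>2 = (f \<omega>)\<^sup>2 + (g \<omega>)\<^sup>2 + 2 * (f \<omega> * g \<omega>)" for \<omega> by (simp add: power2_sum)
  show "(\<lambda>u. f u + g u) \<in> L2_space M M"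
    using f g L2_mult_integrable[OF f g] by (auto simp: L2_space_def sq)
  show "L2_inner M f g = L2_inner M g f" unfolding L2_inner_def by (simp add: mult.commute)
  show "L2_inner M (\<lambda>u. c * f u) g = c * L2_inner M f g" unfolding L2_inner_def by (simp add: mult.assoc)
  fix h assume h: "h \<in> L2_space M M"
  show "L2_inner M (\<lambda>u. f u + g u) h = L2_inner M f h + L2_inner M g h"
    unfolding L2_inner_def using L2_mult_integrable[OF f h] L2_mult_integrable[OF g h]
    by (simp add: distrib_right)
qed (simp add: L2_space_def)

lemma L2_norm_eq: "L2_sq M V = (\<integral>\<omega>. (V \<omega>)\<^sup>2 \<partial>M)"
  unfolding L2_inner_def by (simp add: power2_eq_square)

text \<open>The arithmetic-geometric mean inequality with a free parameter \<open>a\<close>, to be taken of the size of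
  the \<open>L\<^sup>2\<close> norm.\<close>

lemma L1_le_L2:
  assumes V: "V \<in> L2_space M M" and a: "a > 0"
  shows "(\<integral>\<omega>. \<bar>V \<omega>\<bar> \<partial>M) \<le> (L2_sq M V / a + a) / 2"
proof -
  have i: "integrable M (\<lambda>\<omega>. (V \<omega>)\<^sup>2)" using V unfolding L2_space_def by auto
  have "\<bar>V \<omega>\<bar> \<le> ((V \<omega>)\<^sup>2 / a + a) / 2" for \<omega>
  proof -
    have "2 * \<bar>V \<omega>\<bar> * a \<le> (V \<omega>)\<^sup>2 + a\<^sup>2" using sum_squares_bound[of "\<bar>V \<omega>\<bar>" a] by simp
    then show ?thesis using a by (simp add: field_simps power2_eq_square)
  qed
  then have "(\<integral>\<omega>. \<bar>V \<omega>\<bar> \<partial>M) \<le> (\<integral>\<omega>. ((V \<omega>)\<^sup>2 / a + a) / 2 \<partial>M)"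
    by (intro integral_mono) (use L2_integrable[OF V] i in auto)
  also have "\<dots> = (L2_sq M V / a + a) / 2" unfolding L2_norm_eq using i by (simp add: prob_space)
  finally show ?thesis .
qed

text \<open>A subsequence whose successive distances decay geometrically converges almost everywhere, since
  its increments are summable in \<open>L\<^sup>1\<close>; by Fatou's lemma its pointwise limit is the limit in norm.
  The limit inherits measurability with respect to the subalgebra.\<close>

lemma L2_complete:
  assumes sub: "subalgebra M F" and \<sigma>: "\<And>n. \<sigma> n \<in> L2_space M F"
    and cauchy: "\<And>\<epsilon>. \<epsilon> > 0 \<Longrightarrow> \<exists>N. \<forall>m\<ge>N. \<forall>n\<ge>N. L2_sq M (\<lambda>\<omega>. \<sigma> m \<omega> - \<sigma> n \<omega>) < \<epsilon>"
  shows "\<exists>p\<in>L2_space M F. (\<lambda>n. L2_sq M (\<lambda>\<omega>. \<sigma> n \<omega> - p \<omega>)) \<longlonglongrightarrow> 0"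
proof -
  interpret semi_inner "L2_space M M" "L2_inner M" by (rule semi_inner_L2)
  have \<sigma>M: "\<sigma> n \<in> L2_space M M" for n using \<sigma> L2_space_subalgebra[OF sub] by auto
  have [measurable]: "\<sigma> n \<in> borel_measurable M" for n using \<sigma>M unfolding L2_space_def by auto
  have \<sigma>F: "\<sigma> n \<in> borel_measurable F" for n using \<sigma> unfolding L2_space_def by auto
  let ?d = "\<lambda>m n. L2_sq M (\<lambda>\<omega>. \<sigma> m \<omega> - \<sigma> n \<omega>)"
  have "\<exists>N. \<forall>m\<ge>N. \<forall>n\<ge>N. ?d m n < (1/4)^k" for k by (rule cauchy) simp
  then obtain N where N: "\<And>k m n. m \<ge> N k \<Longrightarrow> n \<ge> N k \<Longrightarrow> ?d m n < (1/4)^k" by metis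
  define r where "r = rec_nat (N 0) (\<lambda>k x. max (Suc x) (N (Suc k)))"
  have rS: "r (Suc k) = max (Suc (r k)) (N (Suc k))" for k unfolding r_def by simp
  have rN: "N k \<le> r k" for k by (cases k) (simp_all add: r_def)
  have mono: "strict_mono r" unfolding strict_mono_Suc_iff rS by (simp add: less_max_iff_disj)
  have step: "(\<integral>\<omega>. \<bar>\<sigma> (r (Suc k)) \<omega> - \<sigma> (r k) \<omega>\<bar> \<partial>M) \<le> (1/2)^k" for k
  proof -
    have le: "?d (r (Suc k)) (r k) \<le> (1/4)^k"
      by (rule less_imp_le[OF N]) (use rN[of k] rS[of k] in auto)
    have "(\<integral>\<omega>. \<bar>\<sigma> (r (Suc k)) \<omega> - \<sigma> (r k) \<omega>\<bar> \<partial>M) \<le> (?d (r (Suc k)) (r k) / (1/2)^k + (1/2)^k) / 2"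
      by (rule L1_le_L2[OF diff_in[OF \<sigma>M \<sigma>M]]) simp
    also have "\<dots> \<le> ((1/4)^k / (1/2)^k + (1/2)^k) / 2"
      using le by (intro divide_right_mono add_right_mono) auto
    also have "(1/4::real)^k / (1/2)^k = (1/2)^k" unfolding power_divide[symmetric] by simp
    finally show ?thesis by simp
  qed
  have AEconv: "AE \<omega> in M. convergent (\<lambda>k. \<sigma> (r k) \<omega>)"
  proof -
    let ?D = "\<lambda>k \<omega>. \<bar>\<sigma> (r (Suc k)) \<omega> - \<sigma> (r k) \<omega>\<bar>"
    have "(\<integral>\<^sup>+\<omega>. (\<Sum>k. ennreal (?D k \<omega>)) \<partial>M) = (\<Sum>k. \<integral>\<^sup>+\<omega>. ennreal (?D k \<omega>) \<partial>M)"
      by (rule nn_integral_suminf) measurable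
    also have "\<dots> \<le> (\<Sum>k. ennreal ((1/2)^k))"
    proof (rule suminf_le)
      fix k
      have "(\<integral>\<^sup>+\<omega>. ennreal (?D k \<omega>) \<partial>M) = ennreal (\<integral>\<omega>. ?D k \<omega> \<partial>M)"
        by (rule nn_integral_eq_integral) (use L2_integrable[OF \<sigma>M] in auto)
      also have "\<dots> \<le> ennreal ((1/2)^k)" using step by (rule ennreal_leI)
      finally show "(\<integral>\<^sup>+\<omega>. ennreal (?D k \<omega>) \<partial>M) \<le> ennreal ((1/2)^k)" .
    qed auto
    also have "\<dots> = ennreal (\<Sum>k. (1/2)^k)" by (rule suminf_ennreal2) (auto intro: summable_geometric)
    also have "\<dots> < \<infinity>" by simp
    finally have "AE \<omega> in M. (\<Sum>k. ennreal (?D k \<omega>)) \<noteq> \<infinity>"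
      by (intro nn_integral_PInf_AE) auto
    then show ?thesis
    proof (rule AE_mp, intro AE_I2 impI)
      fix \<omega> assume "(\<Sum>k. ennreal (?D k \<omega>)) \<noteq> \<infinity>"
      then have "summable (\<lambda>k. ?D k \<omega>)" by (intro summable_suminf_not_top) auto
      then have "summable (\<lambda>k. \<sigma> (r (Suc k)) \<omega> - \<sigma> (r k) \<omega>)" by (rule summable_rabs_cancel)
      then show "convergent (\<lambda>k. \<sigma> (r k) \<omega>)" 
        unfolding summable_iff_convergent by (simp add: sum_lessThan_telescope[where f = "\<lambda>k. \<sigma> (r k) \<omega>"] convergent_diff_const_right_iff)
    qed
  qed
  define p where "p \<omega> = lim (\<lambda>k. \<sigma> (r k) \<omega>)" for \<omega>
  have pF: "p \<in> borel_measurable F" unfolding p_def[abs_def] using \<sigma>F by measurable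
  have [measurable]: "p \<in> borel_measurable M" by (rule measurable_from_subalg[OF sub pF])
  have close: "integrable M (\<lambda>\<omega>. (\<sigma> n \<omega> - p \<omega>)\<^sup>2) \<and> (\<integral>\<omega>. (\<sigma> n \<omega> - p \<omega>)\<^sup>2 \<partial>M) \<le> \<epsilon>"
    if e: "\<epsilon> > 0" and N': "\<forall>m\<ge>N'. \<forall>n\<ge>N'. ?d m n < \<epsilon>" and n: "n \<ge> N'" for \<epsilon> N' n
  proof -
    have "AE \<omega> in M. ennreal ((\<sigma> n \<omega> - p \<omega>)\<^sup>2) = liminf (\<lambda>k. ennreal ((\<sigma> n \<omega> - \<sigma> (r k) \<omega>)\<^sup>2))"
      using AEconv
    proof (rule AE_mp, intro AE_I2 impI)
      fix \<omega> assume "convergent (\<lambda>k. \<sigma> (r k) \<omega>)"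
      then have "(\<lambda>k. \<sigma> (r k) \<omega>) \<longlonglongrightarrow> p \<omega>" unfolding p_def by (simp add: convergent_LIMSEQ_iff)
      then have "(\<lambda>k. ennreal ((\<sigma> n \<omega> - \<sigma> (r k) \<omega>)\<^sup>2)) \<longlonglongrightarrow> ennreal ((\<sigma> n \<omega> - p \<omega>)\<^sup>2)"
        by (intro tendsto_intros)
      then show "ennreal ((\<sigma> n \<omega> - p \<omega>)\<^sup>2) = liminf (\<lambda>k. ennreal ((\<sigma> n \<omega> - \<sigma> (r k) \<omega>)\<^sup>2))"
        by (rule lim_imp_Liminf[OF sequentially_bot, symmetric])
    qed
    then have "(\<integral>\<^sup>+\<omega>. ennreal ((\<sigma> n \<omega> - p \<omega>)\<^sup>2) \<partial>M) = (\<integral>\<^sup>+\<omega>. liminf (\<lambda>k. ennreal ((\<sigma> n \<omega> - \<sigma> (r k) \<omega>)\<^sup>2)) \<partial>M)"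
      by (rule nn_integral_cong_AE)
    also have "\<dots> \<le> liminf (\<lambda>k. \<integral>\<^sup>+\<omega>. ennreal ((\<sigma> n \<omega> - \<sigma> (r k) \<omega>)\<^sup>2) \<partial>M)"
      by (rule nn_integral_liminf) measurable
    also have "\<dots> \<le> ennreal \<epsilon>"
    proof -
      have "\<forall>\<^sub>F k in sequentially. (\<integral>\<^sup>+\<omega>. ennreal ((\<sigma> n \<omega> - \<sigma> (r k) \<omega>)\<^sup>2) \<partial>M) \<le> ennreal \<epsilon>"
        unfolding eventually_sequentially
      proof (intro exI allI impI)
        fix k assume k: "N' \<le> k"
        have rk: "r k \<ge> N'" using strict_mono_imp_increasing[OF mono, of k] k by simp
        have "(\<integral>\<^sup>+\<omega>. ennreal ((\<sigma> n \<omega> - \<sigma> (r k) \<omega>)\<^sup>2) \<partial>M) = ennreal (?d n (r k))"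
          unfolding L2_norm_eq
          by (rule nn_integral_eq_integral) (use diff_in[OF \<sigma>M \<sigma>M] in \<open>auto simp: L2_space_def\<close>)
        also have "\<dots> \<le> ennreal \<epsilon>" by (rule ennreal_leI) (use N' n rk less_imp_le in blast)
        finally show "(\<integral>\<^sup>+\<omega>. ennreal ((\<sigma> n \<omega> - \<sigma> (r k) \<omega>)\<^sup>2) \<partial>M) \<le> ennreal \<epsilon>" .
      qed
      then have "liminf (\<lambda>k. \<integral>\<^sup>+\<omega>. ennreal ((\<sigma> n \<omega> - \<sigma> (r k) \<omega>)\<^sup>2) \<partial>M) \<le> liminf (\<lambda>k. ennreal \<epsilon>)"
        by (rule Liminf_mono)
      then show ?thesis by (simp add: Liminf_const)
    qed
    finally have le: "(\<integral>\<^sup>+\<omega>. ennreal ((\<sigma> n \<omega> - p \<omega>)\<^sup>2) \<partial>M) \<le> ennreal \<epsilon>" .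
    have "integrable M (\<lambda>\<omega>. (\<sigma> n \<omega> - p \<omega>)\<^sup>2)"
      by (rule integrableI_nonneg) (use le in \<open>auto simp: le_less_trans ennreal_less_top\<close>)
    moreover from this have "ennreal (\<integral>\<omega>. (\<sigma> n \<omega> - p \<omega>)\<^sup>2 \<partial>M) \<le> ennreal \<epsilon>"
      using le nn_integral_eq_integral[of M "\<lambda>\<omega>. (\<sigma> n \<omega> - p \<omega>)\<^sup>2"] by simp
    ultimately show ?thesis using e by simp
  qed
  obtain N1 where N1: "\<forall>m\<ge>N1. \<forall>n\<ge>N1. ?d m n < 1" using cauchy[of 1] by auto
  have "(\<lambda>\<omega>. \<sigma> N1 \<omega> - p \<omega>) \<in> L2_space M M"
    using close[OF _ N1, of N1] unfolding L2_space_def by simp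
  from diff_in[OF \<sigma>M[of N1] this] have pM: "p \<in> L2_space M M" by simp
  then have "p \<in> L2_space M F" using pF unfolding L2_space_def by auto
  moreover have "(\<lambda>n. L2_sq M (\<lambda>\<omega>. \<sigma> n \<omega> - p \<omega>)) \<longlonglongrightarrow> 0"
  proof (rule LIMSEQ_I)
    fix e :: real assume e: "0 < e"
    then obtain N' where N': "\<forall>m\<ge>N'. \<forall>n\<ge>N'. ?d m n < e/2" using cauchy[of "e/2"] by auto
    have "norm (L2_sq M (\<lambda>\<omega>. \<sigma> n \<omega> - p \<omega>) - 0) < e" if "n \<ge> N'" for n
      using close[OF _ N' that] e nonneg[OF diff_in[OF \<sigma>M pM], of n] unfolding L2_norm_eq by simp
    then show "\<exists>no. \<forall>n\<ge>no. norm (L2_sq M (\<lambda>\<omega>. \<sigma> n \<omega> - p \<omega>) - 0) < e" by blast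
  qed
  ultimately show ?thesis by blast
qed

end

section \<open>Gaussian processes\<close>

context prob_space
begin

lemma gaussian_rv_in_L2:
  assumes "gaussian_rv M Y"
  shows "Y \<in> L2_space M M"
proof -
  have [measurable]: "Y \<in> borel_measurable M" using assms unfolding gaussian_rv_def by simp
  consider \<mu> where "AE \<omega> in M. Y \<omega> = \<mu>"
    | \<mu> \<sigma> where "0 < \<sigma>" "distributed M lborel Y (\<lambda>x. ennreal (normal_density \<mu> \<sigma> x))"
    using assms unfolding gaussian_rv_def by blast
  then have "integrable M (\<lambda>\<omega>. (Y \<omega>)\<^sup>2)"
  proof cases
    case 1
    then have "AE \<omega> in M. (Y \<omega>)\<^sup>2 = \<mu>\<^sup>2" by auto
    then show ?thesis by (subst integrable_cong_AE[of _ _ "\<lambda>_. \<mu>\<^sup>2"]) auto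
  next
    case 2
    have "integrable lborel (\<lambda>x. normal_density \<mu> \<sigma> x * (x - \<mu>)^2 + (2 * \<mu>) * (normal_density \<mu> \<sigma> x * (x - \<mu>)^1)
        + \<mu>\<^sup>2 * (normal_density \<mu> \<sigma> x * (x - \<mu>)^0))"
      by (intro Bochner_Integration.integrable_add integrable_mult_right integrable_normal_moment 2)
    then have "integrable lborel (\<lambda>x. normal_density \<mu> \<sigma> x * x\<^sup>2)"
      by (rule iffD1[OF Bochner_Integration.integrable_cong[OF refl], rotated])
        (simp add: power2_eq_square algebra_simps)
    then show ?thesis
      by (subst (asm) distributed_integrable[OF 2(2), of "\<lambda>x. x\<^sup>2"]) auto
  qed
  then show ?thesis unfolding L2_space_def by simp
qed

lemma gaussian_rv_characteristic:
  assumes Y: "gaussian_rv M Y" and mean: "expectation Y = 0"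
  shows "(\<integral>\<omega>. iexp (Y \<omega>) \<partial>M) = complex_of_real (exp (- (\<integral>\<omega>. (Y \<omega>)\<^sup>2 \<partial>M) / 2))"
proof -
  have [measurable]: "Y \<in> borel_measurable M" using Y unfolding gaussian_rv_def by simp
  consider \<mu> where "AE \<omega> in M. Y \<omega> = \<mu>"
    | \<mu> \<sigma> where "0 < \<sigma>" "distributed M lborel Y (\<lambda>x. ennreal (normal_density \<mu> \<sigma> x))"
    using Y unfolding gaussian_rv_def by blast
  then show ?thesis
  proof cases
    case 1
    have "expectation Y = (\<integral>\<omega>. \<mu> \<partial>M)" by (rule integral_cong_AE) (use 1 in auto)
    then have "AE \<omega> in M. Y \<omega> = 0" using 1 mean by (simp add: prob_space)
    then have "(\<integral>\<omega>. iexp (Y \<omega>) \<partial>M) = (\<integral>\<omega>. 1 \<partial>M)" "(\<integral>\<omega>. (Y \<omega>)\<^sup>2 \<partial>M) = (\<integral>\<omega>. 0 \<partial>M)"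
      by (intro integral_cong_AE; auto)+
    then show ?thesis by (simp add: prob_space)
  next
    case 2
    have \<mu>: "\<mu> = 0" using normal_distributed_expectation[OF 2] mean by simp
    have var: "(\<integral>\<omega>. (Y \<omega>)\<^sup>2 \<partial>M) = \<sigma>\<^sup>2" using normal_distributed_variance[OF 2] mean by simp
    have D: "distributed M lborel (\<lambda>\<omega>. Y \<omega> / \<sigma>) std_normal_density"
      using normal_standard_normal_convert[OF 2(1), of Y \<mu>] 2(2) \<mu> by simp
    have eq: "distr M lborel (\<lambda>\<omega>. Y \<omega> / \<sigma>) = std_normal_distribution"
      using distributed_distr_eq_density[OF D] by simp
    have "char std_normal_distribution \<sigma> = (\<integral>\<omega>. iexp (\<sigma> * (Y \<omega> / \<sigma>)) \<partial>M)"
      unfolding char_def eq[symmetric] by (subst integral_distr) auto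
    also have "\<dots> = (\<integral>\<omega>. iexp (Y \<omega>) \<partial>M)" using 2(1) by simp
    finally show ?thesis unfolding char_std_normal_distribution var by simp
  qed
qed

end

lemma norm_iexp_diff_le: "cmod (iexp x - iexp y) \<le> \<bar>x - y\<bar>"
proof -
  have "iexp x - iexp y = iexp y * (iexp (x - y) - 1)"
    by (simp add: right_diff_distrib exp_add[symmetric] algebra_simps)
  then have "cmod (iexp x - iexp y) = cmod (iexp (x - y) - 1)" by (simp add: norm_mult)
  also have "\<dots> \<le> \<bar>x - y\<bar>" using iexp_approx1[of "x - y" 0] by simp
  finally show ?thesis .
qed

locale centered_gaussian_process =
  fixes M :: "'w measure" and I :: "'i set" and X :: "'i \<Rightarrow> 'w \<Rightarrow> real" and K :: "'i \<Rightarrow> 'i \<Rightarrow> real"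
  assumes gp: "mean_zero_gaussian_process M I X K"
begin

sublocale prob_space M
  using gp unfolding mean_zero_gaussian_process_def gaussian_process_def by simp

lemma gaussian_sum:
  assumes F: "finite F" "F \<subseteq> I"
  shows "gaussian_rv M (\<lambda>\<omega>. \<Sum>x\<in>F. c x * X x \<omega>)"
proof -
  obtain h where h: "bij_betw h {1..card F} F" using ex_bij_betw_nat_finite_1[OF F(1)] by blast
  have "(\<lambda>\<omega>. \<Sum>x\<in>F. c x * X x \<omega>) = (\<lambda>\<omega>. \<Sum>i=1..card F. c (h i) * X (h i) \<omega>)"
    by (rule ext) (rule sum.reindex_bij_betw[OF h, symmetric])
  moreover have "\<forall>i\<in>{1..card F}. h i \<in> I" using h F(2) unfolding bij_betw_def by blast
  then have "gaussian_rv M (\<lambda>\<omega>. \<Sum>i=1..card F. c (h i) * X (h i) \<omega>)"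
    using gp unfolding mean_zero_gaussian_process_def gaussian_process_def by simp
  ultimately show ?thesis by simp
qed

lemma X_L2: "t \<in> I \<Longrightarrow> X t \<in> L2_space M M"
  using gaussian_rv_in_L2[OF gaussian_sum[of "{t}" "\<lambda>_. 1"]] by simp

lemma X_measurable: "t \<in> I \<Longrightarrow> X t \<in> borel_measurable M"
  using X_L2 unfolding L2_space_def by auto

lemma subalgebra_generated: "J \<subseteq> I \<Longrightarrow> subalgebra M (generated_algebra M X J)"
  by (rule generated_algebra_subalgebra) (use X_measurable in auto)

lemma projection_measurable:
  assumes V: "V \<in> L2_space M M" and J: "J \<subseteq> I"
  shows "\<exists>p\<in>L2_space M (generated_algebra M X J). p \<in> closed_span (L2_space M M) (L2_inner M) X J \<and>
    (\<forall>x\<in>J. L2_inner M (\<lambda>u. V u - p u) (X x) = 0)"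
proof -
  interpret semi_inner "L2_space M M" "L2_inner M" by (rule semi_inner_L2)
  note sub = subalgebra_generated[OF J]
  have XJ: "X x \<in> L2_space M M" if "x \<in> J" for x using that J X_L2 by auto
  have span: "h \<in> L2_space M (generated_algebra M X J)" if h: "h \<in> span_of X J" for h
  proof -
    obtain F c where F: "h = (\<lambda>u. \<Sum>x\<in>F. c x * X x u)" "finite F" "F \<subseteq> J"
      using h unfolding span_of_def by blast
    have "h \<in> borel_measurable (generated_algebra M X J)"
      unfolding F(1)
    proof (intro borel_measurable_sum borel_measurable_times borel_measurable_const)
      show "X x \<in> borel_measurable (generated_algebra M X J)" if "x \<in> F" for x
        by (rule measurable_generated_algebra) (use that F in auto)
    qed
    moreover have "h \<in> L2_space M M" by (rule span_of_in[OF XJ h])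
    ultimately show ?thesis unfolding L2_space_def by auto
  qed
  show ?thesis
    by (rule projection_exists[OF V XJ L2_space_subalgebra[OF sub]])
      (use L2_complete[OF sub span] in blast)+
qed

sublocale L2: hilbert_family "L2_space M M" "L2_inner M" X I
proof -
  interpret semi_inner "L2_space M M" "L2_inner M" by (rule semi_inner_L2)
  show "hilbert_family (L2_space M M) (L2_inner M) X I"
    by unfold_locales (use X_L2 projection_measurable in blast)+
qed

lemma gram_eq: "s \<in> I \<Longrightarrow> t \<in> I \<Longrightarrow> L2.gram s t = K s t"
  using gp unfolding L2.gram_def L2_inner_def mean_zero_gaussian_process_def by simp

abbreviation "closure_span \<equiv> closed_span (L2_space M M) (L2_inner M) X"

lemma const_L2: "(\<lambda>_. c) \<in> L2_space M M"
  unfolding L2_space_def by simp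

lemma mean_zero_closed_span:
  assumes "V \<in> closure_span I"
  shows "(\<integral>\<omega>. V \<omega> \<partial>M) = 0"
proof -
  have "L2_inner M (\<lambda>_. 1) V = 0"
    by (rule L2.orthogonal_closed_span'[OF subset_refl const_L2 _ assms])
      (use gp in \<open>simp add: L2_inner_def mean_zero_gaussian_process_def\<close>)
  then show ?thesis unfolding L2_inner_def by simp
qed

text \<open>Linear combinations are centred Gaussian, and both sides of the formula are continuous in \<open>L\<^sup>2\<close>.\<close>

lemma characteristic_closed_span:
  assumes V: "V \<in> closure_span I"
  shows "(\<integral>\<omega>. iexp (V \<omega>) \<partial>M) = complex_of_real (exp (- L2_sq M V / 2))"
proof -
  have VH: "V \<in> L2_space M M" using V L2.closed_span_in by auto
  have "\<exists>h\<in>span_of X I. L2_sq M (\<lambda>u. V u - h u) < (1 / real (Suc n))\<^sup>2" for n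
    using V unfolding closed_span_def by simp
  then obtain h where h: "\<And>n. h n \<in> span_of X I"
    "\<And>n. L2_sq M (\<lambda>u. V u - h n u) < (1 / real (Suc n))\<^sup>2" by metis
  have hI: "h n \<in> closure_span I" for n
    by (rule L2.span_in_closed_span[OF h(1) L2.span_of_in[OF X_L2 h(1)]])
  have hH: "h n \<in> L2_space M M" for n using hI L2.closed_span_in by auto
  have char_h: "(\<integral>\<omega>. iexp (h n \<omega>) \<partial>M) = complex_of_real (exp (- L2_sq M (h n) / 2))" for n
  proof -
    obtain F c where F: "h n = (\<lambda>u. \<Sum>x\<in>F. c x * X x u)" "finite F" "F \<subseteq> I"
      using h(1) unfolding span_of_def by blast
    show ?thesis unfolding L2_norm_eq
      by (rule gaussian_rv_characteristic[OF _ mean_zero_closed_span[OF hI]])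
        (use gaussian_sum[OF F(2,3)] F(1) in simp)
  qed
  define d where "d n = L2_sq M (\<lambda>u. V u - h n u)" for n
  have inv: "(\<lambda>n. 1 / real (Suc n)) \<longlonglongrightarrow> 0" by (rule LIMSEQ_Suc[OF lim_const_over_n[of 1]])
  have d0: "d \<longlonglongrightarrow> 0"
  proof (rule tendsto_sandwich[OF _ _ tendsto_const])
    show "(\<lambda>n. (1 / real (Suc n))\<^sup>2) \<longlonglongrightarrow> 0" using tendsto_power[OF inv, of 2] by simp
    show "\<forall>\<^sub>F n in sequentially. 0 \<le> d n"
      unfolding d_def by (intro always_eventually allI L2.nonneg L2.diff_in VH hH)
    show "\<forall>\<^sub>F n in sequentially. d n \<le> (1 / real (Suc n))\<^sup>2"
      unfolding d_def by (intro always_eventually allI less_imp_le h(2))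
  qed
  have Vd: "(\<lambda>n. L2_inner M V (\<lambda>u. V u - h n u)) \<longlonglongrightarrow> 0"
  proof -
    have "(\<lambda>n. (L2_inner M V (\<lambda>u. V u - h n u))\<^sup>2) \<longlonglongrightarrow> 0"
    proof (rule tendsto_sandwich[OF _ _ tendsto_const])
      show "(\<lambda>n. (L2_sq M V + 1) * d n) \<longlonglongrightarrow> 0" by (rule tendsto_mult_right_zero[OF d0])
      show "\<forall>\<^sub>F n in sequentially. (L2_inner M V (\<lambda>u. V u - h n u))\<^sup>2 \<le> (L2_sq M V + 1) * d n"
      proof (intro always_eventually allI)
        fix n
        have "L2_inner M V (\<lambda>u. V u - h n u) = L2_inner M (\<lambda>u. V u - h n u) V"
          by (rule L2.sym) (intro L2.diff_in VH hH)+
        then show "(L2_inner M V (\<lambda>u. V u - h n u))\<^sup>2 \<le> (L2_sq M V + 1) * d n"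
          unfolding d_def using L2.weak_Cauchy_Schwarz[OF L2.diff_in[OF VH hH] VH] by simp
      qed
    qed simp
    then show ?thesis by (simp add: tendsto_null_power)
  qed
  have "L2_sq M (h n) = L2_sq M V - 2 * L2_inner M V (\<lambda>u. V u - h n u) + d n" for n
    unfolding d_def L2.norm_diff[OF VH hH] L2.diff_right[OF VH VH hH] by simp
  then have "(\<lambda>n. L2_sq M (h n)) \<longlonglongrightarrow> L2_sq M V - 2 * 0 + 0"
    by (simp only:) (intro tendsto_intros Vd d0)
  then have lim1: "(\<lambda>n. complex_of_real (exp (- L2_sq M (h n) / 2))) \<longlonglongrightarrow>
      complex_of_real (exp (- L2_sq M V / 2))"
    by (intro tendsto_intros) simp_all
  have meas: "W \<in> borel_measurable M" if "W \<in> L2_space M M" for W using that unfolding L2_space_def by auto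
  have ie: "integrable M (\<lambda>\<omega>. iexp (W \<omega>))" if "W \<in> L2_space M M" for W
    by (rule integrable_const_bound[of _ 1]) (use meas[OF that] in auto)
  have "(\<lambda>n. (\<integral>\<omega>. iexp (h n \<omega>) \<partial>M) - (\<integral>\<omega>. iexp (V \<omega>) \<partial>M)) \<longlonglongrightarrow> 0"
  proof (rule Lim_null_comparison)
    show "(\<lambda>n. 1 / real (Suc n)) \<longlonglongrightarrow> 0" by (rule inv)
    show "\<forall>\<^sub>F n in sequentially. norm ((\<integral>\<omega>. iexp (h n \<omega>) \<partial>M) - (\<integral>\<omega>. iexp (V \<omega>) \<partial>M)) \<le> 1 / real (Suc n)"
    proof (intro always_eventually allI)
      fix n
      note dH = L2.diff_in[OF VH hH]
      let ?a = "1 / real (Suc n)"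
      have "norm ((\<integral>\<omega>. iexp (h n \<omega>) \<partial>M) - (\<integral>\<omega>. iexp (V \<omega>) \<partial>M)) = norm (\<integral>\<omega>. iexp (h n \<omega>) - iexp (V \<omega>) \<partial>M)"
        using ie[OF hH] ie[OF VH] by simp
      also have "\<dots> \<le> (\<integral>\<omega>. norm (iexp (h n \<omega>) - iexp (V \<omega>)) \<partial>M)" by (rule integral_norm_bound)
      also have "\<dots> \<le> (\<integral>\<omega>. \<bar>V \<omega> - h n \<omega>\<bar> \<partial>M)"
      proof (rule integral_mono)
        show "integrable M (\<lambda>\<omega>. norm (iexp (h n \<omega>) - iexp (V \<omega>)))"
          using ie[OF hH] ie[OF VH] by (intro integrable_norm Bochner_Integration.integrable_diff)
        show "integrable M (\<lambda>\<omega>. \<bar>V \<omega> - h n \<omega>\<bar>)" using L2_integrable[OF dH] by simp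
        show "norm (iexp (h n \<omega>) - iexp (V \<omega>)) \<le> \<bar>V \<omega> - h n \<omega>\<bar>" for \<omega>
          using norm_iexp_diff_le[of "h n \<omega>" "V \<omega>"] by (simp add: abs_minus_commute)
      qed
      also have "\<dots> \<le> (d n / ?a + ?a) / 2" unfolding d_def by (rule L1_le_L2[OF dH]) simp
      also have "\<dots> \<le> (?a\<^sup>2 / ?a + ?a) / 2"
        using h(2)[of n] unfolding d_def by (intro divide_right_mono add_right_mono) auto
      also have "\<dots> = ?a"
      proof -
        have "(a\<^sup>2 / a + a) / 2 = a" if "a \<noteq> 0" for a :: real using that by (simp add: power2_eq_square)
        from this[of ?a] show ?thesis by (simp del: of_nat_Suc)
      qed
      finally show "norm ((\<integral>\<omega>. iexp (h n \<omega>) \<partial>M) - (\<integral>\<omega>. iexp (V \<omega>) \<partial>M)) \<le> ?a" .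
    qed
  qed
  then have "(\<lambda>n. \<integral>\<omega>. iexp (h n \<omega>) \<partial>M) \<longlonglongrightarrow> (\<integral>\<omega>. iexp (V \<omega>) \<partial>M)" by (rule LIM_zero_cancel)
  then show ?thesis using lim1 unfolding char_h by (rule LIMSEQ_unique)
qed

text \<open>Orthogonality makes the characteristic function of \<open>a Y + Z\<close>, with \<open>Z\<close> in the span of \<open>X\<^sub>J\<close>, a
  product. Hence \<open>exp (i a Y)\<close> minus its mean integrates to zero over every event \<open>A\<close> generated by
  \<open>X\<^sub>J\<close>. For fixed \<open>A\<close> this holds for all \<open>a\<close>, so the centred indicator of \<open>A\<close> has
  conditional expectation zero given \<open>Y\<close>.\<close>

lemma independent_of_orthogonal:
  assumes J: "J \<subseteq> I" and Y: "Y \<in> closure_span I" and orth: "\<And>u. u \<in> J \<Longrightarrow> L2_inner M Y (X u) = 0"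
    and A: "A \<in> sets (generated_algebra M X J)"
    and g: "g \<in> borel_measurable borel" "integrable M (\<lambda>\<omega>. g (Y \<omega>) :: real)"
  shows "(\<integral>\<omega>\<in>A. g (Y \<omega>) \<partial>M) = prob A * (\<integral>\<omega>. g (Y \<omega>) \<partial>M)"
proof -
  note sub = subalgebra_generated[OF J]
  have AM [measurable]: "A \<in> sets M" using A sub unfolding subalgebra_def by auto
  have YH: "Y \<in> L2_space M M" using Y L2.closed_span_in by auto
  then have [measurable]: "Y \<in> borel_measurable M" unfolding L2_space_def by auto
  have ie: "integrable M (\<lambda>\<omega>. iexp (a * Y \<omega>))" for a
    by (rule integrable_const_bound[of _ 1]) auto
  define e where "e a = (\<integral>\<omega>. iexp (a * Y \<omega>) \<partial>M)" for a
  have "(\<integral>\<omega>\<in>A. (iexp (a * Y \<omega>) - e a) \<partial>M) = 0" for a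
  proof (rule integral_generated_algebra_eq_0[OF _ _ _ A])
    show "integrable M (\<lambda>\<omega>. iexp (a * Y \<omega>) - e a)" using ie by simp
    show "X u \<in> borel_measurable M" if "u \<in> J" for u using that J X_measurable by auto
    fix F c assume F: "finite F" "F \<subseteq> J"
    define Z where "Z = (\<lambda>\<omega>. \<Sum>j\<in>F. c j * X j \<omega>)"
    have ZJ: "Z \<in> span_of X J" unfolding Z_def by (rule span_ofI[OF F])
    have XI: "\<And>x. x \<in> I \<Longrightarrow> X x \<in> L2_space M M" by (rule X_L2)
    have ZH: "Z \<in> L2_space M M" by (rule L2.span_of_in[OF _ ZJ]) (use J X_L2 in auto)
    have ZI: "Z \<in> closure_span I"
      by (rule L2.span_in_closed_span[OF _ ZH]) (use ZJ span_of_mono[OF J, of X] in blast)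
    have [measurable]: "Z \<in> borel_measurable M" using ZH unfolding L2_space_def by auto
    have YZ: "L2_inner M Y Z = 0"
    proof -
      have "L2_inner M Y Z = (\<Sum>x\<in>F. c x * L2_inner M Y (X x))"
        unfolding Z_def by (rule L2.sum_right[OF F(1) _ YH]) (use F J X_L2 in auto)
      also have "\<dots> = 0" by (rule sum.neutral) (use F orth in auto)
      finally show ?thesis .
    qed
    have aY: "(\<lambda>\<omega>. a * Y \<omega>) \<in> closure_span I" by (rule L2.closed_span_scale[OF XI Y])
    have aYH: "(\<lambda>\<omega>. a * Y \<omega>) \<in> L2_space M M" using aY L2.closed_span_in by auto
    have sI: "(\<lambda>\<omega>. a * Y \<omega> + Z \<omega>) \<in> closure_span I" by (rule L2.closed_span_add[OF XI aY ZI])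
    have "L2_inner M (\<lambda>\<omega>. a * Y \<omega>) Z = 0" using L2.scale_left[OF YH ZH] YZ by simp
    then have "L2_sq M (\<lambda>\<omega>. a * Y \<omega> + Z \<omega>)
        = L2_sq M (\<lambda>\<omega>. a * Y \<omega>) + L2_sq M Z"
      using aYH ZH L2.sym[OF aYH ZH] by (simp add: L2.add_left L2.add_right L2.add_in)
    then have "(\<integral>\<omega>. iexp (a * Y \<omega> + Z \<omega>) \<partial>M) = e a * (\<integral>\<omega>. iexp (Z \<omega>) \<partial>M)"
      unfolding e_def characteristic_closed_span[OF aY] characteristic_closed_span[OF ZI]
        characteristic_closed_span[OF sI]
      by (simp add: exp_add[symmetric] of_real_mult[symmetric] diff_divide_distrib del: of_real_mult)
    moreover have "integrable M (\<lambda>\<omega>. iexp (a * Y \<omega> + Z \<omega>))" "integrable M (\<lambda>\<omega>. iexp (Z \<omega>))"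
      by (rule integrable_const_bound[of _ 1]; auto)+
    moreover have "(iexp (a * Y \<omega>) - e a) * iexp (Z \<omega>) = iexp (a * Y \<omega> + Z \<omega>) - e a * iexp (Z \<omega>)" for \<omega>
      by (simp add: algebra_simps exp_add[symmetric])
    ultimately have "(\<integral>\<omega>. (iexp (a * Y \<omega>) - e a) * iexp (Z \<omega>) \<partial>M) = 0" by simp
    then show "(\<integral>\<omega>. (iexp (a * Y \<omega>) - e a) * iexp (\<Sum>j\<in>F. c j * X j \<omega>) \<partial>M) = 0"
      unfolding Z_def .
  qed
  then have A0: "(\<integral>\<omega>\<in>A. (iexp (a * Y \<omega>) - e a) \<partial>M) = 0" for a .
  define U where "U \<omega> = indicator A \<omega> - prob A" for \<omega>
  have [measurable]: "U \<in> borel_measurable M" unfolding U_def[abs_def] by measurable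
  have Ubd: "\<bar>U \<omega>\<bar> \<le> 1" for \<omega> using prob_le_1[of A] measure_nonneg[of M A] unfolding U_def indicator_def by auto
  have Uint: "integrable M U" by (rule integrable_const_bound[of _ 1]) (use Ubd in auto)
  have "(\<integral>\<omega>. complex_of_real (U \<omega>) * iexp (a * Y \<omega>) \<partial>M) = 0" for a
  proof -
    have iA: "integrable M (\<lambda>\<omega>. indicator A \<omega> *\<^sub>R iexp (a * Y \<omega>))"
      by (rule integrable_mult_indicator[OF AM ie])
    have "(\<integral>\<omega>. complex_of_real (U \<omega>) * iexp (a * Y \<omega>) \<partial>M)
        = (\<integral>\<omega>. indicator A \<omega> *\<^sub>R iexp (a * Y \<omega>) - complex_of_real (prob A) * iexp (a * Y \<omega>) \<partial>M)"
      by (intro Bochner_Integration.integral_cong refl)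
        (simp add: U_def left_diff_distrib scaleR_conv_of_real)
    also have "\<dots> = (\<integral>\<omega>. indicator A \<omega> *\<^sub>R iexp (a * Y \<omega>) \<partial>M) - complex_of_real (prob A) * e a"
      unfolding e_def using iA ie by simp
    also have "\<dots> = (\<integral>\<omega>\<in>A. (iexp (a * Y \<omega>) - e a) \<partial>M)"
    proof -
      have "(\<integral>\<omega>\<in>A. (iexp (a * Y \<omega>) - e a) \<partial>M)
          = (\<integral>\<omega>. indicator A \<omega> *\<^sub>R iexp (a * Y \<omega>) - indicator A \<omega> *\<^sub>R e a \<partial>M)"
        unfolding set_lebesgue_integral_def by (simp add: scaleR_right_diff_distrib)
      also have "\<dots> = (\<integral>\<omega>. indicator A \<omega> *\<^sub>R iexp (a * Y \<omega>) \<partial>M) - (\<integral>\<omega>. indicator A \<omega> *\<^sub>R e a \<partial>M)"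
        by (rule Bochner_Integration.integral_diff[OF iA integrable_mult_indicator[OF AM]]) simp
      finally show ?thesis by (simp add: scaleR_conv_of_real)
    qed
    finally show ?thesis using A0 by simp
  qed
  then have U0: "(\<integral>\<omega>. U \<omega> * indicator B (Y \<omega>) \<partial>M) = 0" if "B \<in> sets borel" for B
    by (intro integral_indicator_eq_0_if_fourier_eq_0_real[OF Uint _ _ that]) auto
  define G where "G = vimage_algebra (space M) Y (borel :: real measure)"
  have subG: "subalgebra M G"
    unfolding subalgebra_def G_def by (auto simp: sets_vimage_algebra2 intro: measurable_sets)
  interpret G: finite_measure_subalgebra M G
    by unfold_locales (rule subG)
  have YG: "Y \<in> borel_measurable G" unfolding G_def by (rule measurable_vimage_algebra1) auto
  have "AE \<omega> in M. real_cond_exp M G U \<omega> = 0"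
  proof (rule G.real_cond_exp_charact[OF _ Uint])
    fix S assume "S \<in> sets G"
    then obtain B where B: "B \<in> sets borel" "S = Y -` B \<inter> space M"
      unfolding G_def by (auto simp: sets_vimage_algebra2)
    have "(\<integral>\<omega>\<in>S. U \<omega> \<partial>M) = (\<integral>\<omega>. U \<omega> * indicator B (Y \<omega>) \<partial>M)"
      unfolding set_lebesgue_integral_def
      by (intro Bochner_Integration.integral_cong refl) (auto simp: B(2) indicator_def)
    then show "(\<integral>\<omega>\<in>S. U \<omega> \<partial>M) = (\<integral>\<omega>\<in>S. 0 \<partial>M)" using U0[OF B(1)] by simp
  qed auto
  then have "(\<integral>\<omega>. g (Y \<omega>) * real_cond_exp M G U \<omega> \<partial>M) = 0"
    by (intro integral_eq_zero_AE) auto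
  moreover have gU: "integrable M (\<lambda>\<omega>. g (Y \<omega>) * U \<omega>)"
  proof (rule Bochner_Integration.integrable_bound[OF g(2)])
    note [measurable] = g(1)
    show "(\<lambda>\<omega>. g (Y \<omega>) * U \<omega>) \<in> borel_measurable M" by measurable
    show "AE \<omega> in M. norm (g (Y \<omega>) * U \<omega>) \<le> norm (g (Y \<omega>))"
      using Ubd by (simp add: abs_mult mult_left_le)
  qed
  ultimately have "(\<integral>\<omega>. g (Y \<omega>) * U \<omega> \<partial>M) = 0"
    using G.real_cond_exp_intg(2)[OF gU measurable_compose[OF YG g(1)]] by simp
  moreover have "(\<integral>\<omega>. g (Y \<omega>) * U \<omega> \<partial>M) = (\<integral>\<omega>\<in>A. g (Y \<omega>) \<partial>M) - prob A * (\<integral>\<omega>. g (Y \<omega>) \<partial>M)"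
  proof -
    have "(\<integral>\<omega>. g (Y \<omega>) * U \<omega> \<partial>M) = (\<integral>\<omega>. indicator A \<omega> *\<^sub>R g (Y \<omega>) - prob A * g (Y \<omega>) \<partial>M)"
      by (intro Bochner_Integration.integral_cong refl) (simp add: U_def algebra_simps)
    also have "\<dots> = (\<integral>\<omega>. indicator A \<omega> *\<^sub>R g (Y \<omega>) \<partial>M) - prob A * (\<integral>\<omega>. g (Y \<omega>) \<partial>M)"
      using integrable_mult_indicator[OF AM g(2)] g(2) by simp
    finally show ?thesis unfolding set_lebesgue_integral_def .
  qed
  ultimately show ?thesis by simp
qed

text \<open>The residuals \<open>Y\<close> of \<open>X\<^sub>s\<close> and \<open>Z\<close> of \<open>X\<^sub>t\<close>, as well as \<open>Y + Z\<close> and \<open>Y - Z\<close>, are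
  independent of \<open>X\<^sub>J\<close>. The first fact identifies the conditional expectations with the projections;
  the second, by polarisation, shows that the conditional expectation of \<open>Y Z\<close> is the
  constant \<open>\<langle>Y, Z\<rangle>\<close>.\<close>

lemma conditional_covariance_zero_iff:
  assumes J: "J \<subseteq> I" and s: "s \<in> I" and t: "t \<in> I"
  defines "F \<equiv> generated_algebra M X J"
  shows "(AE \<omega> in M. real_cond_exp M F
      (\<lambda>\<omega>. (X s \<omega> - real_cond_exp M F (X s) \<omega>) * (X t \<omega> - real_cond_exp M F (X t) \<omega>)) \<omega> = 0)
    \<longleftrightarrow> cond_uncorrelated K J s t"
proof -
  have sub: "subalgebra M F" unfolding F_def by (rule subalgebra_generated[OF J])
  interpret F: finite_measure_subalgebra M F by unfold_locales (rule sub)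
  have XI: "\<And>x. x \<in> I \<Longrightarrow> X x \<in> L2_space M M" by (rule X_L2)
  have resid: "\<exists>p. p \<in> L2_space M F \<and> p \<in> closure_span J \<and>
      (\<forall>x\<in>J. L2_inner M (\<lambda>u. X r u - p u) (X x) = 0) \<and> (\<lambda>u. X r u - p u) \<in> closure_span I \<and>
      (AE \<omega> in M. real_cond_exp M F (X r) \<omega> = p \<omega>)" if r: "r \<in> I" for r
  proof -
    obtain p where p: "p \<in> L2_space M F" "p \<in> closure_span J" "\<forall>x\<in>J. L2_inner M (\<lambda>u. X r u - p u) (X x) = 0"
      using projection_measurable[OF X_L2[OF r] J] unfolding F_def by blast
    have pI: "p \<in> closure_span I" using p(2) L2.closed_span_mono[OF J] by blast
    have Y: "(\<lambda>u. X r u - p u) \<in> closure_span I"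
      by (rule L2.closed_span_diff[OF XI L2.closed_span_base[of r I X, OF r X_L2[OF r]] pI])
    have int: "integrable M (X r)" "integrable M p"
      using L2_integrable X_L2[OF r] L2.closed_span_in[OF pI] by auto
    have "AE \<omega> in M. real_cond_exp M F (X r) \<omega> = p \<omega>"
    proof (rule F.real_cond_exp_charact[OF _ int])
      show "p \<in> borel_measurable F" using p(1) unfolding L2_space_def by simp
      fix A assume A: "A \<in> sets F"
      then have AM: "A \<in> sets M" using sub unfolding subalgebra_def by auto
      have "(\<integral>\<omega>\<in>A. (X r \<omega> - p \<omega>) \<partial>M) = prob A * (\<integral>\<omega>. X r \<omega> - p \<omega> \<partial>M)"
        using independent_of_orthogonal[OF J Y _ A[unfolded F_def], of "\<lambda>x. x"] p(3) int by simp
      also have "\<dots> = 0" using mean_zero_closed_span[OF Y] by simp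
      finally show "(\<integral>\<omega>\<in>A. X r \<omega> \<partial>M) = (\<integral>\<omega>\<in>A. p \<omega> \<partial>M)"
        unfolding set_lebesgue_integral_def
        using integrable_mult_indicator[OF AM int(1)] integrable_mult_indicator[OF AM int(2)]
        by (simp add: right_diff_distrib)
    qed
    then show ?thesis using p Y by blast
  qed
  obtain p where p: "p \<in> L2_space M F" "p \<in> closure_span J"
    "\<And>x. x \<in> J \<Longrightarrow> L2_inner M (\<lambda>u. X s u - p u) (X x) = 0" "(\<lambda>u. X s u - p u) \<in> closure_span I"
    "AE \<omega> in M. real_cond_exp M F (X s) \<omega> = p \<omega>" using resid[OF s] by blast
  obtain q where q: "q \<in> L2_space M F" "q \<in> closure_span J"
    "\<And>x. x \<in> J \<Longrightarrow> L2_inner M (\<lambda>u. X t u - q u) (X x) = 0" "(\<lambda>u. X t u - q u) \<in> closure_span I"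
    "AE \<omega> in M. real_cond_exp M F (X t) \<omega> = q \<omega>" using resid[OF t] by blast
  define Y Z where "Y = (\<lambda>u. X s u - p u)" and "Z = (\<lambda>u. X t u - q u)"
  note Y = p(4)[folded Y_def] and Z = q(4)[folded Z_def]
  have YH: "Y \<in> L2_space M M" and ZH: "Z \<in> L2_space M M" using Y Z L2.closed_span_in by auto
  have [measurable]: "Y \<in> borel_measurable M" "Z \<in> borel_measurable M" "X s \<in> borel_measurable M"
    "X t \<in> borel_measurable M" using YH ZH X_L2[OF s] X_L2[OF t] unfolding L2_space_def by auto
  have YZ: "integrable M (\<lambda>\<omega>. Y \<omega> * Z \<omega>)" by (rule L2_mult_integrable[OF YH ZH])
  have XJ: "X x \<in> L2_space M M" if "x \<in> J" for x using that J X_L2 by auto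
  have sq: "(\<integral>\<omega>\<in>A. (V \<omega>)\<^sup>2 \<partial>M) = prob A * (\<integral>\<omega>. (V \<omega>)\<^sup>2 \<partial>M)"
    if A: "A \<in> sets F" and V: "V \<in> closure_span I" "\<And>x. x \<in> J \<Longrightarrow> L2_inner M V (X x) = 0" for A V
    by (rule independent_of_orthogonal[OF J V A[unfolded F_def], of "\<lambda>x. x\<^sup>2"])
      (use L2.closed_span_in[OF V(1)] in \<open>auto simp: L2_space_def\<close>)
  have "AE \<omega> in M. real_cond_exp M F (\<lambda>\<omega>. Y \<omega> * Z \<omega>) \<omega> = L2_inner M Y Z"
  proof (rule F.real_cond_exp_charact[OF _ YZ])
    fix A assume A: "A \<in> sets F"
    then have AM: "A \<in> sets M" using sub unfolding subalgebra_def by auto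
    define P N where "P = (\<lambda>\<omega>. Y \<omega> + Z \<omega>)" and "N = (\<lambda>\<omega>. Y \<omega> - Z \<omega>)"
    have PI: "P \<in> closure_span I" unfolding P_def by (rule L2.closed_span_add[OF XI Y Z])
    have NI: "N \<in> closure_span I" unfolding N_def by (rule L2.closed_span_diff[OF XI Y Z])
    have "(\<integral>\<omega>\<in>A. (P \<omega>)\<^sup>2 \<partial>M) = prob A * (\<integral>\<omega>. (P \<omega>)\<^sup>2 \<partial>M)"
      by (rule sq[OF A PI]) (use L2.add_left[OF YH ZH XJ] p(3) q(3) in \<open>simp add: P_def Y_def Z_def\<close>)
    moreover have "(\<integral>\<omega>\<in>A. (N \<omega>)\<^sup>2 \<partial>M) = prob A * (\<integral>\<omega>. (N \<omega>)\<^sup>2 \<partial>M)"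
      by (rule sq[OF A NI]) (use L2.diff_left[OF YH ZH XJ] p(3) q(3) in \<open>simp add: N_def Y_def Z_def\<close>)
    moreover have prod: "Y \<omega> * Z \<omega> = (1/4) * ((P \<omega>)\<^sup>2 - (N \<omega>)\<^sup>2)" for \<omega>
      unfolding P_def N_def by (simp add: power2_eq_square algebra_simps)
    have int: "integrable M (\<lambda>\<omega>. (P \<omega>)\<^sup>2)" "integrable M (\<lambda>\<omega>. (N \<omega>)\<^sup>2)"
      using L2.closed_span_in[OF PI] L2.closed_span_in[OF NI] unfolding L2_space_def by auto
    have "(\<integral>\<omega>\<in>A. Y \<omega> * Z \<omega> \<partial>M) = (1/4) * ((\<integral>\<omega>\<in>A. (P \<omega>)\<^sup>2 \<partial>M) - (\<integral>\<omega>\<in>A. (N \<omega>)\<^sup>2 \<partial>M))"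
      unfolding prod set_lebesgue_integral_def
      using integrable_mult_indicator[OF AM int(1)] integrable_mult_indicator[OF AM int(2)]
      by (simp add: right_diff_distrib)
    moreover have "L2_inner M Y Z = (1/4) * ((\<integral>\<omega>. (P \<omega>)\<^sup>2 \<partial>M) - (\<integral>\<omega>. (N \<omega>)\<^sup>2 \<partial>M))"
      unfolding L2_inner_def prod using int by simp
    ultimately have "(\<integral>\<omega>\<in>A. Y \<omega> * Z \<omega> \<partial>M) = prob A * L2_inner M Y Z" by (simp add: right_diff_distrib)
    then show "(\<integral>\<omega>\<in>A. Y \<omega> * Z \<omega> \<partial>M) = (\<integral>\<omega>\<in>A. L2_inner M Y Z \<partial>M)"
      using AM by (simp add: set_lebesgue_integral_def)
  qed auto
  moreover have "AE \<omega> in M. real_cond_exp M F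
      (\<lambda>\<omega>. (X s \<omega> - real_cond_exp M F (X s) \<omega>) * (X t \<omega> - real_cond_exp M F (X t) \<omega>)) \<omega>
      = real_cond_exp M F (\<lambda>\<omega>. Y \<omega> * Z \<omega>) \<omega>"
  proof (rule F.real_cond_exp_cong)
    show "AE \<omega> in M. (X s \<omega> - real_cond_exp M F (X s) \<omega>) * (X t \<omega> - real_cond_exp M F (X t) \<omega>) = Y \<omega> * Z \<omega>"
      using p(5) q(5) by eventually_elim (simp add: Y_def Z_def)
  qed measurable
  ultimately have "AE \<omega> in M. (real_cond_exp M F
      (\<lambda>\<omega>. (X s \<omega> - real_cond_exp M F (X s) \<omega>) * (X t \<omega> - real_cond_exp M F (X t) \<omega>)) \<omega> = 0)
    \<longleftrightarrow> (L2_inner M Y Z = 0)"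
    by eventually_elim simp
  then have "(AE \<omega> in M. real_cond_exp M F
      (\<lambda>\<omega>. (X s \<omega> - real_cond_exp M F (X s) \<omega>) * (X t \<omega> - real_cond_exp M F (X t) \<omega>)) \<omega> = 0)
    \<longleftrightarrow> (AE \<omega> in M. L2_inner M Y Z = 0)"
    by (rule eventually_subst)
  also have "\<dots> \<longleftrightarrow> L2_inner M Y Z = 0" by (rule AE_const)
  also have "L2_inner M Y Z = L2_inner M Y (X t)"
  proof -
    have "L2_inner M Y q = 0"
      by (rule L2.orthogonal_closed_span'[OF J YH p(3)[folded Y_def] q(2)])
    then show ?thesis unfolding Z_def using L2.diff_right[OF YH X_L2[OF t] L2.closed_span_in[OF q(2)]] by simp
  qed
  also have "L2_inner M Y (X t) = 0 \<longleftrightarrow> cond_uncorrelated L2.gram J s t"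
    unfolding Y_def by (rule L2.residual_orthogonal_iff[OF J s t p(2,3)])
  also have "\<dots> \<longleftrightarrow> cond_uncorrelated K J s t"
    by (rule cond_uncorrelated_cong[OF gram_eq J s t])
  finally show ?thesis .
qed

lemma undirected_graphical_model_iff:
  "undirected_graphical_model M I E X \<longleftrightarrow>
    (\<forall>s\<in>I. \<forall>t\<in>I. \<forall>J. J \<subseteq> I \<and> separates I E J s t \<longrightarrow> cond_uncorrelated K J s t)"
  unfolding undirected_graphical_model_def Let_def using conditional_covariance_zero_iff by (simp cong: conj_cong)

end

section \<open>The canonical completion is the graphical completion\<close>

theorem theorem4p2:
  fixes I :: "real set" and m :: nat and Is :: "nat \<Rightarrow> real set"
    and \<Omega> :: "(real \<times> real) set" and K\<^sub>\<Omega> Kstar :: "real \<Rightarrow> real \<Rightarrow> real"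
  assumes "is_interval I"
    and "serrated_cover I m Is"
    and "\<Omega> = serrated_domain m Is"
    and "partial_covariance I \<Omega> K\<^sub>\<Omega>"
    and "Kstar = canonical_completion m Is K\<^sub>\<Omega>"
  shows "is_completion I \<Omega> K\<^sub>\<Omega> Kstar \<and>
    (\<forall>(M :: 'w measure) X. mean_zero_gaussian_process M I X Kstar \<longrightarrow>
       undirected_graphical_model M I \<Omega> X) \<and>
    (\<forall>K (M :: 'v measure) X. is_completion I \<Omega> K\<^sub>\<Omega> K \<and> mean_zero_gaussian_process M I X K \<and>
       undirected_graphical_model M I \<Omega> X \<longrightarrow> (\<forall>s\<in>I. \<forall>t\<in>I. K s t = Kstar s t))"
proof -
  interpret serrated_covariance I m Is K\<^sub>\<Omega>
    by unfold_locales (use assms in auto)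
  note defs = assms(3,5)
  have "undirected_graphical_model M I \<Omega> X" if gp: "mean_zero_gaussian_process M I X Kstar" for M :: "'w measure" and X
  proof -
    interpret centered_gaussian_process M I X Kstar by unfold_locales (rule gp)
    interpret markov_family I m Is "L2_space M M" "L2_inner M" X
    proof
      fix p s t assume p: "1 \<le> p" "p < m" and s: "s \<in> left_part p" and t: "t \<in> Is (Suc p)"
      have "cond_uncorrelated Kstar (overlap p) s t"
        using Kstar_cond_uncorrelated[OF p s t] unfolding defs .
      moreover have "s \<in> I" "t \<in> I" "overlap p \<subseteq> I"
        using s t left_part_subset[of p] Is_subset[of "Suc p"] Is_subset[of p] p unfolding overlap_def by auto
      ultimately show "cond_uncorrelated L2.gram (overlap p) s t"
        using cond_uncorrelated_cong[of I L2.gram Kstar "overlap p" s t, OF gram_eq] by simp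
    qed
    show ?thesis unfolding undirected_graphical_model_iff
    proof (intro ballI allI impI, elim conjE)
      fix s t J assume st: "s \<in> I" "t \<in> I" and J: "J \<subseteq> I" and sep: "separates I \<Omega> J s t"
      have "cond_uncorrelated L2.gram J s t"
        using cond_uncorrelated_of_separates[OF J _ st] sep unfolding defs by blast
      then show "cond_uncorrelated Kstar J s t"
        using cond_uncorrelated_cong[of I L2.gram Kstar J s t, OF gram_eq J st] by simp
    qed
  qed
  moreover have "K s t = Kstar s t"
    if K: "is_completion I \<Omega> K\<^sub>\<Omega> K" and gp: "mean_zero_gaussian_process M I X K"
      and gm: "undirected_graphical_model M I \<Omega> X" and st: "s \<in> I" "t \<in> I"
    for K and M :: "'v measure" and X s t
  proof -
    interpret centered_gaussian_process M I X K by unfold_locales (rule gp)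
    have "K s t = canonical_completion m Is K\<^sub>\<Omega> s t"
    proof (rule completion_unique[OF K[unfolded defs] is_completion_Kstar _ st])
      fix p s t assume p: "1 \<le> p" "p < m" and s: "s \<in> left_part p - Is (Suc p)" and t: "t \<in> Is (Suc p) - left_part p"
      have "s \<in> I" "t \<in> I" "overlap p \<subseteq> I"
        using s t left_part_subset[of p] Is_subset[of "Suc p"] Is_subset[of p] p unfolding overlap_def by auto
      moreover have "separates I \<Omega> (overlap p) s t"
        using overlap_separates[OF p s, of t] t unfolding defs by blast
      ultimately have "cond_uncorrelated K (overlap p) s t"
        using gm unfolding undirected_graphical_model_iff by blast
      then show "cond_uncorrelated K (overlap p) s t \<and> cond_uncorrelated (canonical_completion m Is K\<^sub>\<Omega>) (overlap p) s t"
        using Kstar_cond_uncorrelated[OF p, of s t] s t by blast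
    qed
    then show ?thesis unfolding defs .
  qed
  ultimately show ?thesis using is_completion_Kstar unfolding defs by blast
qed

end
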